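(* Let $y>0$ and $0<\varepsilon<\min\{y/2,1\}$. Let $X$ be a Lévy process with triplet $(\sigma^2,b,\nu)$ such that $\nu$ has a density $s$ which is bounded outside the interval $[-\varepsilon,\varepsilon]$ and which is $C^1$ in a neighborhood of $y$. Then the limit $$\frac{d_2}{2}:=\lim_{t\to0}\frac1t\left\{\frac1t\,\mathbb{P}(X_t\ge y)-\nu([y,\infty))\right\}$$ exists and $$\begin{aligned}\frac{d_2}{2}=&-\frac{\sigma^2}{2}s'(y)+b_\varepsilon s(y)+\int\int_0^x\{s(y-u)-s(y)\}\,du\;s_\varepsilon(x)\,dx\\&+\frac12\int\int\mathbf 1_{\{x+u\ge y\}}\,\bar s_\varepsilon(u)\,\bar s_\varepsilon(x)\,du\,dx-\lambda_\varepsilon\,\nu([y,\infty)).\end{aligned}$$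
   Context: A Lévy process $X=(X_t)_{t\ge0}$ has triplet $(\sigma^2,b,\nu)$ if $X_t=bt+\sigma W_t+\int_0^t\int_{|x|\le1}x\,(\mu-\bar\mu)(dx,ds)+\int_0^t\int_{|x|>1}x\,\mu(dx,ds)$, where $W$ is a standard Brownian motion and $\mu$ is an independent Poisson random measure on $\mathbb{R}_+\times(\mathbb{R}\setminus\{0\})$ with mean measure $\bar\mu(dx,dt)=\nu(dx)\,dt$, $\nu$ being a Lévy measure. Fix a truncation function $c_\varepsilon\in C^\infty(\mathbb{R})$ with $\mathbf 1_{[-\varepsilon/2,\varepsilon/2]}\le c_\varepsilon\le\mathbf 1_{[-\varepsilon,\varepsilon]}$ and put $\bar c_\varepsilon:=1-c_\varepsilon$, $s_\varepsilon:=c_\varepsilon s$, $\bar s_\varepsilon:=\bar c_\varepsilon s$, $\lambda_\varepsilon:=\int\bar c_\varepsilon(x)\,\nu(dx)$, $b_\varepsilon:=b-\int_{|x|\le1}x\,\bar c_\varepsilon(x)\,\nu(dx)$. For $x<0$, $\int_0^x$ denotes $-\int_x^0$. *)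

theory Defs
  imports "HOL-Probability.Probability"
begin

section \<open>Stochastic processes\<close>

text \<open>
  Real-valued processes indexed by \<open>t \<ge> 0\<close> are functions \<open>X :: real \<Rightarrow> 'a \<Rightarrow> real\<close>; their values
  at negative times are irrelevant.
\<close>

definition real_process :: "'a measure \<Rightarrow> (real \<Rightarrow> 'a \<Rightarrow> real) \<Rightarrow> bool" where
  "real_process M X \<longleftrightarrow> (\<forall>t\<ge>0. X t \<in> borel_measurable M)"

definition independent_increments :: "'a measure \<Rightarrow> (real \<Rightarrow> 'a \<Rightarrow> real) \<Rightarrow> bool" where
  "independent_increments M X \<longleftrightarrow>
    (\<forall>(n::nat) (t::nat \<Rightarrow> real). 0 \<le> t 0 \<and> (\<forall>i<n. t i \<le> t (Suc i)) \<longrightarrow>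
       prob_space.indep_vars M (\<lambda>_. borel) (\<lambda>i \<omega>. X (t (Suc i)) \<omega> - X (t i) \<omega>) {..<n})"

definition stationary_increments :: "'a measure \<Rightarrow> (real \<Rightarrow> 'a \<Rightarrow> real) \<Rightarrow> bool" where
  "stationary_increments M X \<longleftrightarrow>
    (\<forall>r\<ge>0. \<forall>h\<ge>0. distr M borel (\<lambda>\<omega>. X (r + h) \<omega> - X r \<omega>)
                 = distr M borel (\<lambda>\<omega>. X h \<omega> - X 0 \<omega>))"

definition cadlag :: "(real \<Rightarrow> real) \<Rightarrow> bool" where
  "cadlag f \<longleftrightarrow>
    (\<forall>t\<ge>0. continuous (at_right t) f) \<and> (\<forall>t>0. \<exists>l. (f \<longlongrightarrow> l) (at_left t))"

definition levy_process :: "'a measure \<Rightarrow> (real \<Rightarrow> 'a \<Rightarrow> real) \<Rightarrow> bool" where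
  "levy_process M X \<longleftrightarrow>
    prob_space M \<and> real_process M X \<and> (AE \<omega> in M. X 0 \<omega> = 0) \<and>
    independent_increments M X \<and> stationary_increments M X \<and>
    (AE \<omega> in M. cadlag (\<lambda>t. X t \<omega>))"

definition standard_brownian_motion :: "'a measure \<Rightarrow> (real \<Rightarrow> 'a \<Rightarrow> real) \<Rightarrow> bool" where
  "standard_brownian_motion M W \<longleftrightarrow>
    prob_space M \<and> real_process M W \<and> (AE \<omega> in M. W 0 \<omega> = 0) \<and>
    independent_increments M W \<and>
    (\<forall>r\<ge>0. \<forall>t>r. distributed M lborel (\<lambda>\<omega>. W t \<omega> - W r \<omega>) (normal_density 0 (sqrt (t - r)))) \<and>
    (AE \<omega> in M. continuous_on {0..} (\<lambda>t. W t \<omega>))"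

section \<open>Poisson random measures\<close>

definition poisson_random_measure ::
    "'a measure \<Rightarrow> ('a \<Rightarrow> 'b measure) \<Rightarrow> 'b measure \<Rightarrow> bool" where
  "poisson_random_measure M \<mu> m \<longleftrightarrow>
    prob_space M \<and>
    (\<forall>\<omega>\<in>space M. sets (\<mu> \<omega>) = sets m) \<and>
    (\<forall>A\<in>sets m. (\<lambda>\<omega>. emeasure (\<mu> \<omega>) A) \<in> borel_measurable M) \<and>
    (\<forall>A\<in>sets m. emeasure m A < \<infinity> \<longrightarrow>
       (\<forall>k::nat. measure M {\<omega> \<in> space M. emeasure (\<mu> \<omega>) A = of_nat k}
                 = measure m A ^ k / fact k * exp (- measure m A))) \<and>
    (\<forall>A\<in>sets m. emeasure m A = \<infinity> \<longrightarrow> (AE \<omega> in M. emeasure (\<mu> \<omega>) A = \<infinity>)) \<and>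
    (\<forall>(n::nat) (A::nat \<Rightarrow> 'b set). A ` {..<n} \<subseteq> sets m \<and> disjoint_family_on A {..<n} \<longrightarrow>
       prob_space.indep_vars M (\<lambda>_. borel) (\<lambda>i \<omega>. emeasure (\<mu> \<omega>) (A i)) {..<n})"

definition generated_sigma ::
    "'a measure \<Rightarrow> 'i set \<Rightarrow> ('i \<Rightarrow> 'a \<Rightarrow> 'b::topological_space) \<Rightarrow> 'a set set" where
  "generated_sigma M I Z =
    sigma_sets (space M) (\<Union>i\<in>I. {Z i -` B \<inter> space M | B. B \<in> sets borel})"

definition independent_of_random_measure ::
    "'a measure \<Rightarrow> (real \<Rightarrow> 'a \<Rightarrow> real) \<Rightarrow> ('a \<Rightarrow> 'b measure) \<Rightarrow> 'b measure \<Rightarrow> bool" where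
  "independent_of_random_measure M W \<mu> m \<longleftrightarrow>
    prob_space.indep_set M (generated_sigma M {0..} W)
      (generated_sigma M (sets m) (\<lambda>A \<omega>. emeasure (\<mu> \<omega>) A))"

section \<open>Levy processes with a given triplet\<close>

definition levy_measure :: "real measure \<Rightarrow> bool" where
  "levy_measure \<nu> \<longleftrightarrow> sets \<nu> = sets borel \<and> emeasure \<nu> {0} = 0 \<and>
    (\<integral>\<^sup>+x. ennreal (min 1 (x\<^sup>2)) \<partial>\<nu>) < \<infinity>"

text \<open>
  The measure \<open>\<nu>(dx) dt\<close> on pairs \<open>(time, jump size)\<close>. It lives on the whole plane but gives mass
  zero to the complement of \<open>[0,\<infinity>) \<times> (\<real> \<setminus> {0})\<close>, since \<open>\<nu> {0} = 0\<close>.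
\<close>

definition jump_mean_measure :: "real measure \<Rightarrow> (real \<times> real) measure" where
  "jump_mean_measure \<nu> = density lborel (indicator {0..}) \<Otimes>\<^sub>M \<nu>"

text \<open>
  \<open>compensated_jumps M \<mu> m t J\<close>: the variable \<open>J\<close> is the compensated integral
  \<open>\<integral>\<^sub>0\<^sup>t \<integral>\<^bsub>|x| \<le> 1\<^esub> x (\<mu> - m)(dx, ds)\<close>, i.e. the limit in mean square, as \<open>\<delta>\<close> tends to \<open>0\<close>, of the
  integrals over \<open>\<delta> < |x| \<le> 1\<close>, for which the integrals against \<open>\<mu>\<close> and \<open>m\<close> exist separately.
\<close>

definition compensated_jumps ::
    "'a measure \<Rightarrow> ('a \<Rightarrow> (real \<times> real) measure) \<Rightarrow> (real \<times> real) measure \<Rightarrow> real \<Rightarrow>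
     ('a \<Rightarrow> real) \<Rightarrow> bool" where
  "compensated_jumps M \<mu> m t J \<longleftrightarrow>
    J \<in> borel_measurable M \<and>
    ((\<lambda>\<delta>. \<integral>\<^sup>+\<omega>. ennreal
        (((LINT p:{0..t} \<times> {x. \<delta> < \<bar>x\<bar> \<and> \<bar>x\<bar> \<le> 1}|\<mu> \<omega>. snd p)
          - (LINT p:{0..t} \<times> {x. \<delta> < \<bar>x\<bar> \<and> \<bar>x\<bar> \<le> 1}|m. snd p)
          - J \<omega>)\<^sup>2) \<partial>M) \<longlongrightarrow> 0) (at_right 0)"

definition levy_process_with_triplet ::
    "'a measure \<Rightarrow> (real \<Rightarrow> 'a \<Rightarrow> real) \<Rightarrow> real \<Rightarrow> real \<Rightarrow> real measure \<Rightarrow> bool" where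
  "levy_process_with_triplet M X v b \<nu> \<longleftrightarrow>
    levy_process M X \<and> levy_measure \<nu> \<and>
    (\<exists>\<sigma> W \<mu> J.
       v = \<sigma>\<^sup>2 \<and>
       standard_brownian_motion M W \<and>
       poisson_random_measure M \<mu> (jump_mean_measure \<nu>) \<and>
       independent_of_random_measure M W \<mu> (jump_mean_measure \<nu>) \<and>
       (\<forall>t\<ge>0. compensated_jumps M \<mu> (jump_mean_measure \<nu>) t (J t) \<and>
          (AE \<omega> in M. X t \<omega> = b * t + \<sigma> * W t \<omega> + J t \<omega>
                            + (LINT p:{0..t} \<times> {x. 1 < \<bar>x\<bar>}|\<mu> \<omega>. snd p))))"

section \<open>Truncation\<close>

definition smooth :: "(real \<Rightarrow> real) \<Rightarrow> bool" where
  "smooth f \<longleftrightarrow> (\<forall>n x. (deriv ^^ n) f field_differentiable (at x))"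

definition truncation_function :: "real \<Rightarrow> (real \<Rightarrow> real) \<Rightarrow> bool" where
  "truncation_function \<epsilon> c \<longleftrightarrow> smooth c \<and>
    (\<forall>x. indicator {-\<epsilon>/2..\<epsilon>/2} x \<le> c x \<and> c x \<le> indicator {-\<epsilon>..\<epsilon>} x)"

definition small_part :: "(real \<Rightarrow> real) \<Rightarrow> (real \<Rightarrow> real) \<Rightarrow> real \<Rightarrow> real" where
  "small_part c s x = c x * s x"

definition large_part :: "(real \<Rightarrow> real) \<Rightarrow> (real \<Rightarrow> real) \<Rightarrow> real \<Rightarrow> real" where
  "large_part c s x = (1 - c x) * s x"

definition large_jump_intensity :: "(real \<Rightarrow> real) \<Rightarrow> real measure \<Rightarrow> real" where
  "large_jump_intensity c \<nu> = (LINT x|\<nu>. 1 - c x)"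

definition truncated_drift :: "(real \<Rightarrow> real) \<Rightarrow> real \<Rightarrow> real measure \<Rightarrow> real" where
  "truncated_drift c b \<nu> = b - (LINT x:{x. \<bar>x\<bar> \<le> 1}|\<nu>. x * (1 - c x))"

definition has_density :: "real measure \<Rightarrow> (real \<Rightarrow> real) \<Rightarrow> bool" where
  "has_density \<nu> s \<longleftrightarrow>
    s \<in> borel_measurable borel \<and> (\<forall>x. 0 \<le> s x) \<and> \<nu> = density lborel (\<lambda>x. ennreal (s x))"

end

theory Submission
  imports Defs "HOL-Real_Asymp.Real_Asymp"
begin

text \<open>
  Cut the jumps sharply at a small level \<open>\<delta>\<close> instead of using \<open>c\<close>, and let \<open>Z\<close> be the process without
  the jumps larger than \<open>\<delta>\<close>. The characteristic function of \<open>X t\<close> is that of \<open>Z\<close> times that of a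
  compound Poisson law, so by uniqueness the law of \<open>X t\<close> is a convolution, and conditioning on the
  number of large jumps gives, up to \<open>O(t\<^sup>3)\<close>,
  \<open>exp (- \<lambda> t) (P (Z \<ge> y) + t E (g Z) + t\<^sup>2 / 2 E (G Z))\<close>, where \<open>g z\<close> is the mass that \<open>\<nu>\<close> gives to the
  jumps \<open>x\<close> with \<open>\<bar>x\<bar> > \<delta>\<close> and \<open>x \<ge> y - z\<close>, and \<open>G\<close> is its analogue for two jumps.
  An exponential moment bound shows \<open>P (\<bar>Z\<bar> \<ge> r) = o(t\<^sup>2)\<close> when \<open>4 \<delta> \<le> r\<close>. Near \<open>0\<close> the function \<open>g\<close> is
  \<open>g 0 + s y sin z - s' y (1 - cos z)\<close> up to \<open>\<eta> (1 - cos z)\<close>, and the expectations of \<open>sin Z\<close> and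
  \<open>1 - cos Z\<close> are read off the characteristic function of \<open>Z\<close> at \<open>1\<close>; using these bounded functions in place
  of \<open>z\<close> and \<open>z\<^sup>2 / 2\<close> makes moments of \<open>Z\<close> unnecessary. The errors vanish as first \<open>t\<close>, then \<open>\<delta>\<close>, then
  \<open>\<eta>\<close> tends to \<open>0\<close>. Finally, the claimed coefficient does not depend on the truncation: if
  \<open>h = c - indicator {x. \<bar>x\<bar> \<le> \<delta>}\<close>, all terms containing \<open>h\<close> cancel, the quadratic one because \<open>2 \<epsilon> < y\<close>.
\<close>

section \<open>Poisson variables\<close>

text \<open>The compensated sum of small jumps is known merely as a limit in mean square. Rather
  than carrying the independence of \<open>Z\<close> and the large jumps through that limit,
  exponential functionals of the random measure are computed for jump sets bounded away from 0, the
  limit is taken in the formulas, and the product form of the characteristic function yields a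
  convolution. The sharp cut leaves \<open>\<delta>\<close> free. It must be small against the
  radius r of the Taylor expansion, because the Chernoff bound yields only powers of t below r /
  \<delta>, and the power 2 is required. But the mass and the drift produced by the cut may be
  unbounded as \<delta> shrinks, so errors such as (\<lambda> t)^3 / t^2 have to vanish at fixed
  \<delta>. What survives that first limit is controlled uniformly in \<delta>: the Taylor error
  contributes \<eta> times the limit of E (1 - cos Z) / t, which is at most \<sigma>^2 / 2 + V, and
  the other discrepancy is of the order of the variance of the small jumps.\<close>

text \<open>The library specifies \<open>poisson_pmf\<close> for positive rates only.\<close>

lemma exists_poisson_pmf:
  fixes a :: real
  assumes "0 \<le> a"
  obtains p :: "nat pmf" where "\<And>k. pmf p k = a ^ k / fact k * exp (- a)"
proof (cases "a = 0")
  case True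
  have "pmf (return_pmf 0 :: nat pmf) k = a ^ k / fact k * exp (- a)" for k
    using True by (cases k) (auto simp: pmf_return)
  then show ?thesis by (rule that)
next
  case False
  then have "0 < a" using assms by simp
  show ?thesis by (rule that[of "poisson_pmf a"]) (simp add: \<open>0 < a\<close>)
qed

lemma has_integral_nat_pmf:
  fixes p :: "nat pmf" and f :: "nat \<Rightarrow> 'b::{banach, second_countable_topology}"
  assumes "summable (\<lambda>k. pmf p k * norm (f k))"
  shows "integrable (measure_pmf p) f"
    and "(\<lambda>k. pmf p k *\<^sub>R f k) sums (LINT k|measure_pmf p. f k)"
proof -
  have i: "integrable (count_space UNIV) (\<lambda>k. pmf p k *\<^sub>R f k)"
    using assms by (simp add: integrable_count_space_nat_iff)
  show "integrable (measure_pmf p) f"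
    unfolding measure_pmf_eq_density
    by (subst integrable_density) (auto simp: i)
  have "(LINT k|measure_pmf p. f k) = (LINT k|count_space UNIV. pmf p k *\<^sub>R f k)"
    unfolding measure_pmf_eq_density by (subst integral_density) auto
  then show "(\<lambda>k. pmf p k *\<^sub>R f k) sums (LINT k|measure_pmf p. f k)"
    using sums_integral_count_space_nat[OF i] by simp
qed

text \<open>Any complex \<open>z\<close> is allowed because of the two uses: \<open>z\<close> is an
  exponential in the moments of Poisson counts, possibly of modulus above 1, and a value of a
  characteristic function in compound Poisson laws.\<close>

lemma poisson_pmf_exp:
  fixes a :: real and p :: "nat pmf" and z :: complex
  assumes p: "\<And>k. pmf p k = a ^ k / fact k * exp (- a)" and "0 \<le> a"
  shows "integrable (measure_pmf p) (\<lambda>k. z ^ k)"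
    and "(LINT k|measure_pmf p. z ^ k) = exp (of_real a * (z - 1))"
proof -
  have eq: "pmf p k *\<^sub>R z ^ k = exp (- of_real a) * ((of_real a * z) ^ k /\<^sub>R fact k)" for k
    unfolding p power_mult_distrib
    by (simp add: scaleR_conv_of_real divide_inverse exp_of_real[symmetric])
  have n: "norm (pmf p k *\<^sub>R z ^ k) = pmf p k * norm (z ^ k)" for k
    by simp
  have "summable (\<lambda>k. norm (pmf p k *\<^sub>R z ^ k))"
    unfolding eq norm_mult by (intro summable_mult summable_norm_exp)
  then have s: "summable (\<lambda>k. pmf p k * norm (z ^ k))"
    unfolding n .
  show "integrable (measure_pmf p) (\<lambda>k. z ^ k)"
    using has_integral_nat_pmf(1)[OF s] .
  have "(\<lambda>k. pmf p k *\<^sub>R z ^ k) sums (exp (- of_real a) * exp (of_real a * z))"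
    unfolding eq by (intro sums_mult exp_converges)
  then have "(LINT k|measure_pmf p. z ^ k) = exp (- of_real a) * exp (of_real a * z)"
    using has_integral_nat_pmf(2)[OF s] sums_unique2 by blast
  then show "(LINT k|measure_pmf p. z ^ k) = exp (of_real a * (z - 1))"
    by (simp add: exp_add[symmetric] algebra_simps)
qed

section \<open>Exponential functionals of Poisson random measures\<close>

locale prm = prob_space M for M :: "'a measure" +
  fixes \<mu> :: "'a \<Rightarrow> 'b measure" and m :: "'b measure"
  assumes prm: "poisson_random_measure M \<mu> m"
begin

lemma sets_mu: "\<omega> \<in> space M \<Longrightarrow> sets (\<mu> \<omega>) = sets m"
  using prm by (simp add: poisson_random_measure_def)

lemma emeasure_mu_measurable[measurable]:
  "A \<in> sets m \<Longrightarrow> (\<lambda>\<omega>. emeasure (\<mu> \<omega>) A) \<in> borel_measurable M"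
  using prm by (simp add: poisson_random_measure_def)

lemma measure_mu_measurable[measurable]:
  "A \<in> sets m \<Longrightarrow> (\<lambda>\<omega>. measure (\<mu> \<omega>) A) \<in> borel_measurable M"
  unfolding measure_def by measurable

lemma prob_mu:
  "A \<in> sets m \<Longrightarrow> emeasure m A < \<infinity> \<Longrightarrow> prob {\<omega> \<in> space M. emeasure (\<mu> \<omega>) A = of_nat k}
                 = measure m A ^ k / fact k * exp (- measure m A)"
  using prm by (simp add: poisson_random_measure_def)

text \<open>The definition prescribes the probabilities of the integer values only; since these add
  up to 1, all other values, including infinity, have probability 0.\<close>

lemma AE_mu_nat:
  assumes A: "A \<in> sets m" "emeasure m A < \<infinity>"
  shows "AE \<omega> in M. \<exists>k::nat. emeasure (\<mu> \<omega>) A = of_nat k"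
proof -
  let ?E = "\<lambda>k::nat. {\<omega> \<in> space M. emeasure (\<mu> \<omega>) A = of_nat k}"
  have E[measurable]: "?E k \<in> sets M" for k using A(1) by measurable
  have "(\<lambda>k. prob (?E k)) sums prob (\<Union>k. ?E k)"
    by (intro finite_measure_UNION) (auto simp: disjoint_family_on_def)
  moreover have "(\<lambda>k. prob (?E k)) sums 1"
  proof -
    have "(\<lambda>k. exp (- measure m A) * (measure m A ^ k /\<^sub>R fact k)) sums (exp (- measure m A) * exp (measure m A))"
      by (intro sums_mult exp_converges)
    then show ?thesis
      unfolding prob_mu[OF A] by (simp add: exp_add[symmetric] field_simps)
  qed
  ultimately have "prob (\<Union>k. ?E k) = 1" using sums_unique2 by blast
  then have "AE \<omega> in M. \<omega> \<in> (\<Union>k. ?E k)" by (subst prob_eq_1[symmetric]) auto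
  then show ?thesis by eventually_elim auto
qed

lemma has_integral_exp_mu:
  fixes z :: complex
  assumes A: "A \<in> sets m" "emeasure m A < \<infinity>"
  shows "has_bochner_integral M (\<lambda>\<omega>. exp (z * of_real (measure (\<mu> \<omega>) A)))
    (exp (of_real (measure m A) * (exp z - 1)))"
proof -
  obtain p :: "nat pmf" where p: "\<And>k. pmf p k = measure m A ^ k / fact k * exp (- measure m A)"
    by (rule exists_poisson_pmf[of "measure m A"]) auto
  \<comment> \<open>\<open>measure\<close> is real-valued even where the mass is infinite, so
    rounding gives an integer variable at every \<open>\<omega>\<close>; almost surely it is the
    true count.\<close>
  define K where "K \<omega> = nat \<lfloor>measure (\<mu> \<omega>) A\<rfloor>" for \<omega>
  have K[measurable]: "K \<in> measurable M (count_space UNIV)"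
    unfolding K_def using A(1) by measurable
  have AE_K: "AE \<omega> in M. emeasure (\<mu> \<omega>) A = of_nat (K \<omega>) \<and> measure (\<mu> \<omega>) A = real (K \<omega>)"
    using AE_mu_nat[OF A] by eventually_elim (auto simp: K_def measure_def)
  have "distr M (count_space UNIV) K = measure_pmf p"
  proof (rule measure_eqI_countable[of _ UNIV])
    fix k :: nat
    have "emeasure (distr M (count_space UNIV) K) {k} = emeasure M (K -` {k} \<inter> space M)"
      by (simp add: emeasure_distr)
    also have "\<dots> = emeasure M {\<omega> \<in> space M. emeasure (\<mu> \<omega>) A = of_nat k}"
      by (rule emeasure_eq_AE) (use AE_K A in \<open>auto elim!: eventually_mono\<close>)
    also have "\<dots> = emeasure (measure_pmf p) {k}"
      by (simp add: emeasure_eq_measure prob_mu[OF A] emeasure_pmf_single p)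
    finally show "emeasure (distr M (count_space UNIV) K) {k} = emeasure (measure_pmf p) {k}" .
  qed auto
  note dist = this
  have i: "integrable (distr M (count_space UNIV) K) (\<lambda>k. exp z ^ k)"
    unfolding dist using poisson_pmf_exp(1)[OF p] by simp
  have "(LINT k|distr M (count_space UNIV) K. exp z ^ k) = exp (of_real (measure m A) * (exp z - 1))"
    unfolding dist using poisson_pmf_exp(2)[OF p] by simp
  then have "has_bochner_integral M (\<lambda>\<omega>. exp z ^ K \<omega>) (exp (of_real (measure m A) * (exp z - 1)))"
    using i by (simp add: has_bochner_integral_iff integrable_distr_eq integral_distr)
  moreover have "AE \<omega> in M. exp z ^ K \<omega> = exp (z * of_real (measure (\<mu> \<omega>) A))"
    using AE_K by eventually_elim (simp add: exp_of_nat2_mult)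
  ultimately show ?thesis
    using A(1) by (subst has_bochner_integral_cong_AE[symmetric]) (auto simp: has_bochner_integral_iff)
qed

lemma AE_mu_finite:
  assumes "A \<in> sets m" "emeasure m A < \<infinity>"
  shows "AE \<omega> in M. emeasure (\<mu> \<omega>) A < \<infinity>"
  using AE_mu_nat[OF assms] by eventually_elim (auto simp: ennreal_of_nat_eq_real_of_nat)

lemma borel_measurable_mu: "\<omega> \<in> space M \<Longrightarrow> borel_measurable (\<mu> \<omega>) = borel_measurable m"
  by (intro measurable_cong_sets sets_mu refl)

lemma space_mu: "\<omega> \<in> space M \<Longrightarrow> space (\<mu> \<omega>) = space m"
  by (intro sets_eq_imp_space_eq sets_mu)

text \<open>\<open>N\<close> is kept general because measurability is needed for \<open>M\<close>
  and also for the sigma-algebra generated by the counts, through which independence passes from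
  \<open>\<mu>\<close> to integrals against it.\<close>

lemma nn_integral_mu_measurable:
  assumes N: "space N = space M" "\<And>A. A \<in> sets m \<Longrightarrow> (\<lambda>\<omega>. emeasure (\<mu> \<omega>) A) \<in> borel_measurable N"
  assumes f: "f \<in> borel_measurable m"
  shows "(\<lambda>\<omega>. \<integral>\<^sup>+p. f p \<partial>\<mu> \<omega>) \<in> borel_measurable N"
  using f
proof (induction f)
  case (cong f g)
  have eq: "(\<integral>\<^sup>+p. f p \<partial>\<mu> \<omega>) = (\<integral>\<^sup>+p. g p \<partial>\<mu> \<omega>)" if "\<omega> \<in> space N" for \<omega>
    using cong(3) that N(1) by (intro nn_integral_cong) (simp add: space_mu)
  show ?case
    by (rule measurable_cong[THEN iffD2], erule eq) (rule cong(4))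
next
  case (set A)
  then have eq: "(\<integral>\<^sup>+p. indicator A p \<partial>\<mu> \<omega>) = emeasure (\<mu> \<omega>) A" if "\<omega> \<in> space N" for \<omega>
    using that N(1) by (intro nn_integral_indicator) (simp add: sets_mu)
  show ?case
    by (rule measurable_cong[THEN iffD2], erule eq) (rule N(2)[OF set])
next
  case (mult u c)
  then have eq: "(\<integral>\<^sup>+p. c * u p \<partial>\<mu> \<omega>) = c * (\<integral>\<^sup>+p. u p \<partial>\<mu> \<omega>)" if "\<omega> \<in> space N" for \<omega>
    using that N(1) by (intro nn_integral_cmult) (simp add: borel_measurable_mu)
  show ?case
    by (rule measurable_cong[THEN iffD2], erule eq) (use mult(4) in simp)
next
  case (add u v)
  then have eq: "(\<integral>\<^sup>+p. v p + u p \<partial>\<mu> \<omega>) = (\<integral>\<^sup>+p. v p \<partial>\<mu> \<omega>) + (\<integral>\<^sup>+p. u p \<partial>\<mu> \<omega>)" if "\<omega> \<in> space N" for \<omega>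
    using that N(1) by (intro nn_integral_add) (simp_all add: borel_measurable_mu)
  show ?case
    by (rule measurable_cong[THEN iffD2], erule eq) (use add.IH in simp)
next
  case (seq U)
  have eq: "(\<integral>\<^sup>+p. (SUP i. U i) p \<partial>\<mu> \<omega>) = (SUP i. \<integral>\<^sup>+p. U i p \<partial>\<mu> \<omega>)" if "\<omega> \<in> space N" for \<omega>
    unfolding SUP_apply using seq(1) \<open>incseq U\<close> that N(1)
    by (intro nn_integral_monotone_convergence_SUP) (simp_all add: borel_measurable_mu)
  show ?case
    by (rule measurable_cong[THEN iffD2], erule eq) (intro borel_measurable_SUP countableI_type, use seq in blast)
qed

lemma integral_mu_measurable:
  fixes f :: "'b \<Rightarrow> real"
  assumes N: "space N = space M" "\<And>A. A \<in> sets m \<Longrightarrow> (\<lambda>\<omega>. emeasure (\<mu> \<omega>) A) \<in> borel_measurable N"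
  assumes f: "f \<in> borel_measurable m"
  shows "(\<lambda>\<omega>. LINT p|\<mu> \<omega>. f p) \<in> borel_measurable N"
proof -
  have [measurable]: "(\<lambda>\<omega>. \<integral>\<^sup>+p. ennreal (f p) \<partial>\<mu> \<omega>) \<in> borel_measurable N"
    "(\<lambda>\<omega>. \<integral>\<^sup>+p. ennreal (- f p) \<partial>\<mu> \<omega>) \<in> borel_measurable N"
    "(\<lambda>\<omega>. \<integral>\<^sup>+p. ennreal \<bar>f p\<bar> \<partial>\<mu> \<omega>) \<in> borel_measurable N"
    using f by (auto intro!: nn_integral_mu_measurable N)
  \<comment> \<open>The Bochner integral is 0 where \<open>f\<close> is not integrable, and
    integrability is itself a measurable condition on \<open>\<omega>\<close>.\<close>
  have *: "(LINT p|\<mu> \<omega>. f p) = (if (\<integral>\<^sup>+p. ennreal (norm (f p)) \<partial>\<mu> \<omega>) < \<infinity> then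
      enn2real (\<integral>\<^sup>+p. ennreal (f p) \<partial>\<mu> \<omega>) - enn2real (\<integral>\<^sup>+p. ennreal (- f p) \<partial>\<mu> \<omega>) else 0)"
    if "\<omega> \<in> space M" for \<omega>
    using f that
    by (auto simp: real_lebesgue_integral_def integrable_iff_bounded borel_measurable_mu not_integrable_integral_eq)
  show ?thesis
    by (subst measurable_cong[OF *]) (simp_all add: N(1))
qed

lemma integral_mu_measurable'[measurable]:
  fixes f :: "'b \<Rightarrow> real"
  shows "f \<in> borel_measurable m \<Longrightarrow> (\<lambda>\<omega>. LINT p|\<mu> \<omega>. f p) \<in> borel_measurable M"
  by (rule integral_mu_measurable) auto

text \<open>The level sets of the nonzero values are disjoint with finite mass, so their counts are
  independent Poisson variables and the expectation factorises. The value 0 is left out: its level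
  set may have infinite mass.\<close>

lemma has_integral_exp_simple:
  fixes f :: "'b \<Rightarrow> real" and z :: complex
  assumes f: "simple_function m f" and fin: "emeasure m {p \<in> space m. f p \<noteq> 0} < \<infinity>"
  shows "has_bochner_integral M (\<lambda>\<omega>. exp (z * of_real (LINT p|\<mu> \<omega>. f p)))
    (exp (CLINT p|m. exp (z * of_real (f p)) - 1))"
proof -
  let ?V = "f ` space m - {0}"
  have "finite ?V" using f by (simp add: simple_function_def)
  then obtain v where "bij_betw v {0..<card ?V} ?V"
    using ex_bij_betw_nat_finite by blast
  then obtain n where v: "bij_betw v {..<n} ?V"
    unfolding atLeast0LessThan by blast
  define A where "A i = f -` {v i} \<inter> space m" for i :: nat
  have A[measurable]: "A i \<in> sets m" for i
    unfolding A_def using f by (meson simple_functionD(2))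
  have v0: "v i \<noteq> 0" if "i < n" for i using v that by (auto simp: bij_betw_def)
  have S[measurable]: "{p \<in> space m. f p \<noteq> 0} \<in> sets m"
    using borel_measurable_simple_function[OF f] by measurable
  have Afin: "emeasure m (A i) < \<infinity>" if "i < n" for i
    by (rule le_less_trans[OF emeasure_mono[OF _ S] fin]) (use v0[OF that] in \<open>auto simp: A_def\<close>)
  have disj: "disjoint_family_on A {..<n}"
    using v unfolding disjoint_family_on_def A_def bij_betw_def inj_on_def by auto
  \<comment> \<open>Used with the embedding of the reals for the integral of \<open>f\<close>, and
    with \<open>exp (z * of_real x) - 1\<close> for the exponent; both vanish at 0.\<close>
  have rep: "g (f p) = (\<Sum>i<n. indicator (A i) p *\<^sub>R g (v i))" if "p \<in> space m" "g 0 = 0"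
    for p and g :: "real \<Rightarrow> complex"
  proof (cases "f p = 0")
    case True
    then have "p \<notin> A i" if "i < n" for i using v0[OF that] by (auto simp: A_def)
    then show ?thesis using True that by simp
  next
    case False
    then have "f p \<in> v ` {..<n}" using v that by (auto simp: bij_betw_def)
    then obtain j where j: "j < n" "f p = v j" by auto
    have "indicator (A i) p *\<^sub>R g (v i) = (if i = j then g (f p) else 0)" if "i < n" for i
      using v j that \<open>p \<in> space m\<close> by (auto simp: A_def bij_betw_def inj_on_def indicator_def)
    then have "(\<Sum>i<n. indicator (A i) p *\<^sub>R g (v i)) = (\<Sum>i<n. if i = j then g (f p) else 0)"
      by (intro sum.cong) auto
    then show ?thesis using j by simp
  qed
  have AE_fin: "AE \<omega> in M. \<forall>i<n. emeasure (\<mu> \<omega>) (A i) < \<infinity>"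
    using AE_mu_finite[OF A Afin] by (subst AE_all_countable) (auto intro!: AE_impI)
  have L: "AE \<omega> in M. (LINT p|\<mu> \<omega>. f p) = (\<Sum>i<n. measure (\<mu> \<omega>) (A i) * v i)"
    using AE_fin AE_space
  proof eventually_elim
    case (elim \<omega>)
    have "f p = (\<Sum>i<n. indicator (A i) p *\<^sub>R v i)" if "p \<in> space m" for p
      using arg_cong[OF rep[OF that, of complex_of_real], of Re] by simp
    then have "(LINT p|\<mu> \<omega>. f p) = (LINT p|\<mu> \<omega>. (\<Sum>i<n. indicator (A i) p *\<^sub>R v i))"
      using elim by (intro Bochner_Integration.integral_cong refl) (simp add: space_mu)
    also have "\<dots> = (\<Sum>i<n. measure (\<mu> \<omega>) (A i) * v i)"
      using elim by (subst Bochner_Integration.integral_sum)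
        (auto simp: sets_mu space_mu sets.Int_space_eq2 A)
    finally show ?case .
  qed
  have hi: "has_bochner_integral M (\<lambda>\<omega>. exp (z * of_real (v i) * of_real (measure (\<mu> \<omega>) (A i))))
    (exp (of_real (measure m (A i)) * (exp (z * of_real (v i)) - 1)))" if "i < n" for i
    by (rule has_integral_exp_mu[OF A Afin[OF that]])
  have "indep_vars (\<lambda>_. borel) (\<lambda>i \<omega>. emeasure (\<mu> \<omega>) (A i)) {..<n}"
    using prm disj A unfolding poisson_random_measure_def by blast
  then have "indep_vars (\<lambda>_. borel) (\<lambda>i \<omega>. (\<lambda>e. exp (z * of_real (v i) * of_real (enn2real e))) (emeasure (\<mu> \<omega>) (A i))) {..<n}"
    by (rule indep_vars_compose2) measurable
  then have ind: "indep_vars (\<lambda>_. borel) (\<lambda>i \<omega>. exp (z * of_real (v i) * of_real (measure (\<mu> \<omega>) (A i)))) {..<n}"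
    by (simp add: measure_def)
  have "has_bochner_integral M (\<lambda>\<omega>. \<Prod>i<n. exp (z * of_real (v i) * of_real (measure (\<mu> \<omega>) (A i))))
     (\<Prod>i<n. exp (of_real (measure m (A i)) * (exp (z * of_real (v i)) - 1)))"
    unfolding has_bochner_integral_iff
    using indep_vars_integrable[OF _ ind] indep_vars_lebesgue_integral[OF _ ind] hi
    by (auto simp: has_bochner_integral_iff)
  moreover have "(\<Prod>i<n. exp (of_real (measure m (A i)) * (exp (z * of_real (v i)) - 1)))
     = exp (CLINT p|m. exp (z * of_real (f p)) - 1)"
  proof -
    have "(CLINT p|m. exp (z * of_real (f p)) - 1) = (CLINT p|m. (\<Sum>i<n. indicator (A i) p *\<^sub>R (exp (z * of_real (v i)) - 1)))"
      by (intro Bochner_Integration.integral_cong refl) (use rep[of _ "\<lambda>x. exp (z * of_real x) - 1"] in simp)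
    also have "\<dots> = (\<Sum>i<n. measure m (A i) *\<^sub>R (exp (z * of_real (v i)) - 1))"
      using Afin by (subst Bochner_Integration.integral_sum) (auto simp: sets.Int_space_eq2 A)
    finally show ?thesis by (simp add: exp_sum scaleR_conv_of_real)
  qed
  moreover have "AE \<omega> in M. (\<Prod>i<n. exp (z * of_real (v i) * of_real (measure (\<mu> \<omega>) (A i)))) = exp (z * of_real (LINT p|\<mu> \<omega>. f p))"
    using L by eventually_elim (simp add: exp_sum[symmetric] sum_distrib_left mult_ac)
  ultimately show ?thesis
    using borel_measurable_simple_function[OF f]
    by (subst has_bochner_integral_cong_AE[symmetric]) (auto simp: has_bochner_integral_iff)
qed

lemma AE_integrable_mu_bounded:
  fixes f :: "'b \<Rightarrow> real"
  assumes f[measurable]: "f \<in> borel_measurable m" and B: "\<And>p. \<bar>f p\<bar> \<le> B"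
    and fin: "emeasure m {p \<in> space m. f p \<noteq> 0} < \<infinity>"
  shows "AE \<omega> in M. integrable (\<mu> \<omega>) f \<and>
    (LINT p|\<mu> \<omega>. \<bar>f p\<bar>) \<le> B * measure (\<mu> \<omega>) {p \<in> space m. f p \<noteq> 0}"
proof -
  let ?S = "{p \<in> space m. f p \<noteq> 0}"
  have S[measurable]: "?S \<in> sets m" by measurable
  have "0 \<le> B" using B[of undefined] by linarith
  show ?thesis
    using AE_mu_finite[OF S fin] AE_space
  proof eventually_elim
    case (elim \<omega>)
    note [simp] = borel_measurable_mu[OF elim(2)] sets_mu[OF elim(2)] space_mu[OF elim(2)]
    have i: "integrable (\<mu> \<omega>) (\<lambda>p. B * indicator ?S p)"
      using elim by (intro integrable_mult_right integrable_real_indicator) auto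
    have le: "AE p in \<mu> \<omega>. norm (f p) \<le> B * indicator ?S p"
      using B \<open>0 \<le> B\<close> by (intro AE_I2) (auto simp: indicator_def)
    have "integrable (\<mu> \<omega>) f"
      by (rule Bochner_Integration.integrable_bound[OF i]) (use le \<open>0 \<le> B\<close> in auto)
    moreover have "(LINT p|\<mu> \<omega>. \<bar>f p\<bar>) \<le> (LINT p|\<mu> \<omega>. B * indicator ?S p)"
      by (intro integral_mono_AE i integrable_abs calculation) (use le in auto)
    ultimately show ?case
      by (simp add: sets.Int_space_eq2)
  qed
qed

text \<open>Approximation by simple functions. The dominating variable is the exponential of a
  multiple of the number of points in the support of \<open>f\<close>, integrable because a Poisson
  variable has all exponential moments.\<close>

lemma has_integral_exp_bounded:
  fixes f :: "'b \<Rightarrow> real" and z :: complex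
  assumes f[measurable]: "f \<in> borel_measurable m" and B: "\<And>p. \<bar>f p\<bar> \<le> B"
    and fin: "emeasure m {p \<in> space m. f p \<noteq> 0} < \<infinity>"
  shows "has_bochner_integral M (\<lambda>\<omega>. exp (z * of_real (LINT p|\<mu> \<omega>. f p)))
    (exp (CLINT p|m. exp (z * of_real (f p)) - 1))"
proof -
  let ?S = "{p \<in> space m. f p \<noteq> 0}"
  have S[measurable]: "?S \<in> sets m" by measurable
  obtain F where F: "\<And>i. simple_function m (F i)" "\<And>p. p \<in> space m \<Longrightarrow> (\<lambda>i. F i p) \<longlonglongrightarrow> f p"
    "\<And>i p. p \<in> space m \<Longrightarrow> \<bar>F i p\<bar> \<le> 2 * \<bar>f p\<bar>"
    using borel_measurable_implies_sequence_metric[OF f, of 0] unfolding dist_real_def diff_0_right by metis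
  have [measurable]: "F i \<in> borel_measurable m" for i using F(1) by (rule borel_measurable_simple_function)
  \<comment> \<open>The approximants are controlled on \<open>space m\<close> only; \<open>G\<close>
    vanishes elsewhere so that the bound \<open>2 * B\<close> holds at every point, as
    \<open>AE_integrable_mu_bounded\<close> demands.\<close>
  define G where "G i p = (if p \<in> space m then F i p else 0)" for i p
  have G: "simple_function m (G i)" for i
    using F(1)[of i] by (subst simple_function_cong[where g = "F i"]) (auto simp: G_def)
  have GB: "\<bar>G i p\<bar> \<le> 2 * B" for i p
    using F(3)[of p i] B[of p] by (auto simp: G_def)
  have "0 \<le> B" using B[of undefined] by linarith
  have Gm[measurable]: "G i \<in> borel_measurable m" for i using G by (rule borel_measurable_simple_function)
  have Gfin: "emeasure m {p \<in> space m. G i p \<noteq> 0} < \<infinity>" for i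
    by (rule le_less_trans[OF emeasure_mono[OF _ S] fin]) (use F(3)[of _ i] in \<open>force simp: G_def\<close>)
  define L where "L \<omega> = (LINT p|\<mu> \<omega>. f p)" for \<omega>
  define Li where "Li i \<omega> = (LINT p|\<mu> \<omega>. G i p)" for i \<omega>
  have [measurable]: "L \<in> borel_measurable M" "Li i \<in> borel_measurable M" for i
    unfolding L_def Li_def by measurable
  have lim: "AE \<omega> in M. (\<lambda>i. Li i \<omega>) \<longlonglongrightarrow> L \<omega>"
    using AE_integrable_mu_bounded[OF f B fin] AE_space
  proof eventually_elim
    case (elim \<omega>)
    then have i: "integrable (\<mu> \<omega>) (\<lambda>p. 2 * \<bar>f p\<bar>)" by auto
    show ?case
      unfolding L_def Li_def
      by (rule integral_dominated_convergence[OF _ _ i])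
        (use elim F in \<open>auto simp: borel_measurable_mu space_mu G_def\<close>)
  qed
  define c where "c = cmod z * (2 * B)"
  have "0 \<le> c" using \<open>0 \<le> B\<close> by (simp add: c_def)
  have "has_bochner_integral M (\<lambda>\<omega>. exp (of_real c * of_real (measure (\<mu> \<omega>) ?S)))
    (exp (of_real (measure m ?S) * (exp (of_real c :: complex) - 1)))"
    by (rule has_integral_exp_mu[OF S fin])
  then have "integrable M (\<lambda>\<omega>. Re (exp (of_real c * of_real (measure (\<mu> \<omega>) ?S) :: complex)))"
    by (simp add: has_bochner_integral_iff)
  then have dom: "integrable M (\<lambda>\<omega>. exp (c * measure (\<mu> \<omega>) ?S))"
    by (simp add: Re_exp)
  have bd: "AE \<omega> in M. norm (exp (z * of_real (Li i \<omega>))) \<le> exp (c * measure (\<mu> \<omega>) ?S)" for i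
    using AE_integrable_mu_bounded[OF Gm[of i] GB[of i] Gfin[of i]] AE_mu_finite[OF S fin] AE_space
  proof eventually_elim
    case (elim \<omega>)
    have "\<bar>Li i \<omega>\<bar> \<le> (LINT p|\<mu> \<omega>. \<bar>G i p\<bar>)"
      unfolding Li_def using integral_norm_bound[of "\<mu> \<omega>" "G i"] by simp
    also have "\<dots> \<le> 2 * B * measure (\<mu> \<omega>) {p \<in> space m. G i p \<noteq> 0}"
      using elim by auto
    also have "\<dots> \<le> 2 * B * measure (\<mu> \<omega>) ?S"
    proof (intro mult_left_mono measure_mono_fmeasurable)
      show "{p \<in> space m. G i p \<noteq> 0} \<subseteq> ?S"
        using F(3)[of _ i] by (force simp: G_def)
    qed (use \<open>0 \<le> B\<close> elim in \<open>auto simp: sets_mu fmeasurable_def\<close>)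
    finally have "cmod z * \<bar>Li i \<omega>\<bar> \<le> cmod z * (2 * B * measure (\<mu> \<omega>) ?S)"
      by (intro mult_left_mono) auto
    moreover have "norm (exp (z * of_real (Li i \<omega>))) \<le> exp (cmod z * \<bar>Li i \<omega>\<bar>)"
      using norm_exp[of "z * of_real (Li i \<omega>)"] by (simp add: norm_mult)
    ultimately show ?case by (simp add: c_def mult.assoc order_trans[OF _ exp_le_cancel_iff[THEN iffD2]])
  qed
  have hs: "has_bochner_integral M (\<lambda>\<omega>. exp (z * of_real (Li i \<omega>)))
    (exp (CLINT p|m. exp (z * of_real (G i p)) - 1))" for i
    unfolding Li_def by (rule has_integral_exp_simple[OF G Gfin])
  have lim2: "AE \<omega> in M. (\<lambda>i. exp (z * of_real (Li i \<omega>))) \<longlonglongrightarrow> exp (z * of_real (L \<omega>))"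
    using lim by eventually_elim (intro tendsto_intros)
  have "integrable M (\<lambda>\<omega>. exp (z * of_real (L \<omega>)))"
    by (rule integrable_dominated_convergence[OF _ _ dom lim2 bd]) measurable
  moreover have "(\<lambda>i. CLINT \<omega>|M. exp (z * of_real (Li i \<omega>))) \<longlonglongrightarrow> (CLINT \<omega>|M. exp (z * of_real (L \<omega>)))"
    by (rule integral_dominated_convergence[OF _ _ dom lim2 bd]) measurable
  moreover have "(\<lambda>i. exp (CLINT p|m. exp (z * of_real (G i p)) - 1)) \<longlonglongrightarrow> exp (CLINT p|m. exp (z * of_real (f p)) - 1)"
  proof (intro tendsto_intros integral_dominated_convergence[where w = "\<lambda>p. (exp c + 1) * indicator ?S p"])
    show "integrable m (\<lambda>p. (exp c + 1) * indicator ?S p)"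
      using fin S by (intro integrable_mult_right integrable_real_indicator) auto
    show "AE p in m. (\<lambda>i. exp (z * of_real (G i p)) - 1) \<longlonglongrightarrow> exp (z * of_real (f p)) - 1"
      by (rule AE_I2) (use F(2) in \<open>auto intro!: tendsto_intros simp: G_def\<close>)
    show "AE p in m. norm (exp (z * of_real (G i p)) - 1) \<le> (exp c + 1) * indicator ?S p" for i
    proof (rule AE_I2)
      fix p assume p: "p \<in> space m"
      show "norm (exp (z * of_real (G i p)) - 1) \<le> (exp c + 1) * indicator ?S p"
      proof (cases "f p = 0")
        case True then show ?thesis using F(3)[OF p, of i] by (simp add: G_def)
      next
        case False
        have "norm (exp (z * of_real (G i p)) - 1) \<le> exp (norm (z * of_real (G i p))) + 1"
          using norm_triangle_ineq4[of "exp (z * of_real (G i p))" 1] norm_exp[of "z * of_real (G i p)"]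
          unfolding norm_one by linarith
        also have "norm (z * of_real (G i p)) \<le> c"
          unfolding c_def norm_mult using GB[of i p] by (intro mult_left_mono) auto
        finally show ?thesis using False p by simp
      qed
    qed
  qed measurable
  ultimately show ?thesis
    using hs LIMSEQ_unique unfolding has_bochner_integral_iff L_def by auto
qed

text \<open>Exponential moments of an unbounded \<open>f\<close> may be infinite, hence the
  imaginary exponent. Cutting \<open>f\<close> at height \<open>n\<close> eventually changes nothing
  for a given \<open>\<omega>\<close>: the numbers of points with \<open>\<bar>f p\<bar> > n\<close>
  are finite integers decreasing to 0, so they are 0 from some \<open>n\<close> on.\<close>

lemma has_integral_iexp:
  fixes f :: "'b \<Rightarrow> real" and u :: real
  assumes f[measurable]: "f \<in> borel_measurable m" 
    and fin: "emeasure m {p \<in> space m. f p \<noteq> 0} < \<infinity>"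
  shows "AE \<omega> in M. integrable (\<mu> \<omega>) f"
    and "(CLINT \<omega>|M. iexp (u * (LINT p|\<mu> \<omega>. f p))) = exp (CLINT p|m. iexp (u * f p) - 1)"
proof -
  let ?S = "\<lambda>n::nat. {p \<in> space m. real n < \<bar>f p\<bar>}"
  have S0: "{p \<in> space m. f p \<noteq> 0} = ?S 0" by auto
  have S[measurable]: "?S n \<in> sets m" for n by measurable
  have Sfin: "emeasure m (?S n) < \<infinity>" for n
    by (rule le_less_trans[OF emeasure_mono[OF _ S[of 0]] fin[unfolded S0]]) auto
  define g where "g n p = f p * indicator {p. \<bar>f p\<bar> \<le> real n} p" for n p
  have g[measurable]: "g n \<in> borel_measurable m" for n unfolding g_def by measurable
  have gB: "\<bar>g n p\<bar> \<le> real n" for n p by (auto simp: g_def indicator_def)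
  have gfin: "emeasure m {p \<in> space m. g n p \<noteq> 0} < \<infinity>" for n
    by (rule le_less_trans[OF emeasure_mono[OF _ S[of 0]] Sfin]) (auto simp: g_def)
  have "AE \<omega> in M. \<forall>n. \<exists>k::nat. emeasure (\<mu> \<omega>) (?S n) = of_nat k"
    using AE_mu_nat[OF S Sfin] by (subst AE_all_countable) auto
  moreover have "AE \<omega> in M. \<forall>n. integrable (\<mu> \<omega>) (g n)"
    using AE_integrable_mu_bounded[OF g gB gfin] by (subst AE_all_countable) auto
  ultimately have *: "AE \<omega> in M. \<exists>N. \<forall>n\<ge>N. integrable (\<mu> \<omega>) (g n) \<and> (AE p in \<mu> \<omega>. g n p = f p)"
    using AE_space
  proof eventually_elim
    case (elim \<omega>)
    have "(\<lambda>n. emeasure (\<mu> \<omega>) (?S n)) \<longlonglongrightarrow> emeasure (\<mu> \<omega>) (\<Inter>n. ?S n)"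
    proof (rule Lim_emeasure_decseq)
      show "emeasure (\<mu> \<omega>) (?S n) \<noteq> \<infinity>" for n
        using elim(1)[rule_format, of n] by auto
    qed (use elim in \<open>auto simp: sets_mu decseq_def\<close>)
    also have "(\<Inter>n. ?S n) = {}"
      by auto (meson reals_Archimedean2 less_asym)
    finally have "\<forall>\<^sub>F n in sequentially. emeasure (\<mu> \<omega>) (?S n) < 1"
      by (intro order_tendstoD(2)[of _ 0]) auto
    then obtain N where N: "\<And>n. n \<ge> N \<Longrightarrow> emeasure (\<mu> \<omega>) (?S n) < 1"
      by (auto simp: eventually_sequentially)
    have "AE p in \<mu> \<omega>. g n p = f p" if "n \<ge> N" for n
    proof -
      obtain k :: nat where k: "emeasure (\<mu> \<omega>) (?S n) = of_nat k" using elim(1) by blast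
      then have "k = 0" using N[OF that] by (cases k) (auto simp: add_increasing2 not_less[symmetric])
      then have "?S n \<in> null_sets (\<mu> \<omega>)" using k elim by (auto simp: null_sets_def sets_mu)
      then show ?thesis
        by (rule AE_I') (use elim(3) in \<open>auto simp: g_def indicator_def space_mu\<close>)
    qed
    then show ?case using elim(2) by (intro exI[of _ N]) simp
  qed
  show "AE \<omega> in M. integrable (\<mu> \<omega>) f"
    using * AE_space
  proof eventually_elim
    case (elim \<omega>)
    then obtain N where N: "integrable (\<mu> \<omega>) (g N)" "AE p in \<mu> \<omega>. g N p = f p" by blast
    show ?case
      by (rule integrable_cong_AE_imp[OF N(1)]) (use N elim in \<open>auto simp: borel_measurable_mu\<close>)
  qed
  have lim: "AE \<omega> in M. (\<lambda>n. iexp (u * (LINT p|\<mu> \<omega>. g n p))) \<longlonglongrightarrow> iexp (u * (LINT p|\<mu> \<omega>. f p))"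
    using * AE_space
  proof eventually_elim
    case (elim \<omega>)
    then obtain N where N: "\<And>n. n \<ge> N \<Longrightarrow> AE p in \<mu> \<omega>. g n p = f p" by blast
    have "(LINT p|\<mu> \<omega>. g n p) = (LINT p|\<mu> \<omega>. f p)" if "n \<ge> N" for n
      by (rule integral_cong_AE) (use N[OF that] elim in \<open>auto simp: borel_measurable_mu\<close>)
    then have "\<forall>\<^sub>F n in sequentially. (LINT p|\<mu> \<omega>. g n p) = (LINT p|\<mu> \<omega>. f p)"
      by (auto simp: eventually_sequentially)
    then show ?case by (intro tendsto_eventually) (auto elim: eventually_mono)
  qed
  have l1: "(\<lambda>n. CLINT \<omega>|M. iexp (u * (LINT p|\<mu> \<omega>. g n p))) \<longlonglongrightarrow> (CLINT \<omega>|M. iexp (u * (LINT p|\<mu> \<omega>. f p)))"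
    by (rule integral_dominated_convergence[where w = "\<lambda>_. 1"]) (use lim in auto)
  have l2: "(\<lambda>n. exp (CLINT p|m. iexp (u * g n p) - 1)) \<longlonglongrightarrow> exp (CLINT p|m. iexp (u * f p) - 1)"
  proof (intro tendsto_intros integral_dominated_convergence[where w = "\<lambda>p. 2 * indicator (?S 0) p"])
    show "integrable m (\<lambda>p. 2 * indicator (?S 0) p :: real)"
      using Sfin[of 0] by (intro integrable_mult_right integrable_real_indicator) auto
    show "AE p in m. (\<lambda>n. iexp (u * g n p) - 1) \<longlonglongrightarrow> iexp (u * f p) - 1"
    proof (rule AE_I2)
      fix p
      obtain N :: nat where "\<bar>f p\<bar> \<le> real N" by (meson real_arch_simple)
      then have "\<forall>\<^sub>F n in sequentially. g n p = f p"
        by (auto simp: eventually_sequentially g_def intro!: exI[of _ N])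
      then show "(\<lambda>n. iexp (u * g n p) - 1) \<longlonglongrightarrow> iexp (u * f p) - 1"
        by (intro tendsto_eventually) (auto elim: eventually_mono)
    qed
    show "AE p in m. norm (iexp (u * g n p) - 1) \<le> 2 * indicator (?S 0) p" for n
    proof (rule AE_I2)
      fix p assume "p \<in> space m"
      then show "norm (iexp (u * g n p) - 1) \<le> 2 * indicator (?S 0) p"
        using norm_triangle_ineq4[of "iexp (u * g n p)" 1] by (cases "f p = 0") (auto simp: g_def)
    qed
  qed measurable
  have "(CLINT \<omega>|M. iexp (u * (LINT p|\<mu> \<omega>. g n p))) = exp (CLINT p|m. iexp (u * g n p) - 1)" for n
    using has_integral_exp_bounded[OF g gB gfin, of "\<i> * of_real u" n]
    by (simp add: has_bochner_integral_iff mult.assoc)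
  then show "(CLINT \<omega>|M. iexp (u * (LINT p|\<mu> \<omega>. f p))) = exp (CLINT p|m. iexp (u * f p) - 1)"
    using l1 l2 LIMSEQ_unique by auto
qed

end

section \<open>Compound Poisson distributions\<close>

lemma (in real_distribution) Re_char: "Re (char M u) = (LINT x|M. cos (u * x))"
proof -
  have "(LINT x|M. Re (iexp (u * x))) = Re (char M u)"
    unfolding char_def by (rule integral_Re[OF integrable_iexp]) auto
  then show ?thesis by (simp add: Re_exp)
qed

lemma (in real_distribution) Im_char: "Im (char M u) = (LINT x|M. sin (u * x))"
proof -
  have "(LINT x|M. Im (iexp (u * x))) = Im (char M u)"
    unfolding char_def by (rule integral_Im[OF integrable_iexp]) auto
  then show ?thesis by (simp add: Im_exp)
qed

lemma (in real_distribution) integral_convolution: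
  fixes f :: "real \<Rightarrow> 'b::{banach, second_countable_topology}"
  assumes N: "real_distribution N" and f[measurable]: "f \<in> borel_measurable borel"
    and B: "\<And>x. norm (f x) \<le> B"
  shows "(LINT x|(M \<star> N). f x) = (LINT x|M. LINT y|N. f (x + y))"
proof -
  interpret N: real_distribution N by fact
  interpret P: pair_prob_space M N ..
  have "(LINT x|(M \<star> N). f x) = (LINT p|(M \<Otimes>\<^sub>M N). f (fst p + snd p))"
    unfolding convolution_def by (subst integral_distr) (auto simp: case_prod_beta)
  also have "\<dots> = (LINT x|M. LINT y|N. f (x + y))"
    by (subst P.integral_fst'[symmetric])
      (auto intro!: P.integrable_const_bound[where B = B] B)
  finally show ?thesis .
qed

lemma (in real_distribution) real_distribution_convolution:
  assumes N: "real_distribution N"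
  shows "real_distribution (M \<star> N)"
proof -
  interpret N: real_distribution N by fact
  interpret P: pair_prob_space M N ..
  have "prob_space (M \<star> N)"
    unfolding convolution_def by (rule P.prob_space_distr) simp
  then show ?thesis by (simp add: real_distribution_def real_distribution_axioms_def)
qed

lemma (in real_distribution) char_convolution:
  assumes N: "real_distribution N"
  shows "char (M \<star> N) u = char M u * char N u"
proof -
  have "char (M \<star> N) u = (CLINT x|M. CLINT y|N. iexp (u * (x + y)))"
    unfolding char_def by (rule integral_convolution[OF N, where B = 1]) auto
  also have "\<dots> = (CLINT x|M. iexp (u * x) * (CLINT y|N. iexp (u * y)))"
    by (simp add: distrib_left exp_add)
  finally show ?thesis by (simp add: char_def)
qed

section \<open>Convolution powers and the compound Poisson law\<close>

fun convolution_power :: "real measure \<Rightarrow> nat \<Rightarrow> real measure" where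
  "convolution_power K 0 = return borel 0"
| "convolution_power K (Suc n) = (K \<star> convolution_power K n)"

lemma real_distribution_return: "real_distribution (return borel x)"
  by (auto simp: real_distribution_def real_distribution_axioms_def intro: prob_space_return)

lemma real_distribution_convolution_power:
  "real_distribution K \<Longrightarrow> real_distribution (convolution_power K n)"
  by (induction n) (auto intro: real_distribution.real_distribution_convolution real_distribution_return)

lemma char_convolution_power:
  "real_distribution K \<Longrightarrow> char (convolution_power K n) u = char K u ^ n"
proof (induction n)
  case 0
  then show ?case by (simp add: char_def integral_return)
next
  case (Suc n)
  then show ?case
    by (simp add: real_distribution.char_convolution real_distribution_convolution_power)
qed

text \<open>For total mass 0 there is nothing to normalise; the point mass at 0 keeps the result a
  probability measure, and the scaled integral identity below then reads 0 = 0.\<close>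

definition normalized_measure :: "(real \<Rightarrow> real) \<Rightarrow> real measure" where
  "normalized_measure k = (let l = (LINT x|lborel. k x) in
     if l = 0 then return borel 0 else density lborel (\<lambda>x. ennreal (k x / l)))"

lemma normalized_measure:
  assumes k[measurable]: "k \<in> borel_measurable borel" and nn: "\<And>x. 0 \<le> k x" and i: "integrable lborel k"
  shows real_distribution_normalized_measure: "real_distribution (normalized_measure k)" (is ?P)
    and integral_normalized_measure: "\<And>f :: real \<Rightarrow> 'b::{banach, second_countable_topology}.
      f \<in> borel_measurable borel \<Longrightarrow>
      (LINT x|lborel. k x) *\<^sub>R (LINT x|normalized_measure k. f x) = (LINT x|lborel. k x *\<^sub>R f x)"
proof -
  have l: "0 \<le> (LINT x|lborel. k x)" by (intro integral_nonneg_AE) (simp add: nn)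
  show ?P
  proof (cases "(LINT x|lborel. k x) = 0")
    case True
    then show ?thesis by (simp add: normalized_measure_def real_distribution_return)
  next
    case False
    have "(\<integral>\<^sup>+x. ennreal (k x / (LINT x|lborel. k x)) \<partial>lborel) = ennreal (LINT x|lborel. k x / (LINT x|lborel. k x))"
      by (intro nn_integral_eq_integral) (use i nn l in auto)
    then have "prob_space (density lborel (\<lambda>x. ennreal (k x / (LINT x|lborel. k x))))"
      using False by (intro prob_spaceI) (simp add: emeasure_density)
    then show ?thesis
      using False by (simp add: normalized_measure_def real_distribution_def real_distribution_axioms_def)
  qed
  fix f :: "real \<Rightarrow> 'b" assume f[measurable]: "f \<in> borel_measurable borel"
  show "(LINT x|lborel. k x) *\<^sub>R (LINT x|normalized_measure k. f x) = (LINT x|lborel. k x *\<^sub>R f x)"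
  proof (cases "(LINT x|lborel. k x) = 0")
    case True
    then have "AE x in lborel. k x = 0"
      using integral_nonneg_eq_0_iff_AE[OF i] nn by simp
    then have "(LINT x|lborel. k x *\<^sub>R f x) = (LINT x|lborel. 0)"
      by (subst integral_cong_AE[where g = "\<lambda>_. 0"]) auto
    then show ?thesis using True by simp
  next
    case False
    then show ?thesis
      using l nn by (simp add: normalized_measure_def integral_density integral_scaleR_right[symmetric] del: integral_scaleR_right)
  qed
qed

text \<open>\<open>Q\<close> is the law of a sum of independent jumps with law
  \<open>normalized_measure k\<close>, whose number is Poisson with mean \<open>l * t\<close>. The
  powers of \<open>l\<close> in the Poisson weights undo the normalisation, so zero, one and two
  jumps give integrals against \<open>k\<close> itself.\<close>

proposition compound_poisson_distribution:
  fixes k :: "real \<Rightarrow> real" and t :: real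
  assumes k[measurable]: "k \<in> borel_measurable borel" and nn: "\<And>x. 0 \<le> k x" and i: "integrable lborel k"
    and t: "0 \<le> t"
  defines "l \<equiv> (LINT x|lborel. k x)"
  obtains Q where "real_distribution Q"
    "\<And>u. char Q u = exp (of_real t * (CLINT x|lborel. of_real (k x) * (iexp (u * x) - 1)))"
    "\<And>h. h \<in> borel_measurable borel \<Longrightarrow> (\<And>x. \<bar>h x\<bar> \<le> 1) \<Longrightarrow>
      \<bar>(LINT x|Q. h x) - exp (- (l * t)) * (h 0 + t * (LINT x|lborel. k x * h x)
        + t\<^sup>2 / 2 * (LINT x|lborel. LINT u|lborel. k x * (k u * h (x + u))))\<bar> \<le> (l * t) ^ 3"
proof -
  define K where "K = normalized_measure k"
  interpret K: real_distribution K
    unfolding K_def by (rule real_distribution_normalized_measure) fact+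
  have rd: "real_distribution (convolution_power K n)" for n
    by (rule real_distribution_convolution_power) unfold_locales
  have "0 \<le> l" unfolding l_def by (intro integral_nonneg_AE) (simp add: nn)
  then have a: "0 \<le> l * t" using t by simp
  obtain p :: "nat pmf" where p: "\<And>n. pmf p n = (l * t) ^ n / fact n * exp (- (l * t))"
    using exists_poisson_pmf[OF a] by blast
  define Q where "Q = measure_pmf p \<bind> convolution_power K"
  have N': "convolution_power K n \<in> space (subprob_algebra borel)" for n
    by (auto simp: space_subprob_algebra prob_space_imp_subprob_space real_distribution.axioms(1)[OF rd]
      real_distribution.events_eq_borel[OF rd])
  then have N[measurable]: "convolution_power K \<in> measurable (measure_pmf p) (subprob_algebra borel)"
    by simp
  have Q_int: "(LINT x|Q. h x) = (LINT n|measure_pmf p. LINT x|convolution_power K n. h x)"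
    if "h \<in> borel_measurable borel" "\<And>x. \<bar>h x\<bar> \<le> 1" for h :: "real \<Rightarrow> real"
    unfolding Q_def
    by (rule integral_bind[where K = borel and B = 1 and B' = 1])
      (use that N' in \<open>auto simp: measure_pmf.finite_measure_axioms prob_space.emeasure_space_1[OF real_distribution.axioms(1)[OF rd]]\<close>)
  have prob_Q: "prob_space Q"
    unfolding Q_def
    by (rule measure_pmf.prob_space_bind[OF _ N]) (auto simp: real_distribution.axioms(1)[OF rd])
  have sets_Q: "sets Q = sets borel"
    unfolding Q_def by (rule sets_bind) (auto simp: real_distribution.events_eq_borel[OF rd])
  have Q: "real_distribution Q"
    using prob_Q sets_Q by (simp add: real_distribution_def real_distribution_axioms_def)
  interpret Q: real_distribution Q by fact
  show ?thesis
  proof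
    show "real_distribution Q" by fact
  next
    fix u :: real
    have pi: "integrable (measure_pmf p) (\<lambda>n. char K u ^ n)"
      by (rule poisson_pmf_exp(1)[OF p a])
    have charn: "char (convolution_power K n) u = char K u ^ n" for n
      by (rule char_convolution_power) unfold_locales
    \<comment> \<open>\<open>Q_int\<close> is available for real integrands only, hence cosine and
      sine separately.\<close>
    have "Re (char Q u) = (LINT x|Q. cos (u * x))"
      by (rule Q.Re_char)
    also have "\<dots> = (LINT n|measure_pmf p. LINT x|convolution_power K n. cos (u * x))"
      by (rule Q_int) auto
    also have "\<dots> = (LINT n|measure_pmf p. Re (char K u ^ n))"
      by (simp add: charn[symmetric] real_distribution.Re_char[OF rd])
    finally have re: "Re (char Q u) = Re (LINT n|measure_pmf p. char K u ^ n)"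
      using pi by simp
    have "Im (char Q u) = (LINT x|Q. sin (u * x))"
      by (rule Q.Im_char)
    also have "\<dots> = (LINT n|measure_pmf p. LINT x|convolution_power K n. sin (u * x))"
      by (rule Q_int) auto
    also have "\<dots> = (LINT n|measure_pmf p. Im (char K u ^ n))"
      by (simp add: charn[symmetric] real_distribution.Im_char[OF rd])
    finally have im: "Im (char Q u) = Im (LINT n|measure_pmf p. char K u ^ n)"
      using pi by simp
    have "char Q u = exp (of_real (l * t) * (char K u - 1))"
      using re im poisson_pmf_exp(2)[OF p a, of "char K u"] by (simp add: complex_eq_iff)
    also have "of_real l * char K u = (CLINT x|lborel. of_real (k x) * iexp (u * x))"
      unfolding l_def char_def K_def
      using integral_normalized_measure[OF k nn i, of "\<lambda>x. iexp (u * x)"] by (simp add: scaleR_conv_of_real)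
    then have "of_real (l * t) * (char K u - 1) = of_real t * ((CLINT x|lborel. of_real (k x) * iexp (u * x)) - of_real l)"
      by (simp add: algebra_simps)
    also have "(CLINT x|lborel. of_real (k x) * iexp (u * x)) - of_real l = (CLINT x|lborel. of_real (k x) * iexp (u * x) - of_real (k x))"
      unfolding l_def integral_complex_of_real[symmetric]
      by (intro Bochner_Integration.integral_diff[symmetric] Bochner_Integration.integrable_bound[OF i]) (use i in \<open>auto simp: norm_mult\<close>)
    finally show "char Q u = exp (of_real t * (CLINT x|lborel. of_real (k x) * (iexp (u * x) - 1)))"
      by (simp add: algebra_simps)
  next
    fix h :: "real \<Rightarrow> real" assume h[measurable]: "h \<in> borel_measurable borel" and hb: "\<And>x. \<bar>h x\<bar> \<le> 1"
    define G where "G n = (LINT x|convolution_power K n. h x)" for n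
    have Gb: "\<bar>G n\<bar> \<le> 1" for n
    proof -
      interpret R: real_distribution "convolution_power K n" by (rule rd)
      have ih: "integrable (convolution_power K n) (\<lambda>x. \<bar>h x\<bar>)"
        by (rule R.integrable_const_bound[where B = 1]) (auto simp: hb)
      have "\<bar>G n\<bar> \<le> (LINT x|convolution_power K n. \<bar>h x\<bar>)"
        unfolding G_def by (rule integral_abs_bound)
      also have "\<dots> \<le> (LINT x|convolution_power K n. 1)"
        by (intro integral_mono ih) (auto simp: hb)
      finally show ?thesis using R.prob_space by simp
    qed
    have w: "(\<lambda>n. pmf p n) sums 1"
    proof -
      have "(\<lambda>n. exp (- (l * t)) * ((l * t) ^ n /\<^sub>R fact n)) sums (exp (- (l * t)) * exp (l * t))"
        by (intro sums_mult exp_converges)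
      then show ?thesis unfolding p by (simp add: exp_add[symmetric] field_simps)
    qed
    have sw: "summable (\<lambda>n. pmf p n * norm (G n))"
      by (rule summable_comparison_test'[OF sums_summable[OF w], of 0])
        (use Gb in \<open>auto simp: mult_left_le\<close>)
    have sG: "(\<lambda>n. pmf p n * G n) sums (LINT x|Q. h x)"
      using has_integral_nat_pmf(2)[OF sw] unfolding G_def Q_int[OF h hb] by simp
    have S1: "(\<lambda>n. pmf p (n + 3) * G (n + 3)) sums ((LINT x|Q. h x) - (\<Sum>n<3. pmf p n * G n))"
      using sG by (subst sums_iff_shift) simp
    \<comment> \<open>As \<open>fact (n + 3)\<close> is at least \<open>fact n\<close>, a weight
      shifted by three is at most (l t)^3 times the original one; summing gives (l t)^3 as bound for
      three or more jumps.\<close>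
    have B: "norm (pmf p (n + 3) * G (n + 3)) \<le> (l * t) ^ 3 * pmf p n" for n
    proof -
      have "norm (pmf p (n + 3) * G (n + 3)) \<le> pmf p (n + 3)"
        using Gb[of "n + 3"] by (simp add: abs_mult mult_left_le)
      also have "\<dots> = (l * t) ^ 3 * ((l * t) ^ n * exp (- (l * t)) / fact (n + 3))"
        unfolding p by (simp add: power_add)
      also have "\<dots> \<le> (l * t) ^ 3 * ((l * t) ^ n * exp (- (l * t)) / fact n)"
        using a by (intro mult_left_mono divide_left_mono fact_mono) auto
      finally show ?thesis unfolding p by simp
    qed
    have S2: "(\<lambda>n. (l * t) ^ 3 * pmf p n) sums ((l * t) ^ 3 * 1)"
      by (rule sums_mult[OF w])
    have "norm ((LINT x|Q. h x) - (\<Sum>n<3. pmf p n * G n)) \<le> (l * t) ^ 3 * 1"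
      using norm_suminf_le[OF B sums_summable[OF S2]]
      unfolding sums_unique[OF S1, symmetric] sums_unique[OF S2, symmetric] .
    moreover have "(\<Sum>n<3. pmf p n * G n) = exp (- (l * t)) * (h 0 + t * (LINT x|lborel. k x * h x)
        + t\<^sup>2 / 2 * (LINT x|lborel. LINT u|lborel. k x * (k u * h (x + u))))"
    proof -
      have G0: "G 0 = h 0" unfolding G_def by (simp add: integral_return)
      have c1: "(LINT x|(K \<star> return borel 0). f x) = (LINT x|K. f x)"
        if "f \<in> borel_measurable borel" "\<And>x. \<bar>f x\<bar> \<le> 1" for f :: "real \<Rightarrow> real"
        using K.integral_convolution[OF real_distribution_return, of f 1] that by (simp add: integral_return)
      have n: "l * (LINT x|K. f x) = (LINT x|lborel. k x * f x)" if "f \<in> borel_measurable borel" for f :: "real \<Rightarrow> real"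
        unfolding l_def K_def using integral_normalized_measure[OF k nn i that] by simp
      have G1: "l * G 1 = (LINT x|lborel. k x * h x)"
        unfolding G_def using n[OF h] by (simp add: c1 hb)
      have m[measurable]: "(\<lambda>x. LINT u|K. h (x + u)) \<in> borel_measurable borel"
        by measurable
      have "G 2 = (LINT x|K. LINT u|(K \<star> return borel 0). h (x + u))"
        unfolding G_def numeral_2_eq_2 convolution_power.simps
        by (rule K.integral_convolution[where B = 1])
          (auto intro!: K.real_distribution_convolution real_distribution_return hb)
      also have "\<dots> = (LINT x|K. LINT u|K. h (x + u))"
        by (intro Bochner_Integration.integral_cong refl c1) (auto simp: hb)
      finally have "l\<^sup>2 * G 2 = l * (l * (LINT x|K. LINT u|K. h (x + u)))"
        by (simp add: power2_eq_square)
      also have "\<dots> = l * (LINT x|K. l * (LINT u|K. h (x + u)))"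
        by simp
      also have "\<dots> = (LINT x|lborel. k x * (LINT u|lborel. k u * h (x + u)))"
        by (subst n) (auto simp: n)
      finally have G2: "l\<^sup>2 * G 2 = (LINT x|lborel. LINT u|lborel. k x * (k u * h (x + u)))"
        by simp
      have "(\<Sum>n<3. pmf p n * G n) = exp (- (l * t)) * (G 0 + t * (l * G 1) + t\<^sup>2 / 2 * (l\<^sup>2 * G 2))"
        by (simp add: p eval_nat_numeral algebra_simps)
      then show ?thesis unfolding G0 G1 G2 .
    qed
    ultimately show "\<bar>(LINT x|Q. h x) - exp (- (l * t)) * (h 0 + t * (LINT x|lborel. k x * h x)
        + t\<^sup>2 / 2 * (LINT x|lborel. LINT u|lborel. k x * (k u * h (x + u))))\<bar> \<le> (l * t) ^ 3"
      by simp
  qed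
qed

section \<open>Levy densities\<close>

locale levy_density =
  fixes s :: "real \<Rightarrow> real"
  assumes s_measurable[measurable]: "s \<in> borel_measurable borel"
    and s_nonneg: "0 \<le> s x"
    and integrable_min: "integrable lborel (\<lambda>x. s x * min 1 (x\<^sup>2))"
begin

abbreviation \<nu> :: "real measure" where "\<nu> \<equiv> density lborel (\<lambda>x. ennreal (s x))"

text \<open>Bounds the second moment of the jumps up to \<open>\<delta>\<close> for every
  \<open>\<delta> \<le> 1\<close>; this makes the estimates uniform in the cut.\<close>

definition V :: real where "V = (LINT x|lborel. s x * min 1 (x\<^sup>2))"

lemma V_nonneg: "0 \<le> V"
  unfolding V_def by (intro integral_nonneg_AE) (simp add: s_nonneg)

lemma integrable_levy:
  fixes g :: "real \<Rightarrow> 'b::{banach, second_countable_topology}"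
  assumes g[measurable]: "g \<in> borel_measurable borel" and gb: "\<And>x. norm (g x) \<le> C * min 1 (x\<^sup>2)"
  shows "integrable lborel (\<lambda>x. s x *\<^sub>R g x)"
proof -
  have b: "norm (s x *\<^sub>R g x) \<le> C * (s x * min 1 (x\<^sup>2))" for x
    using mult_left_mono[OF gb[of x] s_nonneg[of x]] s_nonneg[of x] by (simp add: mult_ac)
  have i: "integrable lborel (\<lambda>x. C * (s x * min 1 (x\<^sup>2)))"
    using integrable_min by (rule integrable_mult_right)
  show "integrable lborel (\<lambda>x. s x *\<^sub>R g x)"
    by (rule Bochner_Integration.integrable_bound[OF i]) (use b in \<open>auto intro: order_trans[OF _ abs_ge_self]\<close>)
qed

lemma integrable_levy_tail:
  fixes g :: "real \<Rightarrow> 'b::{banach, second_countable_topology}"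
  assumes g[measurable]: "g \<in> borel_measurable borel" and gb: "\<And>x. norm (g x) \<le> C"
    and a: "0 < a" and g0: "\<And>x. \<bar>x\<bar> \<le> a \<Longrightarrow> g x = 0"
  shows "integrable lborel (\<lambda>x. s x *\<^sub>R g x)"
proof (rule integrable_levy[OF g])
  have "0 \<le> C" using gb[of 0] norm_ge_zero[of "g 0"] by linarith
  fix x
  \<comment> \<open>Outside the interval of radius \<open>a\<close> the weight min(1, x^2) is at
    least min(1, a^2), which gives the constant.\<close>
  show "norm (g x) \<le> (C / min 1 (a\<^sup>2)) * min 1 (x\<^sup>2)"
  proof (cases "\<bar>x\<bar> \<le> a")
    case True
    then show ?thesis using g0[of x] a \<open>0 \<le> C\<close> by simp
  next
    case False
    then have "a\<^sup>2 \<le> x\<^sup>2" using a by (simp add: abs_le_square_iff[symmetric])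
    then have "min 1 (a\<^sup>2) \<le> min 1 (x\<^sup>2)" by linarith
    then have "C * min 1 (a\<^sup>2) \<le> C * min 1 (x\<^sup>2)" using \<open>0 \<le> C\<close> by (intro mult_left_mono)
    then have "C \<le> C / min 1 (a\<^sup>2) * min 1 (x\<^sup>2)"
      using a by (simp add: field_simps)
    then show ?thesis using gb[of x] by linarith
  qed
qed

lemma emeasure_levy_tail:
  assumes B: "B \<in> sets borel" "0 < a" "B \<subseteq> {x. a < \<bar>x\<bar>}"
  shows "emeasure \<nu> B < \<infinity>"
proof -
  have "integrable lborel (\<lambda>x. s x *\<^sub>R (indicator B x :: real))"
    by (rule integrable_levy_tail[where C = 1 and a = a]) (use B in \<open>auto simp: indicator_def\<close>)
  then have "(\<integral>\<^sup>+x. ennreal (s x * indicator B x) \<partial>lborel) < \<infinity>"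
    by (subst nn_integral_eq_integral) (auto simp: s_nonneg)
  then show ?thesis
    using B(1) by (simp add: emeasure_density ennreal_mult'' ennreal_indicator)
qed

lemma sigma_finite_levy: "sigma_finite_measure \<nu>"
  by (subst sigma_finite_measure.sigma_finite_iff_density_finite[OF sigma_finite_lborel]) auto

lemma integral_levy:
  fixes g :: "real \<Rightarrow> 'b::{banach, second_countable_topology}"
  assumes "g \<in> borel_measurable borel"
  shows "(LINT x|\<nu>. g x) = (LINT x|lborel. s x *\<^sub>R g x)"
    and "integrable \<nu> g \<longleftrightarrow> integrable lborel (\<lambda>x. s x *\<^sub>R g x)"
  using assms by (simp_all add: integral_density integrable_density s_nonneg)

section \<open>The mean measure in time and jump size\<close>

abbreviation mean_measure :: "(real \<times> real) measure" where
  "mean_measure \<equiv> jump_mean_measure \<nu>"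

lemma sets_mean_measure[measurable_cong, simp]: "sets mean_measure = sets borel"
  unfolding jump_mean_measure_def
  by (metis borel_prod sets_density sets_lborel sets_pair_measure_cong)

lemma space_mean_measure[simp]: "space mean_measure = UNIV"
  using sets_eq_imp_space_eq[OF sets_mean_measure] by simp

lemma time_measure:
  "sigma_finite_measure (density lborel (indicator {0..} :: real \<Rightarrow> ennreal))"
  "0 \<le> t \<Longrightarrow> emeasure (density lborel (indicator {0..})) {0..t} = ennreal t"
proof -
  show "sigma_finite_measure (density lborel (indicator {0..} :: real \<Rightarrow> ennreal))"
    by (subst sigma_finite_measure.sigma_finite_iff_density_finite[OF sigma_finite_lborel]) (auto simp: indicator_def)
  assume "0 \<le> t"
  then show "emeasure (density lborel (indicator {0..})) {0..t} = ennreal t"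
    by (simp add: emeasure_density indicator_inter_arith[symmetric] Int_absorb1)
qed

lemma emeasure_mean_measure:
  assumes "0 \<le> t" "B \<in> sets borel"
  shows "emeasure mean_measure ({0..t} \<times> B) = ennreal t * emeasure \<nu> B"
proof -
  interpret sigma_finite_measure \<nu> by (rule sigma_finite_levy)
  show ?thesis
    unfolding jump_mean_measure_def using assms
    by (subst emeasure_pair_measure_Times) (auto simp: time_measure)
qed

lemma integral_mean_measure:
  fixes g :: "real \<Rightarrow> 'b::{banach, second_countable_topology}"
  assumes t: "0 \<le> t" and g[measurable]: "g \<in> borel_measurable borel"
    and i: "integrable lborel (\<lambda>x. s x *\<^sub>R g x)"
  shows "(LINT p|mean_measure. indicator {0..t} (fst p) *\<^sub>R g (snd p)) = t *\<^sub>R (LINT x|lborel. s x *\<^sub>R g x)"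
proof -
  let ?T = "density lborel (indicator {0..} :: real \<Rightarrow> ennreal)"
  interpret T: sigma_finite_measure ?T by (rule time_measure)
  interpret N: sigma_finite_measure \<nu> by (rule sigma_finite_levy)
  interpret P: pair_sigma_finite ?T \<nu> ..
  have iT: "integrable ?T (indicator {0..t} :: real \<Rightarrow> real)"
    using time_measure(2)[OF t] by (intro integrable_real_indicator) auto
  have mT: "measure ?T {0..t} = t"
    using time_measure(2)[OF t] t by (simp add: measure_def)
  have ig: "integrable \<nu> g" using i by (simp add: integral_levy)
  let ?f = "\<lambda>p. indicator {0..t} (fst p) *\<^sub>R g (snd p) :: 'b"
  have "integrable (?T \<Otimes>\<^sub>M \<nu>) ?f"
  proof (rule P.Fubini_integrable)
    show "integrable ?T (\<lambda>x. LINT y|\<nu>. norm (?f (x, y)))"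
      using iT by (simp add: integral_mult_right_zero)
    show "AE x in ?T. integrable \<nu> (\<lambda>y. ?f (x, y))"
      using ig by simp
  qed measurable
  then have "(LINT p|(?T \<Otimes>\<^sub>M \<nu>). ?f p) = (LINT x|?T. LINT y|\<nu>. ?f (x, y))"
    by (rule P.integral_fst'[symmetric])
  also have "\<dots> = (LINT x|?T. indicator {0..t} x *\<^sub>R (LINT y|\<nu>. g y))"
    by simp
  also have "\<dots> = t *\<^sub>R (LINT y|\<nu>. g y)"
    using iT by (simp add: mT)
  finally show ?thesis
    by (simp add: jump_mean_measure_def integral_levy)
qed

end

lemma levy_density_of_measure:
  assumes "levy_measure \<nu>" "has_density \<nu> s"
  shows "levy_density s"
proof
  have s[measurable]: "s \<in> borel_measurable borel" and nn: "\<And>x. 0 \<le> s x" and \<nu>: "\<nu> = density lborel (\<lambda>x. ennreal (s x))"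
    using assms(2) by (auto simp: has_density_def)
  show "s \<in> borel_measurable borel" by fact
  show "0 \<le> s x" for x by fact
  have "(\<integral>\<^sup>+x. ennreal (norm (s x * min 1 (x\<^sup>2))) \<partial>lborel) = (\<integral>\<^sup>+x. ennreal (min 1 (x\<^sup>2)) \<partial>\<nu>)"
    unfolding \<nu> using nn by (subst nn_integral_density) (auto simp: ennreal_mult' abs_mult)
  also have "\<dots> < \<infinity>" using assms(1) by (simp add: levy_measure_def)
  finally show "integrable lborel (\<lambda>x. s x * min 1 (x\<^sup>2))"
    by (intro integrableI_bounded) auto
qed

section \<open>Gaussian exponentials\<close>

lemma (in prob_space) char_normal:
  assumes D: "distributed M lborel X (normal_density 0 r)" and r: "0 < r"
  shows "(CLINT \<omega>|M. iexp (u * X \<omega>)) = exp (- of_real ((u * r)\<^sup>2 / 2))"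
proof -
  have [measurable]: "X \<in> borel_measurable M" using distributed_measurable[OF D] by simp
  have D': "distributed M lborel (\<lambda>\<omega>. X \<omega> / r) std_normal_density"
    using D normal_standard_normal_convert[OF r, of X 0] by simp
  then have "distr M borel (\<lambda>\<omega>. X \<omega> / r) = std_normal_distribution"
    using distributed_distr_eq_density[OF D'] by (metis distr_cong sets_lborel)
  then have "char (distr M borel (\<lambda>\<omega>. X \<omega> / r)) (u * r) = exp (- of_real ((u * r)\<^sup>2 / 2))"
    by (simp add: char_std_normal_distribution flip: exp_of_real)
  also have "char (distr M borel (\<lambda>\<omega>. X \<omega> / r)) (u * r) = (CLINT \<omega>|M. iexp (u * X \<omega>))"
    unfolding char_def using r by (subst integral_distr) auto
  finally show ?thesis .
qed

lemma (in prob_space) exp_moment_normal: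
  assumes D: "distributed M lborel X (normal_density 0 r)" and r: "0 < r"
  shows "has_bochner_integral M (\<lambda>\<omega>. exp (u * X \<omega>)) (exp ((u * r)\<^sup>2 / 2))"
proof -
  \<comment> \<open>Completing the square: the exponential tilt moves the mean from 0 to u
    r^2.\<close>
  have eq: "normal_density 0 r x * exp (u * x) = exp ((u * r)\<^sup>2 / 2) * normal_density (u * r\<^sup>2) r x" for x
  proof -
    have "- (x - 0)\<^sup>2 / (2 * r\<^sup>2) + u * x = (u * r)\<^sup>2 / 2 + - (x - u * r\<^sup>2)\<^sup>2 / (2 * r\<^sup>2)"
      using r by (simp add: field_simps power2_eq_square)
    then have "exp (- (x - 0)\<^sup>2 / (2 * r\<^sup>2)) * exp (u * x) = exp ((u * r)\<^sup>2 / 2) * exp (- (x - u * r\<^sup>2)\<^sup>2 / (2 * r\<^sup>2))"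
      by (simp only: exp_add[symmetric])
    then show ?thesis by (simp add: normal_density_def)
  qed
  have i: "integrable lborel (\<lambda>x. normal_density 0 r x * exp (u * x))"
    unfolding eq using integrable_normal_density[OF r] by (intro integrable_mult_right)
  have "integrable M (\<lambda>\<omega>. exp (u * X \<omega>))"
    using distributed_integrable[OF D, of "\<lambda>x. exp (u * x)"] i r by simp
  moreover have "(LINT \<omega>|M. exp (u * X \<omega>)) = exp ((u * r)\<^sup>2 / 2)"
    using distributed_integral[OF D, of "\<lambda>x. exp (u * x)"] r
    by (simp add: eq integral_normal_density)
  ultimately show ?thesis by (simp add: has_bochner_integral_iff)
qed

text \<open>With u x in place of u and \<bar>x\<bar> \<le> \<delta> this produces x^2, which the
  Levy density integrates, times u^2 exp(\<bar>u\<bar> \<delta>), the factor that the Chernoff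
  estimate has to absorb. The numerical constant is immaterial there.\<close>

lemma exp_minus_one_minus_le: "exp u - 1 - u \<le> u\<^sup>2 * exp \<bar>u\<bar>" for u :: real
proof -
  have *: "exp v - 1 \<le> v * exp v" for v :: real
    using exp_ge_add_one_self[of "- v"] mult_right_mono[of "1 - v" "exp (- v)" "exp v"]
    by (simp add: exp_minus field_simps)
  have "exp u - 1 - u \<le> u * (exp u - 1)" using *[of u] by (simp add: algebra_simps)
  also have "\<dots> \<le> u\<^sup>2 * exp \<bar>u\<bar>"
  proof (cases "0 \<le> u")
    case True
    then show ?thesis using mult_left_mono[OF *[of u] True] by (simp add: power2_eq_square)
  next
    case False
    have "u * (exp u - 1) \<le> u * u"
      using False exp_ge_add_one_self[of u] by (intro mult_left_mono_neg) linarith+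
    also have "\<dots> \<le> u\<^sup>2 * exp \<bar>u\<bar>"
      by (simp add: power2_eq_square[symmetric] mult_le_cancel_left1)
    finally show ?thesis .
  qed
  finally show ?thesis .
qed

section \<open>Gaussian part and jumps\<close>

locale levy_ito = levy_density s + prm M \<mu> "jump_mean_measure (density lborel (\<lambda>x. ennreal (s x)))"
  for s :: "real \<Rightarrow> real" and M :: "'a measure" and \<mu> :: "'a \<Rightarrow> (real \<times> real) measure" +
  fixes W :: "real \<Rightarrow> 'a \<Rightarrow> real" and t :: real
  assumes W: "standard_brownian_motion M W"
    and independent: "independent_of_random_measure M W \<mu> (jump_mean_measure (density lborel (\<lambda>x. ennreal (s x))))"
    and t_pos: "0 < t"
begin

definition jumps :: "real set \<Rightarrow> 'a \<Rightarrow> real" where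
  "jumps B \<omega> = (LINT p:{0..t} \<times> B|\<mu> \<omega>. snd p)"

definition jump_function :: "real set \<Rightarrow> real \<times> real \<Rightarrow> real" where
  "jump_function B p = indicator ({0..t} \<times> B) p *\<^sub>R snd p"

lemma jumps_eq: "jumps B \<omega> = (LINT p|\<mu> \<omega>. jump_function B p)"
  by (simp add: jumps_def jump_function_def set_lebesgue_integral_def)

lemma jump_function_measurable:
  assumes "B \<in> sets borel"
  shows "jump_function B \<in> borel_measurable mean_measure"
proof -
  have "{0..t} \<times> B \<in> sets mean_measure"
    unfolding sets_mean_measure borel_prod[symmetric] using assms(1) by measurable
  moreover have "(snd :: real \<times> real \<Rightarrow> real) \<in> borel_measurable mean_measure"
    by (simp add: borel_prod[symmetric] cong: measurable_cong_sets)
  ultimately show ?thesis unfolding jump_function_def by measurable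
qed

lemma jumps_measurable[measurable]: "B \<in> sets borel \<Longrightarrow> jumps B \<in> borel_measurable M"
  unfolding jumps_eq[abs_def] by (intro integral_mu_measurable' jump_function_measurable)

lemma W_measurable[measurable]: "W t \<in> borel_measurable M"
  using W t_pos by (simp add: standard_brownian_motion_def real_process_def)

text \<open>Independence is assumed between the sigma-algebras generated by \<open>W\<close> and by
  the counts. As an integral against \<open>\<mu>\<close>, \<open>jumps B\<close> is measurable for
  the latter, here realised as the measure \<open>N\<close>.\<close>

lemma indep_W_jumps:
  assumes B: "B \<in> sets borel"
  shows "indep_var borel (W t) borel (jumps B)"
proof -
  define G where "G = (\<Union>A\<in>sets mean_measure. {(\<lambda>\<omega>. emeasure (\<mu> \<omega>) A) -` C \<inter> space M | C. C \<in> sets borel})"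
  define N where "N = sigma (space M) G"
  have G: "G \<subseteq> Pow (space M)" unfolding G_def by auto
  have N: "space N = space M" "sets N = sigma_sets (space M) G"
    using G by (auto simp: N_def)
  have gen: "generated_sigma M (sets mean_measure) (\<lambda>A \<omega>. emeasure (\<mu> \<omega>) A) = sigma_sets (space M) G"
    unfolding generated_sigma_def G_def ..
  have "(\<lambda>\<omega>. emeasure (\<mu> \<omega>) A) \<in> borel_measurable N" if "A \<in> sets mean_measure" for A
  proof (rule measurableI)
    fix C :: "ennreal set" assume "C \<in> sets borel"
    then have "(\<lambda>\<omega>. emeasure (\<mu> \<omega>) A) -` C \<inter> space M \<in> G" using that unfolding G_def by blast
    then show "(\<lambda>\<omega>. emeasure (\<mu> \<omega>) A) -` C \<inter> space N \<in> sets N"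
      unfolding N by (rule sigma_sets.Basic)
  qed simp
  then have "jumps B \<in> borel_measurable N"
    unfolding jumps_eq[abs_def] by (intro integral_mu_measurable jump_function_measurable B N(1))
  then have "{jumps B -` C \<inter> space M | C. C \<in> sets borel} \<subseteq> sigma_sets (space M) G"
    using measurable_sets[of "jumps B" N borel] by (auto simp: N)
  then have 1: "sigma_sets (space M) {jumps B -` C \<inter> space M | C. C \<in> sets borel}
      \<subseteq> generated_sigma M (sets mean_measure) (\<lambda>A \<omega>. emeasure (\<mu> \<omega>) A)"
    unfolding gen by (rule sigma_sets_mono)
  have 2: "sigma_sets (space M) {W t -` C \<inter> space M | C. C \<in> sets borel} \<subseteq> generated_sigma M {0..} W"
    unfolding generated_sigma_def using t_pos by (intro sigma_sets_mono') (force intro!: bexI[of _ t])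
  show ?thesis
    using independent 1 2 B unfolding independent_of_random_measure_def indep_var_eq indep_sets2_eq
    by auto blast+
qed

lemma W_normal: "distributed M lborel (\<lambda>\<omega>. W t \<omega> - W 0 \<omega>) (normal_density 0 (sqrt t))"
  "AE \<omega> in M. W 0 \<omega> = 0"
proof -
  have "\<forall>r\<ge>0. \<forall>t>r. distributed M lborel (\<lambda>\<omega>. W t \<omega> - W r \<omega>) (normal_density 0 (sqrt (t - r)))"
    using W by (simp add: standard_brownian_motion_def)
  from this[rule_format, of 0 t] show "distributed M lborel (\<lambda>\<omega>. W t \<omega> - W 0 \<omega>) (normal_density 0 (sqrt t))"
    using t_pos by simp
  show "AE \<omega> in M. W 0 \<omega> = 0"
    using W by (simp add: standard_brownian_motion_def)
qed

lemma W0_measurable[measurable]: "W 0 \<in> borel_measurable M"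
  using W by (simp add: standard_brownian_motion_def real_process_def)

lemma char_W: "(CLINT \<omega>|M. iexp (u * W t \<omega>)) = exp (- of_real (u\<^sup>2 * t / 2))"
proof -
  have "(CLINT \<omega>|M. iexp (u * W t \<omega>)) = (CLINT \<omega>|M. iexp (u * (W t \<omega> - W 0 \<omega>)))"
    by (rule integral_cong_AE) (use W_normal(2) in auto)
  also have "\<dots> = exp (- of_real ((u * sqrt t)\<^sup>2 / 2))"
    using char_normal[OF W_normal(1)] t_pos by simp
  finally show ?thesis using t_pos by (simp add: power_mult_distrib flip: of_real_power)
qed

lemma exp_moment_W: "has_bochner_integral M (\<lambda>\<omega>. exp (u * W t \<omega>)) (exp (u\<^sup>2 * t / 2))"
proof -
  have "has_bochner_integral M (\<lambda>\<omega>. exp (u * (W t \<omega> - W 0 \<omega>))) (exp ((u * sqrt t)\<^sup>2 / 2))"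
    using exp_moment_normal[OF W_normal(1)] t_pos by simp
  moreover have "AE \<omega> in M. exp (u * (W t \<omega> - W 0 \<omega>)) = exp (u * W t \<omega>)"
    using W_normal(2) by eventually_elim simp
  ultimately show ?thesis
    using t_pos by (subst has_bochner_integral_cong_AE[symmetric]) (auto simp: power_mult_distrib)
qed

lemma jump_function_support:
  assumes "B \<in> sets borel" "0 < a" "B \<subseteq> {x. a < \<bar>x\<bar>}"
  shows "emeasure mean_measure {p \<in> space mean_measure. jump_function B p \<noteq> 0} < \<infinity>"
proof -
  have "{0..t} \<times> B \<in> sets mean_measure"
    unfolding sets_mean_measure borel_prod[symmetric] using assms(1) by measurable
  then have "emeasure mean_measure {p \<in> space mean_measure. jump_function B p \<noteq> 0} \<le> emeasure mean_measure ({0..t} \<times> B)"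
    by (intro emeasure_mono) (auto simp: jump_function_def indicator_def split: if_splits)
  also have "\<dots> = ennreal t * emeasure \<nu> B"
    using assms(1) t_pos by (intro emeasure_mean_measure) auto
  also have "\<dots> < \<infinity>"
    using emeasure_levy_tail[OF assms] by (simp add: ennreal_mult_less_top)
  finally show ?thesis .
qed

lemma integral_exp_jump_function:
  fixes z :: complex
  assumes B: "B \<in> sets borel" "0 < a" "B \<subseteq> {x. a < \<bar>x\<bar>}"
    and C: "\<And>x. x \<in> B \<Longrightarrow> norm (exp (z * of_real x)) \<le> C"
  shows "(CLINT p|mean_measure. exp (z * of_real (jump_function B p)) - 1)
    = of_real t * (CLINT x|lborel. s x *\<^sub>R (indicator B x *\<^sub>R (exp (z * of_real x) - 1)))"
proof -
  let ?g = "\<lambda>x. indicator B x *\<^sub>R (exp (z * of_real x) - 1)"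
  have gm: "?g \<in> borel_measurable borel" using B(1) by measurable
  have gb: "norm (?g x) \<le> max 0 (C + 1)" for x
    using norm_triangle_ineq4[of "exp (z * of_real x)" 1] C[of x] by (auto simp: indicator_def)
  have i: "integrable lborel (\<lambda>x. s x *\<^sub>R ?g x)"
    by (rule integrable_levy_tail[OF gm gb B(2)]) (use B in \<open>auto simp: indicator_def\<close>)
  have "(exp (z * of_real (jump_function B p)) - 1) = indicator {0..t} (fst p) *\<^sub>R ?g (snd p)" for p
    by (cases p) (auto simp: jump_function_def indicator_def)
  then show ?thesis
    using integral_mean_measure[OF less_imp_le[OF t_pos] gm i] by (simp only: scaleR_conv_of_real[of t])
qed

lemma AE_jump_function_integrable:
  assumes B: "B \<in> sets borel" "0 < a" "B \<subseteq> {x. a < \<bar>x\<bar>}"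
  shows "AE \<omega> in M. integrable (\<mu> \<omega>) (jump_function B)"
  by (rule has_integral_iexp(1)[OF jump_function_measurable[OF B(1)] jump_function_support[OF B]])

lemma AE_jumps_Un:
  assumes B: "B \<in> sets borel" "B \<subseteq> {x. a < \<bar>x\<bar>}" and C: "C \<in> sets borel" "C \<subseteq> {x. a < \<bar>x\<bar>}"
    and a: "0 < a" and disj: "B \<inter> C = {}"
  shows "AE \<omega> in M. jumps (B \<union> C) \<omega> = jumps B \<omega> + jumps C \<omega>"
  using AE_jump_function_integrable[OF B(1) a B(2)] AE_jump_function_integrable[OF C(1) a C(2)]
proof eventually_elim
  case (elim \<omega>)
  have "jump_function (B \<union> C) p = jump_function B p + jump_function C p" for p
    using disj by (cases p) (auto simp: jump_function_def indicator_def)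
  then show ?case using elim by (simp add: jumps_eq)
qed

text \<open>The Levy-Khintchine formula in its uncompensated form, legitimate because
  \<open>B\<close> stays away from 0.\<close>

lemma char_W_jumps:
  assumes B: "B \<in> sets borel" "0 < a" "B \<subseteq> {x. a < \<bar>x\<bar>}"
  shows "(CLINT \<omega>|M. iexp (u * (\<sigma> * W t \<omega> + jumps B \<omega>)))
    = exp (of_real t * ((CLINT x|lborel. s x *\<^sub>R (indicator B x *\<^sub>R (iexp (u * x) - 1))) - of_real (\<sigma>\<^sup>2 * u\<^sup>2 / 2)))"
proof -
  have "(CLINT \<omega>|M. iexp (u * jumps B \<omega>)) = exp (CLINT p|mean_measure. iexp (u * jump_function B p) - 1)"
    unfolding jumps_eq
    by (rule has_integral_iexp(2)[OF jump_function_measurable[OF B(1)] jump_function_support[OF B]])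
  also have "\<dots> = exp (of_real t * (CLINT x|lborel. s x *\<^sub>R (indicator B x *\<^sub>R (iexp (u * x) - 1))))"
    using integral_exp_jump_function[OF B, of "\<i> * of_real u" 1] by (simp add: mult.assoc)
  finally have j: "(CLINT \<omega>|M. iexp (u * jumps B \<omega>)) = \<dots>" .
  have ind: "indep_var borel (\<lambda>\<omega>. iexp (u * \<sigma> * W t \<omega>)) borel (\<lambda>\<omega>. iexp (u * jumps B \<omega>))"
    by (rule indep_var_compose[unfolded comp_def, OF indep_W_jumps[OF B(1)]]) measurable
  have "(CLINT \<omega>|M. iexp (u * (\<sigma> * W t \<omega> + jumps B \<omega>))) = (CLINT \<omega>|M. iexp (u * \<sigma> * W t \<omega>) * iexp (u * jumps B \<omega>))"
    by (simp add: exp_add[symmetric] algebra_simps)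
  also have "\<dots> = (CLINT \<omega>|M. iexp (u * \<sigma> * W t \<omega>)) * (CLINT \<omega>|M. iexp (u * jumps B \<omega>))"
    by (intro indep_var_lebesgue_integral[OF ind] integrable_iexp) (use B(1) in auto)
  also have "\<dots> = exp (- of_real ((u * \<sigma>)\<^sup>2 * t / 2)) * exp (of_real t * (CLINT x|lborel. s x *\<^sub>R (indicator B x *\<^sub>R (iexp (u * x) - 1))))"
    unfolding j char_W ..
  finally show ?thesis
    by (simp add: exp_add[symmetric] algebra_simps power_mult_distrib)
qed

text \<open>The complex formula at real exponents, which needs bounded jumps; both sides are
  embedded reals and can be compared as such.\<close>

lemma exp_moment_W_jumps:
  assumes B: "B \<in> sets borel" "0 < a" "B \<subseteq> {x. a < \<bar>x\<bar> \<and> \<bar>x\<bar> \<le> 1}"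
  shows "has_bochner_integral M (\<lambda>\<omega>. exp (u * (\<sigma> * W t \<omega> + jumps B \<omega>)))
    (exp (t * ((LINT x|lborel. s x * (indicator B x * (exp (u * x) - 1))) + \<sigma>\<^sup>2 * u\<^sup>2 / 2)))"
proof -
  have B': "B \<subseteq> {x. a < \<bar>x\<bar>}" using B by auto
  have bd: "\<bar>jump_function B p\<bar> \<le> 1" for p
    using B(3) by (cases p) (auto simp: jump_function_def indicator_def)
  have eb: "norm (exp (of_real u * of_real x :: complex)) \<le> exp \<bar>u\<bar>" if "x \<in> B" for x
  proof -
    have "\<bar>x\<bar> \<le> 1" using B(3) that by auto
    then have "\<bar>u\<bar> * \<bar>x\<bar> \<le> \<bar>u\<bar>" by (simp add: mult_left_le)
    then have "u * x \<le> \<bar>u\<bar>" using abs_ge_self[of "u * x"] by (simp add: abs_mult)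
    then show ?thesis by simp
  qed
  have "has_bochner_integral M (\<lambda>\<omega>. exp (of_real u * of_real (jumps B \<omega>)))
    (exp (CLINT p|mean_measure. exp (of_real u * of_real (jump_function B p)) - 1))"
    unfolding jumps_eq
    by (rule has_integral_exp_bounded[OF jump_function_measurable[OF B(1)] bd jump_function_support[OF B(1,2) B']])
  also have "(CLINT p|mean_measure. exp (of_real u * of_real (jump_function B p)) - 1)
    = of_real t * (CLINT x|lborel. s x *\<^sub>R (indicator B x *\<^sub>R (exp (of_real u * of_real x) - 1)))"
    by (rule integral_exp_jump_function[OF B(1,2) B' eb])
  also have "(CLINT x|lborel. s x *\<^sub>R (indicator B x *\<^sub>R (exp (of_real u * of_real x) - 1)))
    = (CLINT x|lborel. of_real (s x * (indicator B x * (exp (u * x) - 1))))"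
    by (intro Bochner_Integration.integral_cong refl) (simp add: scaleR_conv_of_real exp_of_real[symmetric])
  also have "of_real t * \<dots> = of_real (t * (LINT x|lborel. s x * (indicator B x * (exp (u * x) - 1))))"
    by (subst integral_complex_of_real) (rule of_real_mult[symmetric])
  finally have "has_bochner_integral M (\<lambda>\<omega>. complex_of_real (exp (u * jumps B \<omega>)))
    (of_real (exp (t * (LINT x|lborel. s x * (indicator B x * (exp (u * x) - 1))))))"
    by (simp only: exp_of_real of_real_mult[symmetric])
  then have j: "integrable M (\<lambda>\<omega>. exp (u * jumps B \<omega>))"
    "(LINT \<omega>|M. exp (u * jumps B \<omega>)) = exp (t * (LINT x|lborel. s x * (indicator B x * (exp (u * x) - 1))))"
    unfolding has_bochner_integral_iff integral_complex_of_real of_real_eq_iff complex_of_real_integrable_eq by auto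
  have w: "integrable M (\<lambda>\<omega>. exp (u * \<sigma> * W t \<omega>))" "(LINT \<omega>|M. exp (u * \<sigma> * W t \<omega>)) = exp ((u * \<sigma>)\<^sup>2 * t / 2)"
    using exp_moment_W[of "u * \<sigma>"] by (auto simp: has_bochner_integral_iff)
  have ind: "indep_var borel (\<lambda>\<omega>. exp (u * \<sigma> * W t \<omega>)) borel (\<lambda>\<omega>. exp (u * jumps B \<omega>))"
    by (rule indep_var_compose[unfolded comp_def, OF indep_W_jumps[OF B(1)]]) measurable
  have "has_bochner_integral M (\<lambda>\<omega>. exp (u * \<sigma> * W t \<omega>) * exp (u * jumps B \<omega>))
    (exp ((u * \<sigma>)\<^sup>2 * t / 2) * exp (t * (LINT x|lborel. s x * (indicator B x * (exp (u * x) - 1)))))"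
    using indep_var_integrable[OF ind w(1) j(1)] indep_var_lebesgue_integral[OF ind w(1) j(1)]
    by (simp add: has_bochner_integral_iff w j)
  then show ?thesis
    by (simp add: exp_add[symmetric] algebra_simps power_mult_distrib)
qed

lemma integral_jump_function_mean_measure:
  assumes B: "B \<in> sets borel" "0 < a" "B \<subseteq> {x. a < \<bar>x\<bar> \<and> \<bar>x\<bar> \<le> 1}"
  shows "(LINT p:{0..t} \<times> B|mean_measure. snd p) = t * (LINT x|lborel. s x * (indicator B x * x))"
proof -
  have i: "integrable lborel (\<lambda>x. s x *\<^sub>R (indicator B x * x))"
    by (rule integrable_levy_tail[where C = 1 and a = a]) (use B in \<open>auto simp: indicator_def\<close>)
  have "(LINT p:{0..t} \<times> B|mean_measure. snd p)
      = (LINT p|mean_measure. indicator {0..t} (fst p) *\<^sub>R (indicator B (snd p) * snd p))"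
    unfolding set_lebesgue_integral_def
    by (intro Bochner_Integration.integral_cong refl) (auto simp: indicator_def)
  then show ?thesis
    using integral_mean_measure[OF _ _ i] t_pos B(1) by simp
qed

end

text \<open>Needed because \<open>compensated_jumps\<close> provides convergence in mean square only.\<close>

lemma L2_AE_subseq:
  fixes F :: "real \<Rightarrow> 'a \<Rightarrow> real"
  assumes F[measurable]: "\<And>d. 0 < d \<Longrightarrow> F d \<in> borel_measurable M"
    and lim: "((\<lambda>d. \<integral>\<^sup>+\<omega>. ennreal ((F d \<omega>)\<^sup>2) \<partial>M) \<longlongrightarrow> 0) (at_right 0)" and "0 < a"
  obtains d :: "nat \<Rightarrow> real" where "\<And>n. 0 < d n" "\<And>n. d n < a" "d \<longlonglongrightarrow> 0"
    "AE \<omega> in M. (\<lambda>n. F (d n) \<omega>) \<longlonglongrightarrow> 0"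
proof -
  have "\<forall>\<^sub>F d in at_right 0. (\<integral>\<^sup>+\<omega>. ennreal ((F d \<omega>)\<^sup>2) \<partial>M) < 1"
    by (rule order_tendstoD(2)[OF lim]) simp
  then obtain c where c: "0 < c" "\<And>d. 0 < d \<Longrightarrow> d < c \<Longrightarrow> (\<integral>\<^sup>+\<omega>. ennreal ((F d \<omega>)\<^sup>2) \<partial>M) < 1"
    by (auto simp: eventually_at_right_field)
  \<comment> \<open>Below \<open>c\<close> the second moments are finite, so that Bochner integrals
    may replace the nonnegative ones and convergence in mean yields an almost sure
    subsequence.\<close>
  define b where "b = min a c"
  have b: "0 < b" "b \<le> a" "b \<le> c" using \<open>0 < a\<close> c by (auto simp: b_def)
  define e where "e n = b / (real n + 2)" for n
  have e0: "0 < e n" for n using b by (simp add: e_def)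
  have e1: "e n < b" for n
    using mult_strict_left_mono[of 1 "real n + 2" b] b by (simp add: e_def divide_less_eq)
  have el: "e \<longlonglongrightarrow> 0"
    unfolding e_def by real_asymp
  then have er: "filterlim e (at_right 0) sequentially"
    by (rule tendsto_imp_filterlim_at_right) (simp add: e0)
  have nn: "(\<integral>\<^sup>+\<omega>. ennreal ((F (e n) \<omega>)\<^sup>2) \<partial>M) < 1" for n
    using c(2)[OF e0] e1[of n] b by simp
  have i: "integrable M (\<lambda>\<omega>. (F (e n) \<omega>)\<^sup>2)" for n
    using nn[of n] F[OF e0] by (intro integrableI_nonneg) (auto intro: less_trans)
  have "(\<lambda>n. ennreal (LINT \<omega>|M. (F (e n) \<omega>)\<^sup>2)) \<longlonglongrightarrow> 0"
    using filterlim_compose[OF lim er] i by (simp add: nn_integral_eq_integral)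
  then have "(\<lambda>n. LINT \<omega>|M. norm ((F (e n) \<omega>)\<^sup>2)) \<longlonglongrightarrow> 0"
    by (subst (asm) tendsto_ennreal_iff[where x = 0, simplified]) auto
  from tendsto_L1_AE_subseq[OF i this] obtain r :: "nat \<Rightarrow> nat" where r: "strict_mono r"
    "AE \<omega> in M. (\<lambda>n. (F (e (r n)) \<omega>)\<^sup>2) \<longlonglongrightarrow> 0" by blast
  show ?thesis
  proof
    show "0 < e (r n)" "e (r n) < a" for n using e0 e1[of "r n"] b by auto
    show "(\<lambda>n. e (r n)) \<longlonglongrightarrow> 0"
      using LIMSEQ_subseq_LIMSEQ[OF el r(1)] by (simp add: comp_def)
    show "AE \<omega> in M. (\<lambda>n. F (e (r n)) \<omega>) \<longlonglongrightarrow> 0"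
      using r(2)
    proof eventually_elim
      case (elim \<omega>)
      from tendsto_real_sqrt[OF this] show ?case
        by (simp add: tendsto_rabs_zero_iff)
    qed
  qed
qed

lemma norm_iexp_minus_le: "norm (iexp x - 1 - \<i> * of_real x) \<le> x\<^sup>2"
  using iexp_approx1[of x 1] by (simp add: numeral_2_eq_2[symmetric] diff_diff_eq) (smt (verit) zero_le_power2)

section \<open>Drift and exponents for the cut at level \<delta>\<close>

context levy_density
begin

text \<open>The jumps between \<open>\<delta>\<close> and 1 are compensated in the triplet but
  uncompensated after the cut; their compensator goes into the drift, which becomes
  \<open>b - mid_drift \<delta>\<close>.\<close>

definition mid_drift :: "real \<Rightarrow> real" where
  "mid_drift \<delta> = (LINT x|lborel. s x * (indicator {x. \<delta> < \<bar>x\<bar> \<and> \<bar>x\<bar> \<le> 1} x * x))"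

text \<open>The linear term stays subtracted because the jumps near 0 need not be absolutely
  summable; in \<open>big_exponent\<close> there is no such term.\<close>

definition small_exponent :: "real \<Rightarrow> real \<Rightarrow> complex" where
  "small_exponent \<delta> u =
    (CLINT x|lborel. s x *\<^sub>R (indicator {x. \<bar>x\<bar> \<le> \<delta>} x *\<^sub>R (iexp (u * x) - 1 - \<i> * of_real (u * x))))"

definition big_exponent :: "real \<Rightarrow> real \<Rightarrow> complex" where
  "big_exponent \<delta> u =
    (CLINT x|lborel. of_real (s x * indicator {x. \<delta> < \<bar>x\<bar>} x) * (iexp (u * x) - 1))"

end

context levy_ito
begin

text \<open>\<open>Z\<close> is \<open>X\<close> without the jumps beyond \<open>\<delta>\<close>.
  It is the almost sure limit of \<open>Zn\<close>, where the jumps below \<open>d n\<close> are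
  dropped as well, so that all formulas are explicit. The factorisation comes from evaluating
  \<open>char_W_jumps\<close> on all jumps beyond \<open>d n\<close>, whose exponent is additive
  over the pieces \<open>S (d n)\<close> and \<open>T\<close>. The moment bound is uniform in
  \<open>n\<close> and passes to \<open>Z\<close> by Fatou's lemma.\<close>

proposition law_decomposition:
  fixes X J :: "'a \<Rightarrow> real"
  assumes \<delta>: "0 < \<delta>" "\<delta> < 1"
    and X[measurable]: "X \<in> borel_measurable M"
    and J: "compensated_jumps M \<mu> mean_measure t J"
    and X_eq: "AE \<omega> in M. X \<omega> = b * t + \<sigma> * W t \<omega> + J \<omega> + (LINT p:{0..t} \<times> {x. 1 < \<bar>x\<bar>}|\<mu> \<omega>. snd p)"
  obtains Z where "Z \<in> borel_measurable M"
    "\<And>u. (CLINT \<omega>|M. iexp (u * X \<omega>)) = (CLINT \<omega>|M. iexp (u * Z \<omega>)) * exp (of_real t * big_exponent \<delta> u)"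
    "\<And>u. (CLINT \<omega>|M. iexp (u * Z \<omega>)) =
      exp (of_real t * (\<i> * of_real (u * (b - mid_drift \<delta>)) - of_real (\<sigma>\<^sup>2 * u\<^sup>2 / 2) + small_exponent \<delta> u))"
    "\<And>u. (\<integral>\<^sup>+\<omega>. ennreal (exp (u * Z \<omega>)) \<partial>M)
      \<le> ennreal (exp (t * (u * (b - mid_drift \<delta>) + \<sigma>\<^sup>2 * u\<^sup>2 / 2 + u\<^sup>2 * exp (\<bar>u\<bar> * \<delta>) * V)))"
proof -
  define A where "A d = {x::real. d < \<bar>x\<bar> \<and> \<bar>x\<bar> \<le> 1}" for d
  define S where "S d = {x::real. d < \<bar>x\<bar> \<and> \<bar>x\<bar> \<le> \<delta>}" for d
  define T where "T = {x::real. \<delta> < \<bar>x\<bar>}"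
  have Tm: "{x::real. d < \<bar>x\<bar>} \<in> sets borel" for d by measurable
  have meas[measurable]: "A d \<in> sets borel" "S d \<in> sets borel" "T \<in> sets borel" for d
    unfolding A_def S_def T_def by measurable
  have [measurable]: "J \<in> borel_measurable M" using J by (simp add: compensated_jumps_def)
  have mid: "(LINT p:{0..t} \<times> A d|mean_measure. snd p) = t * mid_drift d" if "0 < d" for d
    unfolding mid_drift_def A_def[symmetric]
    by (rule integral_jump_function_mean_measure[OF _ that]) (auto simp: A_def)
  have "((\<lambda>d. \<integral>\<^sup>+\<omega>. ennreal ((jumps (A d) \<omega> - (LINT p:{0..t} \<times> A d|mean_measure. snd p) - J \<omega>)\<^sup>2) \<partial>M) \<longlongrightarrow> 0) (at_right 0)"
    using J unfolding compensated_jumps_def A_def jumps_def by simp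
  moreover have "\<forall>\<^sub>F d in at_right 0. (\<integral>\<^sup>+\<omega>. ennreal ((jumps (A d) \<omega> - (LINT p:{0..t} \<times> A d|mean_measure. snd p) - J \<omega>)\<^sup>2) \<partial>M)
      = (\<integral>\<^sup>+\<omega>. ennreal ((jumps (A d) \<omega> - t * mid_drift d - J \<omega>)\<^sup>2) \<partial>M)"
    by (auto simp: eventually_at_right_field mid intro!: exI[of _ 1])
  ultimately have lim: "((\<lambda>d. \<integral>\<^sup>+\<omega>. ennreal ((jumps (A d) \<omega> - t * mid_drift d - J \<omega>)\<^sup>2) \<partial>M) \<longlongrightarrow> 0) (at_right 0)"
    by (rule Lim_transform_eventually)
  obtain d where d: "\<And>n. 0 < d n" "\<And>n. d n < \<delta>" "d \<longlonglongrightarrow> 0"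
    and d_lim: "AE \<omega> in M. (\<lambda>n. jumps (A (d n)) \<omega> - t * mid_drift (d n) - J \<omega>) \<longlonglongrightarrow> 0"
    using L2_AE_subseq[OF _ lim \<delta>(1)] by (auto simp: measurable_If)
  define Z where "Z \<omega> = X \<omega> - jumps T \<omega>" for \<omega>
  define Zn where "Zn n \<omega> = (b - mid_drift (d n)) * t + (\<sigma> * W t \<omega> + jumps (S (d n)) \<omega>)" for n \<omega>
  have [measurable]: "Z \<in> borel_measurable M" "Zn n \<in> borel_measurable M" for n
    unfolding Z_def Zn_def by measurable
  have a1: "AE \<omega> in M. jumps (A (d n)) \<omega> = jumps (S (d n)) \<omega> + jumps (A \<delta>) \<omega>" for n
  proof -
    have eq: "A (d n) = S (d n) \<union> A \<delta>" using d(2)[of n] \<delta> by (auto simp: A_def S_def)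
    show ?thesis unfolding eq
      by (rule AE_jumps_Un[OF meas(2) _ meas(1) _ d(1)[of n]]) (use d(2)[of n] in \<open>auto simp: A_def S_def\<close>)
  qed
  have a2: "AE \<omega> in M. jumps T \<omega> = jumps (A \<delta>) \<omega> + jumps {x. 1 < \<bar>x\<bar>} \<omega>"
  proof -
    have eq: "T = A \<delta> \<union> {x. 1 < \<bar>x\<bar>}" using \<delta> by (auto simp: A_def T_def)
    show ?thesis unfolding eq
      by (rule AE_jumps_Un[OF meas(1) _ Tm _ \<delta>(1)]) (use \<delta> in \<open>auto simp: A_def\<close>)
  qed
  have a3: "AE \<omega> in M. jumps {x. d n < \<bar>x\<bar>} \<omega> = jumps (S (d n)) \<omega> + jumps T \<omega>" for n
  proof -
    have eq: "{x. d n < \<bar>x\<bar>} = S (d n) \<union> T" using d(2)[of n] by (auto simp: S_def T_def)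
    show ?thesis unfolding eq
      by (rule AE_jumps_Un[OF meas(2) _ meas(3) _ d(1)[of n]]) (use d(2)[of n] in \<open>auto simp: S_def T_def\<close>)
  qed
  have a1': "AE \<omega> in M. \<forall>n. jumps (A (d n)) \<omega> = jumps (S (d n)) \<omega> + jumps (A \<delta>) \<omega>"
    using a1 by (simp add: AE_all_countable)
  have Z_lim: "AE \<omega> in M. (\<lambda>n. Zn n \<omega>) \<longlonglongrightarrow> Z \<omega>"
    using a1' a2 d_lim X_eq
  proof eventually_elim
    case (elim \<omega>)
    \<comment> \<open>By \<open>a1'\<close> and \<open>a2\<close> the jumps beyond
      \<open>\<delta>\<close> cancel; what remains is exactly the error of the compensated limit,
      which tends to 0 along the chosen \<open>d\<close>.\<close>
    have "Zn n \<omega> = Z \<omega> + (jumps (A (d n)) \<omega> - t * mid_drift (d n) - J \<omega>)" for n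
      using elim unfolding Zn_def Z_def jumps_def[of "{x. 1 < \<bar>x\<bar>}", symmetric] by (simp add: algebra_simps)
    then show ?case using tendsto_add[OF tendsto_const elim(3), of "Z \<omega>"] by simp
  qed
  have bd: "norm (indicator B x *\<^sub>R (iexp (u * x) - 1)) \<le> 2" for u x and B :: "real set"
    using norm_triangle_ineq4[of "iexp (u * x)" 1] by (auto simp: indicator_def)
  have i_tail: "integrable lborel (\<lambda>x. s x *\<^sub>R (indicator B x *\<^sub>R (iexp (u * x) - 1)))"
    if "B \<in> sets borel" "0 < a" "B \<subseteq> {x. a < \<bar>x\<bar>}" for a u B
    by (rule integrable_levy_tail[OF _ bd that(2)]) (use that in \<open>auto simp: indicator_def\<close>)
  have i_lin: "integrable lborel (\<lambda>x. s x * (indicator B x * x))"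
    if "B \<in> sets borel" "0 < a" "B \<subseteq> {x. a < \<bar>x\<bar> \<and> \<bar>x\<bar> \<le> 1}" for a and B
    unfolding real_scaleR_def[symmetric, of "s _"]
    by (rule integrable_levy_tail[where C = 1 and a = a]) (use that in \<open>auto simp: indicator_def\<close>)
  define E where "E B u = (CLINT x|lborel. s x *\<^sub>R (indicator B x *\<^sub>R (iexp (u * x) - 1)))" for B u
  have E_T: "E T u = big_exponent \<delta> u" for u
    unfolding E_def big_exponent_def T_def[symmetric] by (simp add: scaleR_conv_of_real mult.assoc)
  have Sd: "S (d n) \<subseteq> {x. d n < \<bar>x\<bar>}" for n by (auto simp: S_def)
  have char_Zn: "(CLINT \<omega>|M. iexp (u * Zn n \<omega>)) =
      exp (of_real t * (\<i> * of_real (u * (b - mid_drift (d n))) - of_real (\<sigma>\<^sup>2 * u\<^sup>2 / 2) + E (S (d n)) u))" for u n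
  proof -
    have "(CLINT \<omega>|M. iexp (u * Zn n \<omega>)) = iexp (u * ((b - mid_drift (d n)) * t)) * (CLINT \<omega>|M. iexp (u * (\<sigma> * W t \<omega> + jumps (S (d n)) \<omega>)))"
      unfolding Zn_def by (simp add: distrib_left exp_add)
    also have "\<dots> = iexp (u * ((b - mid_drift (d n)) * t)) * exp (of_real t * (E (S (d n)) u - of_real (\<sigma>\<^sup>2 * u\<^sup>2 / 2)))"
      unfolding E_def by (subst char_W_jumps[OF _ d(1) Sd]) auto
    finally show ?thesis by (simp add: exp_add[symmetric] algebra_simps)
  qed
  \<comment> \<open>Up to the drift, \<open>Zn n \<omega> + jumps T \<omega>\<close> is the Gaussian
    part plus all jumps beyond \<open>d n\<close>, hence again of the form treated by
    \<open>char_W_jumps\<close>.\<close>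
  have char_Xn: "(CLINT \<omega>|M. iexp (u * (Zn n \<omega> + jumps T \<omega>))) = (CLINT \<omega>|M. iexp (u * Zn n \<omega>)) * exp (of_real t * big_exponent \<delta> u)" for u n
  proof -
    let ?B = "{x. d n < \<bar>x\<bar>}"
    have "(CLINT \<omega>|M. iexp (u * (Zn n \<omega> + jumps T \<omega>)))
        = (CLINT \<omega>|M. iexp (u * ((b - mid_drift (d n)) * t)) * iexp (u * (\<sigma> * W t \<omega> + jumps ?B \<omega>)))"
    proof (rule integral_cong_AE)
      show "AE \<omega> in M. iexp (u * (Zn n \<omega> + jumps T \<omega>)) = iexp (u * ((b - mid_drift (d n)) * t)) * iexp (u * (\<sigma> * W t \<omega> + jumps ?B \<omega>))"
        using a3[of n] by eventually_elim (simp add: Zn_def exp_add[symmetric] algebra_simps)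
    qed (use Tm in measurable)
    also have "\<dots> = iexp (u * ((b - mid_drift (d n)) * t)) * exp (of_real t * (E ?B u - of_real (\<sigma>\<^sup>2 * u\<^sup>2 / 2)))"
      unfolding E_def char_W_jumps[OF Tm d(1) order_refl, symmetric] by (rule integral_mult_right_zero)
    also have "E ?B u = E (S (d n)) u + E T u"
    proof -
      have "E ?B u = (CLINT x|lborel. s x *\<^sub>R (indicator (S (d n)) x *\<^sub>R (iexp (u * x) - 1)) + s x *\<^sub>R (indicator T x *\<^sub>R (iexp (u * x) - 1)))"
        unfolding E_def using d(2)[of n]
        by (intro Bochner_Integration.integral_cong refl) (auto simp: indicator_def S_def T_def)
      then show ?thesis
        unfolding E_def
        by (subst (asm) Bochner_Integration.integral_add[OF i_tail[OF _ d(1)] i_tail[OF _ \<delta>(1)]])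
          (auto simp: S_def[of "d n"] T_def)
    qed
    finally show ?thesis
      unfolding char_Zn E_T by (simp add: exp_add[symmetric] algebra_simps)
  qed
  have l1: "(\<lambda>n. CLINT \<omega>|M. iexp (u * Zn n \<omega>)) \<longlonglongrightarrow> (CLINT \<omega>|M. iexp (u * Z \<omega>))" for u
  proof (rule integral_dominated_convergence[where w = "\<lambda>_. 1"])
    show "AE \<omega> in M. (\<lambda>n. iexp (u * Zn n \<omega>)) \<longlonglongrightarrow> iexp (u * Z \<omega>)"
      using Z_lim by eventually_elim (intro tendsto_intros)
  qed auto
  have l2: "(\<lambda>n. CLINT \<omega>|M. iexp (u * (Zn n \<omega> + jumps T \<omega>))) \<longlonglongrightarrow> (CLINT \<omega>|M. iexp (u * X \<omega>))" for u
  proof (rule integral_dominated_convergence[where w = "\<lambda>_. 1"])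
    show "AE \<omega> in M. (\<lambda>n. iexp (u * (Zn n \<omega> + jumps T \<omega>))) \<longlonglongrightarrow> iexp (u * X \<omega>)"
      using Z_lim
    proof eventually_elim
      case (elim \<omega>)
      have "(\<lambda>n. iexp (u * (Zn n \<omega> + jumps T \<omega>))) \<longlonglongrightarrow> iexp (u * (Z \<omega> + jumps T \<omega>))"
        by (intro tendsto_intros elim)
      then show ?case by (simp add: Z_def)
    qed
  qed auto
  have mid_split: "mid_drift (d n) = mid_drift \<delta> + (LINT x|lborel. s x * (indicator (S (d n)) x * x))" for n
  proof -
    have "mid_drift (d n) = (LINT x|lborel. s x * (indicator (A \<delta>) x * x) + s x * (indicator (S (d n)) x * x))"
      unfolding mid_drift_def using d(2)[of n] \<delta>
      by (intro Bochner_Integration.integral_cong refl) (auto simp: indicator_def S_def A_def)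
    then show ?thesis
      using i_lin[of "A \<delta>" \<delta>] i_lin[of "S (d n)" "d n"] \<delta> d(1)[of n]
      by (simp add: mid_drift_def A_def[symmetric]) (auto simp: A_def S_def subset_eq)
  qed
  have S_in: "S (d n) \<subseteq> {x. d n < \<bar>x\<bar> \<and> \<bar>x\<bar> \<le> 1}" for n using \<delta> by (auto simp: S_def)
  \<comment> \<open>Neither \<open>mid_drift (d n)\<close> nor \<open>E (S (d n)) u\<close> need
    converge. Moving the linear term of the jumps in \<open>S (d n)\<close> from the drift into the
    integral leaves an integrand of order x^2, to which dominated convergence applies.\<close>
  have E_split: "\<i> * of_real (u * (b - mid_drift (d n))) + E (S (d n)) u = \<i> * of_real (u * (b - mid_drift \<delta>))
    + (CLINT x|lborel. s x *\<^sub>R (indicator (S (d n)) x *\<^sub>R (iexp (u * x) - 1 - \<i> * of_real (u * x))))" for u n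
  proof -
    let ?r = "\<lambda>x. s x * (indicator (S (d n)) x * x)"
    have ir: "integrable lborel (\<lambda>x. \<i> * of_real u * of_real (?r x) :: complex)"
      using i_lin[OF _ d(1) S_in, of n] by (intro integrable_mult_right integrable_of_real) auto
    have "(CLINT x|lborel. s x *\<^sub>R (indicator (S (d n)) x *\<^sub>R (iexp (u * x) - 1 - \<i> * of_real (u * x))))
      = (CLINT x|lborel. s x *\<^sub>R (indicator (S (d n)) x *\<^sub>R (iexp (u * x) - 1)) - \<i> * of_real u * of_real (?r x))"
      by (intro Bochner_Integration.integral_cong refl) (simp add: scaleR_conv_of_real algebra_simps)
    also have "\<dots> = E (S (d n)) u - (CLINT x|lborel. \<i> * of_real u * of_real (?r x))"
      unfolding E_def by (intro Bochner_Integration.integral_diff ir i_tail[OF _ d(1) Sd]) auto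
    also have "(CLINT x|lborel. \<i> * of_real u * of_real (?r x)) = \<i> * of_real u * of_real (LINT x|lborel. ?r x)"
      by (simp only: integral_mult_right_zero integral_complex_of_real)
    finally show ?thesis unfolding mid_split[of n] by (simp add: algebra_simps)
  qed
  have l3: "(\<lambda>n. CLINT x|lborel. s x *\<^sub>R (indicator (S (d n)) x *\<^sub>R (iexp (u * x) - 1 - \<i> * of_real (u * x))))
      \<longlonglongrightarrow> small_exponent \<delta> u" for u
    unfolding small_exponent_def
  proof (rule integral_dominated_convergence[where w = "\<lambda>x. u\<^sup>2 * (s x * min 1 (x\<^sup>2))"])
    show "integrable lborel (\<lambda>x. u\<^sup>2 * (s x * min 1 (x\<^sup>2)))"
      using integrable_min by (rule integrable_mult_right)
    show "AE x in lborel. (\<lambda>n. s x *\<^sub>R (indicator (S (d n)) x *\<^sub>R (iexp (u * x) - 1 - \<i> * of_real (u * x))))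
      \<longlonglongrightarrow> s x *\<^sub>R (indicator {x. \<bar>x\<bar> \<le> \<delta>} x *\<^sub>R (iexp (u * x) - 1 - \<i> * of_real (u * x)))"
    proof (rule AE_I2)
      fix x :: real
      show "(\<lambda>n. s x *\<^sub>R (indicator (S (d n)) x *\<^sub>R (iexp (u * x) - 1 - \<i> * of_real (u * x))))
        \<longlonglongrightarrow> s x *\<^sub>R (indicator {x. \<bar>x\<bar> \<le> \<delta>} x *\<^sub>R (iexp (u * x) - 1 - \<i> * of_real (u * x)))"
      proof (cases "x = 0")
        case False
        then have "\<forall>\<^sub>F n in sequentially. d n < \<bar>x\<bar>"
          by (intro order_tendstoD(2)[OF d(3)]) simp
        then show ?thesis
          by (intro tendsto_eventually) (auto elim!: eventually_mono simp: S_def indicator_def)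
      qed simp
    qed
    show "AE x in lborel. norm (s x *\<^sub>R (indicator (S (d n)) x *\<^sub>R (iexp (u * x) - 1 - \<i> * of_real (u * x))))
      \<le> u\<^sup>2 * (s x * min 1 (x\<^sup>2))" for n
    proof (rule AE_I2)
      fix x :: real
      show "norm (s x *\<^sub>R (indicator (S (d n)) x *\<^sub>R (iexp (u * x) - 1 - \<i> * of_real (u * x)))) \<le> u\<^sup>2 * (s x * min 1 (x\<^sup>2))"
      proof (cases "x \<in> S (d n)")
        case True
        then have "x\<^sup>2 \<le> 1" using \<delta> by (auto simp: S_def abs_square_le_1)
        then show ?thesis
          using True s_nonneg[of x] mult_left_mono[OF norm_iexp_minus_le[of "u * x"] s_nonneg[of x]]
          by (simp add: power_mult_distrib mult_ac)
      qed (simp add: s_nonneg)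
    qed
  qed measurable
  show ?thesis
  proof
    show "Z \<in> borel_measurable M" by measurable
  next
    fix u
    show "(CLINT \<omega>|M. iexp (u * X \<omega>)) = (CLINT \<omega>|M. iexp (u * Z \<omega>)) * exp (of_real t * big_exponent \<delta> u)"
      by (rule LIMSEQ_unique[OF l2]) (unfold char_Xn, intro tendsto_intros l1)
  next
    fix u
    have "(\<lambda>n. exp (of_real t * (\<i> * of_real (u * (b - mid_drift \<delta>)) - of_real (\<sigma>\<^sup>2 * u\<^sup>2 / 2) +
        (CLINT x|lborel. s x *\<^sub>R (indicator (S (d n)) x *\<^sub>R (iexp (u * x) - 1 - \<i> * of_real (u * x)))))))
      \<longlonglongrightarrow> exp (of_real t * (\<i> * of_real (u * (b - mid_drift \<delta>)) - of_real (\<sigma>\<^sup>2 * u\<^sup>2 / 2) + small_exponent \<delta> u))"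
      by (intro tendsto_intros l3)
    moreover have "(CLINT \<omega>|M. iexp (u * Zn n \<omega>)) = exp (of_real t * (\<i> * of_real (u * (b - mid_drift \<delta>)) - of_real (\<sigma>\<^sup>2 * u\<^sup>2 / 2) +
        (CLINT x|lborel. s x *\<^sub>R (indicator (S (d n)) x *\<^sub>R (iexp (u * x) - 1 - \<i> * of_real (u * x))))))" for n
      unfolding char_Zn diff_add_eq E_split ..
    ultimately show "(CLINT \<omega>|M. iexp (u * Z \<omega>)) =
      exp (of_real t * (\<i> * of_real (u * (b - mid_drift \<delta>)) - of_real (\<sigma>\<^sup>2 * u\<^sup>2 / 2) + small_exponent \<delta> u))"
      using l1[of u] LIMSEQ_unique by auto
  next
    fix u :: real
    let ?K = "exp (t * (u * (b - mid_drift \<delta>) + \<sigma>\<^sup>2 * u\<^sup>2 / 2 + u\<^sup>2 * exp (\<bar>u\<bar> * \<delta>) * V))"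
    have bound: "(\<integral>\<^sup>+\<omega>. ennreal (exp (u * Zn n \<omega>)) \<partial>M) \<le> ennreal ?K" for n
    proof -
      let ?B = "S (d n)" and ?c = "u * ((b - mid_drift (d n)) * t)"
      let ?e = "\<lambda>x. s x * (indicator ?B x * (exp (u * x) - 1))"
      have hb: "has_bochner_integral M (\<lambda>\<omega>. exp (u * (\<sigma> * W t \<omega> + jumps ?B \<omega>)))
        (exp (t * ((LINT x|lborel. ?e x) + \<sigma>\<^sup>2 * u\<^sup>2 / 2)))"
        by (rule exp_moment_W_jumps[OF _ d(1) S_in]) measurable
      have eq: "exp (u * Zn n \<omega>) = exp ?c * exp (u * (\<sigma> * W t \<omega> + jumps ?B \<omega>))" for \<omega>
        unfolding Zn_def by (simp add: exp_add[symmetric] distrib_left)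
      have "(\<integral>\<^sup>+\<omega>. ennreal (exp (u * Zn n \<omega>)) \<partial>M) = ennreal (LINT \<omega>|M. exp (u * Zn n \<omega>))"
        unfolding eq using hb by (intro nn_integral_eq_integral) (auto simp: has_bochner_integral_iff)
      also have "(LINT \<omega>|M. exp (u * Zn n \<omega>)) = exp (?c + t * ((LINT x|lborel. ?e x) + \<sigma>\<^sup>2 * u\<^sup>2 / 2))"
        unfolding eq using hb by (simp add: has_bochner_integral_iff exp_add)
      also have "\<dots> \<le> ?K"
      proof -
        have il: "integrable lborel (\<lambda>x. s x * (indicator ?B x * x))"
          by (rule i_lin[OF _ d(1) S_in]) measurable
        have ul: "u * x \<le> \<bar>u\<bar> * \<delta>" "\<bar>u * x\<bar> \<le> \<bar>u\<bar> * \<delta>" if "x \<in> ?B" for x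
          using that mult_left_mono[of "\<bar>x\<bar>" \<delta> "\<bar>u\<bar>"] abs_ge_self[of "u * x"] by (auto simp: S_def abs_mult)
        have ie: "integrable lborel ?e"
        proof -
          have "norm (indicator ?B x * (exp (u * x) - 1)) \<le> exp (\<bar>u\<bar> * \<delta>) + 1" for x
          proof (cases "x \<in> ?B")
            case True
            then have "exp (u * x) \<le> exp (\<bar>u\<bar> * \<delta>)" using ul by simp
            then have "\<bar>exp (u * x) - 1\<bar> \<le> exp (\<bar>u\<bar> * \<delta>) + 1"
              using exp_gt_zero[of "u * x"] unfolding abs_le_iff by linarith
            then show ?thesis using True by simp
          qed (simp add: add_nonneg_nonneg)
          then show ?thesis
            unfolding real_scaleR_def[symmetric, of "s _"]
            by (rule integrable_levy_tail[OF _ _ d(1)[of n], rotated]) (auto simp: S_def)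
        qed
        \<comment> \<open>The same exchange with the drift as in \<open>E_split\<close>, now for a
          real exponent; it makes the bound independent of \<open>n\<close>.\<close>
        have "(LINT x|lborel. ?e x) - u * (LINT x|lborel. s x * (indicator ?B x * x))
          = (LINT x|lborel. ?e x - u * (s x * (indicator ?B x * x)))"
          using ie il by simp
        also have "\<dots> \<le> (LINT x|lborel. u\<^sup>2 * exp (\<bar>u\<bar> * \<delta>) * (s x * min 1 (x\<^sup>2)))"
        proof (rule integral_mono)
          show "integrable lborel (\<lambda>x. ?e x - u * (s x * (indicator ?B x * x)))" using ie il by simp
          show "integrable lborel (\<lambda>x. u\<^sup>2 * exp (\<bar>u\<bar> * \<delta>) * (s x * min 1 (x\<^sup>2)))"
            using integrable_min by (rule integrable_mult_right)
          fix x
          show "?e x - u * (s x * (indicator ?B x * x)) \<le> u\<^sup>2 * exp (\<bar>u\<bar> * \<delta>) * (s x * min 1 (x\<^sup>2))"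
          proof (cases "x \<in> ?B")
            case True
            then have "x\<^sup>2 \<le> 1" using \<delta> by (auto simp: S_def abs_square_le_1)
            have "exp (u * x) - 1 - u * x \<le> (u * x)\<^sup>2 * exp \<bar>u * x\<bar>" by (rule exp_minus_one_minus_le)
            also have "\<dots> \<le> (u * x)\<^sup>2 * exp (\<bar>u\<bar> * \<delta>)" using ul[OF True] by (intro mult_left_mono) auto
            finally have "s x * (exp (u * x) - 1 - u * x) \<le> s x * ((u * x)\<^sup>2 * exp (\<bar>u\<bar> * \<delta>))"
              by (intro mult_left_mono s_nonneg)
            then show ?thesis using True \<open>x\<^sup>2 \<le> 1\<close> by (simp add: power_mult_distrib algebra_simps)
          qed (simp add: s_nonneg)
        qed
        also have "\<dots> = u\<^sup>2 * exp (\<bar>u\<bar> * \<delta>) * V" by (simp add: V_def)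
        finally have "t * ((LINT x|lborel. ?e x) - u * (LINT x|lborel. s x * (indicator ?B x * x))) \<le> t * (u\<^sup>2 * exp (\<bar>u\<bar> * \<delta>) * V)"
          using t_pos by (intro mult_left_mono) auto
        then show ?thesis unfolding mid_split[of n] exp_le_cancel_iff by (simp add: algebra_simps)
      qed
      finally show ?thesis by (simp add: ennreal_leI)
    qed
    have "(\<integral>\<^sup>+\<omega>. ennreal (exp (u * Z \<omega>)) \<partial>M) = (\<integral>\<^sup>+\<omega>. liminf (\<lambda>n. ennreal (exp (u * Zn n \<omega>))) \<partial>M)"
    proof (rule nn_integral_cong_AE)
      show "AE \<omega> in M. ennreal (exp (u * Z \<omega>)) = liminf (\<lambda>n. ennreal (exp (u * Zn n \<omega>)))"
        using Z_lim
      proof eventually_elim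
        case (elim \<omega>)
        have "(\<lambda>n. ennreal (exp (u * Zn n \<omega>))) \<longlonglongrightarrow> ennreal (exp (u * Z \<omega>))"
          by (intro tendsto_intros elim)
        then show ?case by (intro lim_imp_Liminf[symmetric]) auto
      qed
    qed
    also have "\<dots> \<le> liminf (\<lambda>n. \<integral>\<^sup>+\<omega>. ennreal (exp (u * Zn n \<omega>)) \<partial>M)"
      by (rule nn_integral_liminf) measurable
    also have "\<dots> \<le> ennreal ?K"
      using bound by (intro Liminf_le) auto
    finally show "(\<integral>\<^sup>+\<omega>. ennreal (exp (u * Z \<omega>)) \<partial>M) \<le> ennreal ?K" .
  qed
qed

end

section \<open>Expansion of the tail in the number of large jumps\<close>

context levy_density
begin

definition big_part :: "real \<Rightarrow> real \<Rightarrow> real" where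
  "big_part \<delta> x = s x * indicator {x. \<delta> < \<bar>x\<bar>} x"

definition one_jump :: "real \<Rightarrow> real \<Rightarrow> real \<Rightarrow> real" where
  "one_jump y \<delta> z = (LINT x|lborel. big_part \<delta> x * indicator {y..} (z + x))"

definition two_jumps :: "real \<Rightarrow> real \<Rightarrow> real \<Rightarrow> real" where
  "two_jumps y \<delta> z = (LINT x|lborel. big_part \<delta> x * one_jump y \<delta> (z + x))"

definition big_mass :: "real \<Rightarrow> real" where
  "big_mass \<delta> = (LINT x|lborel. big_part \<delta> x)"

lemma big_part_measurable[measurable]: "big_part \<delta> \<in> borel_measurable borel"
  unfolding big_part_def by measurable

lemma big_part_nonneg: "0 \<le> big_part \<delta> x"
  by (simp add: big_part_def s_nonneg)

lemma integrable_big_part: "0 < \<delta> \<Longrightarrow> integrable lborel (big_part \<delta>)"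
  using integrable_levy_tail[of "indicator {x. \<delta> < \<bar>x\<bar>} :: real \<Rightarrow> real" 1 \<delta>]
  unfolding big_part_def by (auto simp: indicator_def)

lemma integrable_big_part_mult:
  fixes f :: "real \<Rightarrow> real"
  assumes "0 < \<delta>" and f[measurable]: "f \<in> borel_measurable borel" and B: "\<And>x. \<bar>f x\<bar> \<le> B"
  shows "integrable lborel (\<lambda>x. big_part \<delta> x * f x)"
    and "\<bar>LINT x|lborel. big_part \<delta> x * f x\<bar> \<le> big_mass \<delta> * B"
proof -
  have i: "integrable lborel (\<lambda>x. big_part \<delta> x * B)"
    using integrable_big_part[OF assms(1)] by (rule integrable_mult_left)
  have b: "norm (big_part \<delta> x * f x) \<le> big_part \<delta> x * B" for x
    using B[of x] by (simp add: abs_mult big_part_nonneg mult_left_mono)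
  show 1: "integrable lborel (\<lambda>x. big_part \<delta> x * f x)"
    by (rule Bochner_Integration.integrable_bound[OF i]) (use b in \<open>auto intro: order_trans[OF _ abs_ge_self]\<close>)
  have "norm (LINT x|lborel. big_part \<delta> x * f x) \<le> (LINT x|lborel. big_part \<delta> x * B)"
    by (rule Bochner_Integration.integral_norm_bound_integral[OF 1 i]) (use b in auto)
  then show "\<bar>LINT x|lborel. big_part \<delta> x * f x\<bar> \<le> big_mass \<delta> * B"
    by (simp add: big_mass_def)
qed

lemma one_jump_measurable[measurable]: "one_jump y \<delta> \<in> borel_measurable borel"
  unfolding one_jump_def by measurable

lemma abs_one_jump_le: "0 < \<delta> \<Longrightarrow> \<bar>one_jump y \<delta> z\<bar> \<le> big_mass \<delta>"
  using integrable_big_part_mult(2)[of \<delta> "\<lambda>x. indicator {y..} (z + x)" 1]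
  unfolding one_jump_def by simp

lemma two_jumps_measurable[measurable]: "two_jumps y \<delta> \<in> borel_measurable borel"
  unfolding two_jumps_def by measurable

lemma abs_two_jumps_le: "0 < \<delta> \<Longrightarrow> \<bar>two_jumps y \<delta> z\<bar> \<le> (big_mass \<delta>)\<^sup>2"
  using integrable_big_part_mult(2)[of \<delta> "\<lambda>x. one_jump y \<delta> (z + x)" "big_mass \<delta>"] abs_one_jump_le
  unfolding two_jumps_def by (simp add: power2_eq_square)

text \<open>The indicator is discontinuous in \<open>z\<close> only at the single jump size
  \<open>x = y - z\<close>, a null set for a measure with a density.\<close>

lemma isCont_one_jump: assumes "0 < \<delta>" shows "isCont (one_jump y \<delta>) z"
proof (rule continuous_at_sequentiallyI)
  fix Z :: "nat \<Rightarrow> real" assume Z: "Z \<longlonglongrightarrow> z"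
  show "(\<lambda>n. one_jump y \<delta> (Z n)) \<longlonglongrightarrow> one_jump y \<delta> z"
    unfolding one_jump_def
  proof (rule integral_dominated_convergence[where w = "big_part \<delta>"])
    show "AE x in lborel. (\<lambda>n. big_part \<delta> x * indicator {y..} (Z n + x)) \<longlonglongrightarrow> big_part \<delta> x * indicator {y..} (z + x)"
      using AE_lborel_singleton[of "y - z"]
    proof eventually_elim
      case (elim x)
      have lim: "(\<lambda>n. Z n + x) \<longlonglongrightarrow> z + x" by (intro tendsto_intros Z)
      consider "z + x < y" | "y < z + x" using elim by linarith
      then have "\<forall>\<^sub>F n in sequentially. indicator {y..} (Z n + x) = (indicator {y..} (z + x) :: real)"
      proof cases
        case 1
        from order_tendstoD(2)[OF lim 1] show ?thesis by eventually_elim (use 1 in auto)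
      next
        case 2
        from order_tendstoD(1)[OF lim 2] show ?thesis by eventually_elim (use 2 in auto)
      qed
      then show ?case by (intro tendsto_mult tendsto_const tendsto_eventually)
    qed
  qed (use assms big_part_nonneg in \<open>auto simp: integrable_big_part indicator_def\<close>)
qed

lemma isCont_two_jumps: assumes "0 < \<delta>" shows "isCont (two_jumps y \<delta>) z"
proof (rule continuous_at_sequentiallyI)
  fix Z :: "nat \<Rightarrow> real" assume Z: "Z \<longlonglongrightarrow> z"
  show "(\<lambda>n. two_jumps y \<delta> (Z n)) \<longlonglongrightarrow> two_jumps y \<delta> z"
    unfolding two_jumps_def
  proof (rule integral_dominated_convergence[where w = "\<lambda>x. big_part \<delta> x * big_mass \<delta>"])
    show "AE x in lborel. (\<lambda>n. big_part \<delta> x * one_jump y \<delta> (Z n + x)) \<longlonglongrightarrow> big_part \<delta> x * one_jump y \<delta> (z + x)"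
      by (intro AE_I2 tendsto_mult tendsto_const isCont_tendsto_compose[OF isCont_one_jump[OF assms]] tendsto_add Z)
    show "AE x in lborel. norm (big_part \<delta> x * one_jump y \<delta> (Z n + x)) \<le> big_part \<delta> x * big_mass \<delta>" for n
      using abs_one_jump_le[OF assms] by (intro AE_I2) (simp add: abs_mult big_part_nonneg mult_left_mono)
  qed (use assms in \<open>auto intro!: integrable_mult_left integrable_big_part\<close>)
qed

text \<open>The compound Poisson expansion is applied to the indicator shifted by \<open>z\<close>.
  Its remainder does not depend on the shift, so it survives integration over the law
  \<open>R\<close> of the small part.\<close>

lemma tail_expansion:
  assumes \<delta>: "0 < \<delta>" and t: "0 \<le> t"
    and L: "real_distribution L" and R: "real_distribution R"
    and char: "\<And>u. char L u = char R u * exp (of_real t * big_exponent \<delta> u)"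
  shows "\<bar>measure L {y..} - exp (- (big_mass \<delta> * t)) * (measure R {y..} + t * (LINT z|R. one_jump y \<delta> z)
    + t\<^sup>2 / 2 * (LINT z|R. two_jumps y \<delta> z))\<bar> \<le> (big_mass \<delta> * t) ^ 3"
proof -
  interpret R: real_distribution R by fact
  let ?l = "big_mass \<delta>"
  obtain Q where Q: "real_distribution Q"
    "\<And>u. char Q u = exp (of_real t * big_exponent \<delta> u)"
    and Qe: "\<And>h. h \<in> borel_measurable borel \<Longrightarrow> (\<And>x. \<bar>h x\<bar> \<le> 1) \<Longrightarrow>
      \<bar>(LINT x|Q. h x) - exp (- (?l * t)) * (h 0 + t * (LINT x|lborel. big_part \<delta> x * h x)
        + t\<^sup>2 / 2 * (LINT x|lborel. LINT u|lborel. big_part \<delta> x * (big_part \<delta> u * h (x + u))))\<bar> \<le> (?l * t) ^ 3"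
    using compound_poisson_distribution[OF big_part_measurable big_part_nonneg integrable_big_part[OF \<delta>] t]
    unfolding big_mass_def[symmetric] unfolding big_part_def[symmetric] big_exponent_def by blast
  interpret Q: real_distribution Q by fact
  have "L = (R \<star> Q)"
    by (rule Levy_uniqueness[OF L R.real_distribution_convolution[OF Q(1)]])
      (auto simp: char Q R.char_convolution[OF Q(1)])
  then have "measure L {y..} = (LINT x|(R \<star> Q). indicator {y..} x)"
    by simp
  also have "\<dots> = (LINT z|R. LINT v|Q. indicator {y..} (z + v))"
    by (rule R.integral_convolution[OF Q(1), where B = 1]) (auto simp: indicator_def)
  finally have PL: "measure L {y..} = (LINT z|R. LINT v|Q. indicator {y..} (z + v))" .
  define F where "F z = indicator {y..} z + t * one_jump y \<delta> z + t\<^sup>2 / 2 * two_jumps y \<delta> z" for z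
  have [measurable]: "F \<in> borel_measurable borel" unfolding F_def by measurable
  have i1: "integrable R (one_jump y \<delta>)" "integrable R (two_jumps y \<delta>)" "integrable R (indicator {y..} :: real \<Rightarrow> real)"
    using R.integrable_const_bound[of "one_jump y \<delta>" ?l] R.integrable_const_bound[of "two_jumps y \<delta>" "?l\<^sup>2"]
    by (auto simp: abs_one_jump_le[OF \<delta>] abs_two_jumps_le[OF \<delta>] R.emeasure_eq_measure)
  then have iF: "integrable R F" unfolding F_def by auto
  have iQ: "integrable R (\<lambda>z. LINT v|Q. (indicator {y..} (z + v) :: real))"
  proof (rule R.integrable_const_bound[where B = 1])
    show "AE z in R. norm (LINT v|Q. indicator {y..} (z + v) :: real) \<le> 1"
    proof (rule AE_I2)
      fix z
      have "(LINT v|Q. indicator {y..} (z + v) :: real) = measure Q {y - z..}"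
        by (subst Bochner_Integration.integral_cong[where g = "indicator {y - z..}"]) (auto simp: indicator_def)
      then show "norm (LINT v|Q. indicator {y..} (z + v) :: real) \<le> 1" by simp
    qed
  qed simp
  have pt: "\<bar>(LINT v|Q. indicator {y..} (z + v)) - exp (- (?l * t)) * F z\<bar> \<le> (?l * t) ^ 3" for z
  proof -
    have "(LINT x|lborel. LINT u|lborel. big_part \<delta> x * (big_part \<delta> u * indicator {y..} (z + (x + u)))) = two_jumps y \<delta> z"
      unfolding two_jumps_def one_jump_def by (simp add: add.assoc)
    then show ?thesis
      using Qe[of "\<lambda>v. indicator {y..} (z + v)"] by (simp add: F_def one_jump_def)
  qed
  have "measure L {y..} - exp (- (?l * t)) * (LINT z|R. F z) = (LINT z|R. (LINT v|Q. indicator {y..} (z + v)) - exp (- (?l * t)) * F z)"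
    unfolding PL using iF iQ by simp
  also have "\<bar>\<dots>\<bar> \<le> (LINT z|R. \<bar>(LINT v|Q. indicator {y..} (z + v)) - exp (- (?l * t)) * F z\<bar>)"
    by (rule integral_abs_bound)
  also have "\<dots> \<le> (LINT z|R. (?l * t) ^ 3)"
    by (intro integral_mono) (use pt iF iQ in auto)
  also have "\<dots> = (?l * t) ^ 3" using R.prob_space by simp
  also have "(LINT z|R. F z) = measure R {y..} + t * (LINT z|R. one_jump y \<delta> z) + t\<^sup>2 / 2 * (LINT z|R. two_jumps y \<delta> z)"
    unfolding F_def using i1 by simp
  finally show ?thesis .
qed

end

section \<open>Small jumps\<close>

lemma chernoff_two_sided:
  assumes R: "real_distribution R" and u: "0 \<le> u" and "0 \<le> K"
    and K: "\<And>v. v \<in> {u, - u} \<Longrightarrow> (\<integral>\<^sup>+z. ennreal (exp (v * z)) \<partial>R) \<le> ennreal K"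
  shows "measure R {z. r \<le> \<bar>z\<bar>} \<le> 2 * exp (- (u * r)) * K"
proof -
  interpret real_distribution R by fact
  have "indicator {z. r \<le> \<bar>z\<bar>} z \<le> ennreal (exp (- (u * r))) * (ennreal (exp (u * z)) + ennreal (exp (- u * z)))" for z
  proof (cases "r \<le> \<bar>z\<bar>")
    case True
    then have "u * r \<le> u * z \<or> u * r \<le> - u * z"
      using mult_left_mono[OF True u] by (auto simp: abs_if split: if_splits)
    then have "1 \<le> exp (u * z - u * r) + exp (- u * z - u * r)"
      using exp_gt_zero[of "u * z - u * r"] exp_gt_zero[of "- u * z - u * r"]
        one_le_exp_iff[of "u * z - u * r"] one_le_exp_iff[of "- u * z - u * r"] by linarith
    also have "\<dots> = exp (- (u * r)) * (exp (u * z) + exp (- u * z))"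
      by (simp add: distrib_left exp_add[symmetric])
    finally have "1 \<le> exp (- (u * r)) * (exp (u * z) + exp (- u * z))" .
    then show ?thesis
      using True by (simp flip: ennreal_plus ennreal_mult)
  qed simp
  note le = this
  have "emeasure R {z. r \<le> \<bar>z\<bar>} = (\<integral>\<^sup>+z. indicator {z. r \<le> \<bar>z\<bar>} z \<partial>R)"
    by simp
  also have "\<dots> \<le> (\<integral>\<^sup>+z. ennreal (exp (- (u * r))) * (ennreal (exp (u * z)) + ennreal (exp (- u * z))) \<partial>R)"
    by (intro nn_integral_mono le)
  also have "\<dots> = ennreal (exp (- (u * r))) * ((\<integral>\<^sup>+z. ennreal (exp (u * z)) \<partial>R) + (\<integral>\<^sup>+z. ennreal (exp (- u * z)) \<partial>R))"
    by (subst nn_integral_cmult) (auto simp: nn_integral_add)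
  also have "\<dots> \<le> ennreal (exp (- (u * r))) * (ennreal (K) + ennreal (K))"
    using K[of u] K[of "- u"] by (intro mult_left_mono add_mono) auto
  also have "\<dots> = ennreal (2 * exp (- (u * r)) * K)"
    using \<open>0 \<le> K\<close> by (simp flip: ennreal_plus ennreal_mult)
  finally show ?thesis
    using \<open>0 \<le> K\<close> by (simp add: emeasure_eq_measure ennreal_le_iff)
qed

text \<open>
  With the exponent \<open>u = \<kappa> ln (1 / t)\<close> the Chernoff factor is \<open>exp (- u r) = t powr (\<kappa> r)\<close>, while the
  contribution of the jumps to the moment bound stays negligible, since
  \<open>t u\<^sup>2 exp (u \<delta>) = u\<^sup>2 t powr (1 - \<kappa> \<delta>)\<close> tends to \<open>0\<close>.
\<close>

lemma small_time_chernoff: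
  fixes R :: "real \<Rightarrow> real measure"
  assumes R: "\<And>t. 0 < t \<Longrightarrow> real_distribution (R t)"
    and mgf: "\<And>t u. 0 < t \<Longrightarrow> (\<integral>\<^sup>+z. ennreal (exp (u * z)) \<partial>R t)
      \<le> ennreal (exp (t * (u * B + v * u\<^sup>2 / 2 + u\<^sup>2 * exp (\<bar>u\<bar> * \<delta>) * V)))"
    and \<kappa>: "0 < \<kappa>" "\<kappa> * \<delta> < 1" and a: "a < \<kappa> * r"
  shows "((\<lambda>t. measure (R t) {z. r \<le> \<bar>z\<bar>} / t powr a) \<longlongrightarrow> 0) (at_right 0)"
proof -
  define c where "c = 1 - \<kappa> * \<delta>"
  have c: "0 < c" using \<kappa> by (simp add: c_def)
  define u where "u t = - \<kappa> * ln t" for t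
  define K where "K t = exp (t * u t * \<bar>B\<bar> + t * (v * (u t)\<^sup>2 / 2) + (u t)\<^sup>2 * t powr c * V)" for t
  have bound: "measure (R t) {z. r \<le> \<bar>z\<bar>} / t powr a \<le> 2 * t powr (\<kappa> * r - a) * K t" if t: "0 < t" "t < 1" for t
  proof -
    have u: "0 \<le> u t" using t \<kappa> by (simp add: u_def mult_le_0_iff)
    have e: "t * exp (u t * \<delta>) = t powr c"
      using t by (simp add: u_def c_def powr_def algebra_simps exp_diff exp_minus field_simps)
    have "(\<integral>\<^sup>+z. ennreal (exp (w * z)) \<partial>R t) \<le> ennreal (K t)" if "w \<in> {u t, - u t}" for w
    proof (rule order_trans[OF mgf[OF t(1)]], rule ennreal_leI)
      have "w * B \<le> u t * \<bar>B\<bar>"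
        using that u mult_left_mono[of B "\<bar>B\<bar>" "u t"] mult_left_mono[of "-B" "\<bar>B\<bar>" "u t"] by auto
      then have "t * (w * B) \<le> t * (u t * \<bar>B\<bar>)" using t by (intro mult_left_mono) auto
      have w: "w\<^sup>2 = (u t)\<^sup>2" "\<bar>w\<bar> = u t" using that u by auto
      have "t * (w * B + v * w\<^sup>2 / 2 + w\<^sup>2 * exp (\<bar>w\<bar> * \<delta>) * V)
          = t * (w * B) + t * (v * (u t)\<^sup>2 / 2) + (u t)\<^sup>2 * (t * exp (u t * \<delta>)) * V"
        unfolding w by (simp add: distrib_left)
      also have "\<dots> \<le> t * u t * \<bar>B\<bar> + t * (v * (u t)\<^sup>2 / 2) + (u t)\<^sup>2 * t powr c * V"
        unfolding e using \<open>t * (w * B) \<le> t * (u t * \<bar>B\<bar>)\<close> by (simp add: mult.assoc)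
      finally show "exp (t * (w * B + v * w\<^sup>2 / 2 + w\<^sup>2 * exp (\<bar>w\<bar> * \<delta>) * V)) \<le> K t"
        unfolding K_def exp_le_cancel_iff .
    qed
    from chernoff_two_sided[OF R[OF t(1)] u _ this, where r = r]
    have "measure (R t) {z. r \<le> \<bar>z\<bar>} \<le> 2 * exp (- (u t * r)) * K t"
      by (simp add: K_def)
    also have "exp (- (u t * r)) = t powr (\<kappa> * r)"
      using t by (simp add: u_def powr_def mult_ac)
    finally have "measure (R t) {z. r \<le> \<bar>z\<bar>} / t powr a \<le> 2 * t powr (\<kappa> * r) * K t / t powr a"
      by (intro divide_right_mono) auto
    then show ?thesis using t by (simp add: powr_diff)
  qed
  have l1: "((\<lambda>t::real. t powr (\<kappa> * r - a)) \<longlongrightarrow> 0) (at_right 0)"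
    using a by real_asymp
  have l2: "((\<lambda>t. t * u t) \<longlongrightarrow> 0) (at_right 0)" "((\<lambda>t. t * (u t)\<^sup>2) \<longlongrightarrow> 0) (at_right 0)"
    unfolding u_def using \<kappa>(1) by real_asymp+
  then have l2': "((\<lambda>t. t * (v * (u t)\<^sup>2 / 2)) \<longlongrightarrow> 0) (at_right 0)"
    using tendsto_mult_left[OF l2(2), of "v / 2"] by (simp add: mult_ac)
  have l3: "((\<lambda>t. (u t)\<^sup>2 * t powr c) \<longlongrightarrow> 0) (at_right 0)"
    unfolding u_def using c \<kappa>(1) by real_asymp
  have "(K \<longlongrightarrow> exp (0 * \<bar>B\<bar> + 0 + 0 * V)) (at_right 0)"
    unfolding K_def by (intro tendsto_intros l2(1) l2' l3)
  then have "((\<lambda>t. 2 * t powr (\<kappa> * r - a) * K t) \<longlongrightarrow> 2 * 0 * exp (0 * \<bar>B\<bar> + 0 + 0 * V)) (at_right 0)"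
    by (intro tendsto_intros l1)
  then have lim: "((\<lambda>t. 2 * t powr (\<kappa> * r - a) * K t) \<longlongrightarrow> 0) (at_right 0)" by simp
  show ?thesis
  proof (rule tendsto_sandwich[OF _ _ tendsto_const lim])
    show "\<forall>\<^sub>F t in at_right 0. 0 \<le> measure (R t) {z. r \<le> \<bar>z\<bar>} / t powr a"
      by (auto intro!: always_eventually)
    show "\<forall>\<^sub>F t in at_right 0. measure (R t) {z. r \<le> \<bar>z\<bar>} / t powr a \<le> 2 * t powr (\<kappa> * r - a) * K t"
      using bound by (auto simp: eventually_at_right_field intro!: exI[of _ 1])
  qed
qed

section \<open>Second-order behaviour near the threshold\<close>

text \<open>The mean value theorem gives q z = z q'(\<xi>), and q' vanishes at 0 and is
  differentiable there, so q'(\<xi>) is at most a multiple of \<xi>. Only the single point 0 needs a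
  second derivative, as for a density that is C^1 near \<open>y\<close>.\<close>

lemma quadratic_remainder:
  fixes q q' :: "real \<Rightarrow> real"
  assumes q: "\<And>u. \<bar>u\<bar> < \<rho> \<Longrightarrow> (q has_real_derivative q' u) (at u)" and "q 0 = 0" "0 < \<rho>"
    and q': "(q' has_real_derivative m) (at 0)" "q' 0 = 0" and "\<bar>m\<bar> < K"
  obtains r where "0 < r" "\<And>z. \<bar>z\<bar> \<le> r \<Longrightarrow> \<bar>q z\<bar> \<le> K * z\<^sup>2"
proof -
  have "((\<lambda>h. \<bar>q' h / h\<bar>) \<longlongrightarrow> \<bar>m\<bar>) (at 0)"
    using q' by (intro tendsto_rabs) (simp add: DERIV_def)
  from order_tendstoD(2)[OF this \<open>\<bar>m\<bar> < K\<close>]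
  obtain e where e: "0 < e" "\<And>h. h \<noteq> 0 \<Longrightarrow> \<bar>h\<bar> < e \<Longrightarrow> \<bar>q' h / h\<bar> < K"
    by (auto simp: eventually_at dist_real_def)
  define r where "r = min e \<rho> / 2"
  have r: "0 < r" "r < e" "r < \<rho>" using e \<open>0 < \<rho>\<close> by (auto simp: r_def min_def)
  have q'b: "\<bar>q' h\<bar> \<le> K * \<bar>h\<bar>" if "\<bar>h\<bar> \<le> r" for h
  proof (cases "h = 0")
    case False
    then have "\<bar>q' h\<bar> / \<bar>h\<bar> < K" using e(2)[OF False] that r by (simp add: abs_divide)
    then show ?thesis using False by (simp add: field_simps)
  qed (simp add: q')
  have "\<bar>q z\<bar> \<le> K * z\<^sup>2" if z: "\<bar>z\<bar> \<le> r" for z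
  proof -
    have "\<exists>\<xi>. \<bar>\<xi>\<bar> \<le> \<bar>z\<bar> \<and> \<bar>q z\<bar> = \<bar>z\<bar> * \<bar>q' \<xi>\<bar>"
    proof (cases z "0::real" rule: linorder_cases)
      case less
      have "\<exists>\<xi>>z. \<xi> < 0 \<and> q 0 - q z = (0 - z) * q' \<xi>"
        by (rule MVT2[OF less]) (use z r in \<open>auto intro: q\<close>)
      then obtain \<xi> where "z < \<xi>" "\<xi> < 0" "q z = z * q' \<xi>" using \<open>q 0 = 0\<close> by auto
      then show ?thesis by (intro exI[of _ \<xi>]) (auto simp: abs_mult)
    next
      case greater
      have "\<exists>\<xi>>0. \<xi> < z \<and> q z - q 0 = (z - 0) * q' \<xi>"
        by (rule MVT2[OF greater]) (use z r in \<open>auto intro: q\<close>)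
      then obtain \<xi> where "0 < \<xi>" "\<xi> < z" "q z = z * q' \<xi>" using \<open>q 0 = 0\<close> by auto
      then show ?thesis by (intro exI[of _ \<xi>]) (auto simp: abs_mult)
    qed (use \<open>q 0 = 0\<close> in auto)
    then obtain \<xi> where \<xi>: "\<bar>\<xi>\<bar> \<le> \<bar>z\<bar>" "\<bar>q z\<bar> = \<bar>z\<bar> * \<bar>q' \<xi>\<bar>" by blast
    have "\<bar>q' \<xi>\<bar> \<le> K * \<bar>z\<bar>"
      using q'b[of \<xi>] \<xi>(1) z \<open>\<bar>m\<bar> < K\<close> mult_left_mono[OF \<xi>(1), of K] by linarith
    then have "\<bar>z\<bar> * \<bar>q' \<xi>\<bar> \<le> \<bar>z\<bar> * (K * \<bar>z\<bar>)" by (intro mult_left_mono) auto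
    also have "\<dots> = K * z\<^sup>2" by (simp add: power2_eq_square mult.left_commute)
    finally show ?thesis using \<xi>(2) by simp
  qed
  then show ?thesis using r(1) that by blast
qed

lemma exp_of_real_mult_quotient_tendsto:
  "((\<lambda>t. (exp (of_real t * \<zeta>) - 1) / of_real t) \<longlongrightarrow> \<zeta>) (at_right 0)" for \<zeta> :: complex
proof -
  have "((\<lambda>w. exp (w * \<zeta>)) has_field_derivative \<zeta>) (at 0)"
    by (auto intro!: derivative_eq_intros)
  then have 1: "((\<lambda>h. (exp (h * \<zeta>) - 1) / h) \<longlongrightarrow> \<zeta>) (at 0)"
    by (simp add: DERIV_def)
  have "filterlim (complex_of_real) (at 0) (at_right 0)"
  proof (rule filterlim_atI)
    show "(complex_of_real \<longlongrightarrow> 0) (at_right 0)"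
      using tendsto_of_real[OF tendsto_ident_at, of 0 "{0<..}"] by simp
    show "\<forall>\<^sub>F x in at_right 0. complex_of_real x \<noteq> 0"
      by (auto simp: eventually_at_right_field intro!: exI[of _ 1])
  qed
  from filterlim_compose[OF 1 this] show ?thesis .
qed

section \<open>Taylor expansion of the tail at the threshold\<close>

context levy_density
begin

definition tail :: "real \<Rightarrow> real" where
  "tail v = (LINT x|lborel. s x * indicator {v..} x)"

lemma integrable_tail: "0 < v \<Longrightarrow> integrable lborel (\<lambda>x. s x * indicator {v..} x)"
  using integrable_levy_tail[of "indicator {v..} :: real \<Rightarrow> real" 1 "v / 2"]
  by (auto simp: indicator_def)

lemma measure_tail: "0 < v \<Longrightarrow> measure \<nu> {v..} = tail v"
proof -
  assume "0 < v"
  have "emeasure \<nu> {v..} = (\<integral>\<^sup>+x. ennreal (s x * indicator {v..} x) \<partial>lborel)"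
    by (simp add: emeasure_density ennreal_mult'' ennreal_indicator)
  also have "\<dots> = ennreal (tail v)"
    unfolding tail_def using s_nonneg
    by (intro nn_integral_eq_integral integrable_tail \<open>0 < v\<close>) auto
  finally show ?thesis
    by (simp add: measure_def tail_def s_nonneg integral_nonneg_AE)
qed

lemma one_jump_eq_tail: "0 < \<delta> \<Longrightarrow> \<delta> < y - z \<Longrightarrow> one_jump y \<delta> z = tail (y - z)"
  unfolding one_jump_def tail_def big_part_def
  by (intro Bochner_Integration.integral_cong refl) (auto simp: indicator_def)

text \<open>On the interval around \<open>y\<close> the tail is its value at
  \<open>y - \<rho>\<close> minus the integral of a continuous function, so the fundamental theorem
  of calculus applies.\<close>

lemma tail_has_derivative:
  assumes \<rho>: "0 < \<rho>" "\<rho> < y" and cont: "continuous_on {y - \<rho>..y + \<rho>} s" and v: "\<bar>v - y\<bar> < \<rho>"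
  shows "(tail has_real_derivative - s v) (at v)"
proof -
  let ?I = "{y - \<rho>..y + \<rho>}"
  have eq: "tail w = tail (y - \<rho>) - integral {y - \<rho>..w} s" if w: "w \<in> ?I" for w
  proof -
    have c: "continuous_on {y - \<rho>..w} s" using continuous_on_subset[OF cont] w by auto
    then have si: "set_integrable lborel {y - \<rho>..w} s"
      by (intro borel_integrable_atLeastAtMost') 
    have "tail (y - \<rho>) = (LINT x|lborel. s x * indicator {w..} x + indicator {y - \<rho>..w} x *\<^sub>R s x)"
      unfolding tail_def
    proof (rule integral_cong_AE)
      show "AE x in lborel. s x * indicator {y - \<rho>..} x = s x * indicator {w..} x + indicator {y - \<rho>..w} x *\<^sub>R s x"
        using AE_lborel_singleton[of w] by eventually_elim (use w in \<open>auto simp: indicator_def\<close>)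
    qed auto
    also have "\<dots> = tail w + (LINT x:{y - \<rho>..w}|lborel. s x)"
      unfolding set_lebesgue_integral_def tail_def
      using integrable_tail[of w] si \<rho> w by (intro Bochner_Integration.integral_add) (auto simp: set_integrable_def)
    also have "(LINT x:{y - \<rho>..w}|lborel. s x) = integral {y - \<rho>..w} s"
      by (rule set_borel_integral_eq_integral(2)[OF si])
    finally show ?thesis by simp
  qed
  have "((\<lambda>w. integral {y - \<rho>..w} s) has_real_derivative s v) (at v within ?I)"
    using v by (intro integral_has_real_derivative[OF cont]) auto
  moreover have "at v within ?I = at v"
    using v by (intro at_within_interior) auto
  ultimately have "((\<lambda>w. tail (y - \<rho>) - integral {y - \<rho>..w} s) has_real_derivative - s v) (at v)"
    by (auto intro!: derivative_eq_intros)
  then show ?thesis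
  proof (rule has_field_derivative_transform_within_open[where S = "{y - \<rho><..<y + \<rho>}"])
    show "tail (y - \<rho>) - integral {y - \<rho>..w} s = tail w" if "w \<in> {y - \<rho><..<y + \<rho>}" for w
      by (rule eq[symmetric]) (use that in auto)
  qed (use v in \<open>auto simp: abs_less_iff\<close>)
qed

text \<open>\<open>sin z\<close> and \<open>1 - cos z\<close> have the same second-order Taylor
  polynomials as z and z^2 / 2. The remainder thus vanishes at 0 with two derivatives and is o(z^2),
  which near 0 is comparable with \<open>1 - cos z\<close>.\<close>

lemma tail_second_order:
  assumes \<rho>: "0 < \<rho>" "\<rho> < y" and cont: "continuous_on {y - \<rho>..y + \<rho>} s"
    and s': "(s has_real_derivative s') (at y)" and \<eta>: "0 < \<eta>"
  obtains r where "0 < r" "\<And>z. \<bar>z\<bar> \<le> r \<Longrightarrow> \<bar>tail (y - z) - tail y - s y * sin z + s' * (1 - cos z)\<bar> \<le> \<eta> * (1 - cos z)"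
proof -
  let ?q = "\<lambda>z. tail (y - z) - tail y - s y * sin z + s' * (1 - cos z)"
  have "((\<lambda>z. (1 - cos z) / z\<^sup>2) \<longlongrightarrow> 1 / 2) (at (0::real))" by real_asymp
  \<comment> \<open>Any number below the limit 1/2 works; 1/4 gives z^2 \<le> 4 (1 - cos z), matched
    by the constant \<open>\<eta> / 4\<close> in the quadratic bound.\<close>
  from order_tendstoD(1)[OF this, of "1/4"]
  obtain e where e: "0 < e" "\<And>z::real. z \<noteq> 0 \<Longrightarrow> \<bar>z\<bar> < e \<Longrightarrow> 1 / 4 < (1 - cos z) / z\<^sup>2"
    by (auto simp: eventually_at dist_real_def)
  have d: "((\<lambda>z. tail (y - z)) has_real_derivative s (y - u)) (at u)" if "\<bar>u\<bar> < \<rho>" for u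
  proof -
    have "(tail has_real_derivative - s (y - u)) (at (y - u))"
      by (rule tail_has_derivative[OF \<rho> cont]) (use that in auto)
    moreover have "((\<lambda>z. y - z) has_real_derivative - 1) (at u)"
      by (auto intro!: derivative_eq_intros)
    ultimately show ?thesis using DERIV_chain2[of tail] by fastforce
  qed
  have d2: "((\<lambda>u. s (y - u)) has_real_derivative - s') (at 0)"
  proof -
    have "(s has_real_derivative s') (at (y - 0))" using s' by simp
    moreover have "((\<lambda>z. y - z) has_real_derivative - 1) (at 0)"
      by (auto intro!: derivative_eq_intros)
    ultimately show ?thesis using DERIV_chain2[of s] by fastforce
  qed
  obtain r where r: "0 < r" "\<And>z. \<bar>z\<bar> \<le> r \<Longrightarrow> \<bar>?q z\<bar> \<le> \<eta> / 4 * z\<^sup>2"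
  proof (rule quadratic_remainder[where q = ?q and \<rho> = \<rho> and q' = "\<lambda>u. s (y - u) - s y * cos u + s' * sin u" and m = 0 and K = "\<eta> / 4"])
    show "(?q has_real_derivative s (y - u) - s y * cos u + s' * sin u) (at u)" if "\<bar>u\<bar> < \<rho>" for u
      by (rule derivative_eq_intros d[OF that] refl | simp)+
    show "((\<lambda>u. s (y - u) - s y * cos u + s' * sin u) has_real_derivative 0) (at 0)"
      by (rule derivative_eq_intros d2 refl | simp)+
  qed (use \<rho> \<eta> in auto)
  show ?thesis
  proof
    show "0 < min r (e / 2)" using r e by simp
    fix z assume z: "\<bar>z\<bar> \<le> min r (e / 2)"
    show "\<bar>?q z\<bar> \<le> \<eta> * (1 - cos z)"
    proof (cases "z = 0")
      case False
      then have "1 / 4 * z\<^sup>2 \<le> 1 - cos z" using e(2)[OF False] z e(1) by (simp add: field_simps)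
      then have "\<eta> * (1 / 4 * z\<^sup>2) \<le> \<eta> * (1 - cos z)" using \<eta> by (intro mult_left_mono) auto
      then show ?thesis using r(2)[of z] z by simp
    qed simp
  qed
qed

text \<open>The remainder has second derivative \<open>- s'\<close> at 0, so any constant above
  \<open>\<bar>s'\<bar>\<close> serves. The bound makes the small-jump term of the coefficient
  integrable at 0.\<close>

lemma tail_first_order:
  assumes \<rho>: "0 < \<rho>" "\<rho> < y" and cont: "continuous_on {y - \<rho>..y + \<rho>} s"
    and s': "(s has_real_derivative s') (at y)"
  obtains r where "0 < r" "\<And>z. \<bar>z\<bar> \<le> r \<Longrightarrow> \<bar>tail (y - z) - tail y - z * s y\<bar> \<le> (\<bar>s'\<bar> + 1) * z\<^sup>2"
proof (rule quadratic_remainder[where q = "\<lambda>z. tail (y - z) - tail y - z * s y" and \<rho> = \<rho> and q' = "\<lambda>u. s (y - u) - s y"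
    and m = "- s'" and K = "\<bar>s'\<bar> + 1"])
  show "((\<lambda>z. tail (y - z) - tail y - z * s y) has_real_derivative s (y - u) - s y) (at u)" if "\<bar>u\<bar> < \<rho>" for u
  proof -
    have "(tail has_real_derivative - s (y - u)) (at (y - u))"
      by (rule tail_has_derivative[OF \<rho> cont]) (use that in auto)
    moreover have "((\<lambda>z. y - z) has_real_derivative - 1) (at u)"
      by (auto intro!: derivative_eq_intros)
    ultimately have "((\<lambda>z. tail (y - z)) has_real_derivative s (y - u)) (at u)"
      using DERIV_chain2[of tail] by fastforce
    then show ?thesis by (auto intro!: derivative_eq_intros)
  qed
  show "((\<lambda>u. s (y - u) - s y) has_real_derivative - s') (at 0)"
  proof -
    have "(s has_real_derivative s') (at (y - 0))" using s' by simp
    moreover have "((\<lambda>z. y - z) has_real_derivative - 1) (at 0)"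
      by (auto intro!: derivative_eq_intros)
    ultimately have "((\<lambda>u. s (y - u)) has_real_derivative - s') (at 0)"
      using DERIV_chain2[of s] by fastforce
    then show ?thesis by (auto intro!: derivative_eq_intros)
  qed
qed (use \<rho> that in auto)

text \<open>With the cut fixed, \<open>big_mass \<delta>\<close> is a constant and three or more
  jumps contribute O(t^3). The only error not vanishing with t comes from \<open>loc\<close>: it is
  at most \<eta> E (1 - cos Z) / t, whose limit is \<open>\<eta> * (- Re \<zeta>)\<close>.\<close>

lemma tail_asymptotics_fixed_cutoff:
  fixes L R :: "real \<Rightarrow> real measure"
  assumes \<delta>: "0 < \<delta>" "4 * \<delta> \<le> r" and r: "r + \<delta> < y" and \<eta>: "0 \<le> \<eta>"
    and loc: "\<And>z. \<bar>z\<bar> \<le> r \<Longrightarrow> \<bar>tail (y - z) - tail y - s y * sin z + s' * (1 - cos z)\<bar> \<le> \<eta> * (1 - cos z)"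
    and L: "\<And>t. 0 < t \<Longrightarrow> real_distribution (L t)" and R: "\<And>t. 0 < t \<Longrightarrow> real_distribution (R t)"
    and char: "\<And>t u. 0 < t \<Longrightarrow> char (L t) u = char (R t) u * exp (of_real t * big_exponent \<delta> u)"
    and charR: "\<And>t. 0 < t \<Longrightarrow> char (R t) 1 = exp (of_real t * \<zeta>)"
    and mgf: "\<And>t u. 0 < t \<Longrightarrow> (\<integral>\<^sup>+z. ennreal (exp (u * z)) \<partial>R t)
      \<le> ennreal (exp (t * (u * B + v * u\<^sup>2 / 2 + u\<^sup>2 * exp (\<bar>u\<bar> * \<delta>) * V)))"
    and "0 < e"
  shows "\<forall>\<^sub>F t in at_right 0. \<bar>1 / t * (1 / t * measure (L t) {y..} - tail y)
    - (s y * Im \<zeta> + s' * Re \<zeta> + two_jumps y \<delta> 0 / 2 - big_mass \<delta> * tail y)\<bar> < \<eta> * (- Re \<zeta>) + e"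
proof -
  let ?l = "big_mass \<delta>"
  define p where "p t = measure (R t) {z. r \<le> \<bar>z\<bar>}" for t
  define PZ where "PZ t = measure (R t) {y..}" for t
  define E1 where "E1 t = (LINT z|R t. one_jump y \<delta> z)" for t
  define E2 where "E2 t = (LINT z|R t. two_jumps y \<delta> z)" for t
  define S where "S t = Im (exp (of_real t * \<zeta>))" for t
  define C where "C t = 1 - Re (exp (of_real t * \<zeta>))" for t
  \<comment> \<open>Bounds the Taylor remainder where no expansion is available:
    \<open>one_jump\<close> is at most the total mass, the sine at most 1 and
    \<open>1 - cos z\<close> at most 2.\<close>
  define K where "K = ?l + \<bar>tail y\<bar> + \<bar>s y\<bar> + 2 * \<bar>s'\<bar>"
  have r0: "0 < r" using \<delta> by simp
  have p_lim: "((\<lambda>t. p t / t\<^sup>2) \<longlongrightarrow> 0) (at_right 0)"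
  proof -
    \<comment> \<open>With \<kappa> = 3 / r the exponent \<kappa> r = 3 exceeds 2, while 4 \<delta>
      \<le> r gives \<kappa> \<delta> \<le> 3 / 4 < 1.\<close>
    have "((\<lambda>t. p t / t powr 2) \<longlongrightarrow> 0) (at_right 0)"
      unfolding p_def
      by (rule small_time_chernoff[OF R mgf, where \<kappa> = "3 / r"]) (use \<delta> r0 in \<open>auto simp: field_simps\<close>)
    then show ?thesis
      by (rule Lim_transform_eventually) (auto simp: eventually_at_right_field powr_numeral intro!: exI[of _ 1])
  qed
  have p_lim1: "((\<lambda>t. p t / t) \<longlongrightarrow> 0) (at_right 0)"
  proof -
    have "((\<lambda>t. t * (p t / t\<^sup>2)) \<longlongrightarrow> 0 * 0) (at_right 0)"
      by (intro tendsto_mult p_lim tendsto_ident_at)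
    then have "((\<lambda>t. t * (p t / t\<^sup>2)) \<longlongrightarrow> 0) (at_right 0)" by simp
    then show ?thesis
      by (rule Lim_transform_eventually) (auto simp: eventually_at_right_field power2_eq_square intro!: exI[of _ 1])
  qed
  have PZ_lim: "((\<lambda>t. PZ t / t\<^sup>2) \<longlongrightarrow> 0) (at_right 0)"
  proof (rule tendsto_sandwich[OF _ _ tendsto_const p_lim])
    show "\<forall>\<^sub>F t in at_right 0. PZ t / t\<^sup>2 \<le> p t / t\<^sup>2"
      unfolding eventually_at_right_field
    proof (intro exI[of _ 1] conjI allI impI)
      fix t :: real assume "0 < t"
      interpret real_distribution "R t" by (rule R) fact
      have "PZ t \<le> p t"
        unfolding PZ_def p_def using r \<delta> by (intro finite_measure_mono) auto
      then show "PZ t / t\<^sup>2 \<le> p t / t\<^sup>2" by (rule divide_right_mono) simp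
    qed simp
  qed (auto simp: PZ_def intro!: always_eventually)
  have E2_lim: "(E2 \<longlongrightarrow> two_jumps y \<delta> 0) (at_right 0)"
  proof (rule tendstoI)
    fix h :: real assume h: "0 < h"
    have "isCont (two_jumps y \<delta>) 0" by (rule isCont_two_jumps[OF \<delta>(1)])
    then obtain r' where r': "0 < r'" "\<And>z. \<bar>z\<bar> < r' \<Longrightarrow> \<bar>two_jumps y \<delta> z - two_jumps y \<delta> 0\<bar> < h / 2"
      using h unfolding continuous_at_eps_delta dist_real_def by (metis diff_zero half_gt_zero)
    \<comment> \<open>Here mere concentration at 0 is wanted, with \<open>r'\<close> possibly far
      below \<delta>; the power a = 0 only requires \<kappa> r' > 0, so \<kappa> \<delta> = 1 / 2 is
      a safe choice.\<close>
    have "((\<lambda>t. measure (R t) {z. r' \<le> \<bar>z\<bar>} / t powr 0) \<longlongrightarrow> 0) (at_right 0)"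
      by (rule small_time_chernoff[OF R mgf, where \<kappa> = "1 / (2 * \<delta>)"]) (use \<delta> r' in auto)
    then have "((\<lambda>t. measure (R t) {z. r' \<le> \<bar>z\<bar>}) \<longlongrightarrow> 0) (at_right 0)"
      by (rule Lim_transform_eventually) (auto simp: eventually_at_right_field intro!: exI[of _ 1])
    then have "((\<lambda>t. h / 2 + 2 * ?l\<^sup>2 * measure (R t) {z. r' \<le> \<bar>z\<bar>}) \<longlongrightarrow> h / 2 + 2 * ?l\<^sup>2 * 0) (at_right 0)"
      by (intro tendsto_intros)
    from order_tendstoD(2)[OF this, of h] h
    have "\<forall>\<^sub>F t in at_right 0. h / 2 + 2 * ?l\<^sup>2 * measure (R t) {z. r' \<le> \<bar>z\<bar>} < h" by simp
    moreover have "\<forall>\<^sub>F t in at_right 0. 0 < (t::real)"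
      by (simp add: eventually_at_right_less)
    ultimately show "\<forall>\<^sub>F t in at_right 0. dist (E2 t) (two_jumps y \<delta> 0) < h"
    proof eventually_elim
      case (elim t)
      interpret real_distribution "R t" by (rule R) fact
      have i: "integrable (R t) (two_jumps y \<delta>)"
        using integrable_const_bound[of "two_jumps y \<delta>" "?l\<^sup>2"] by (auto simp: abs_two_jumps_le[OF \<delta>(1)])
      have ii: "integrable (R t) (indicator {z. r' \<le> \<bar>z\<bar>} :: real \<Rightarrow> real)"
        by (intro integrable_real_indicator) (auto simp: emeasure_eq_measure)
      have "\<bar>E2 t - two_jumps y \<delta> 0\<bar> = \<bar>LINT z|R t. two_jumps y \<delta> z - two_jumps y \<delta> 0\<bar>"
        unfolding E2_def using i prob_space by simp
      also have "\<dots> \<le> (LINT z|R t. \<bar>two_jumps y \<delta> z - two_jumps y \<delta> 0\<bar>)"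
        by (rule integral_abs_bound)
      also have "\<dots> \<le> (LINT z|R t. h / 2 + 2 * ?l\<^sup>2 * indicator {z. r' \<le> \<bar>z\<bar>} z)"
      proof (rule integral_mono)
        show "\<bar>two_jumps y \<delta> z - two_jumps y \<delta> 0\<bar> \<le> h / 2 + 2 * ?l\<^sup>2 * indicator {z. r' \<le> \<bar>z\<bar>} z" for z
          using r'(2)[of z] abs_two_jumps_le[OF \<delta>(1), of y z] abs_two_jumps_le[OF \<delta>(1), of y 0] h
          by (cases "\<bar>z\<bar> < r'") auto
      qed (use i ii in auto)
      also have "\<dots> = h / 2 + 2 * ?l\<^sup>2 * measure (R t) {z. r' \<le> \<bar>z\<bar>}"
        using ii prob_space by simp
      finally show ?case using elim by (simp add: dist_real_def)
    qed
  qed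
  \<comment> \<open>\<open>S t\<close> and \<open>C t\<close> are the expectations of
    \<open>sin\<close> and \<open>1 - cos\<close>, read off the characteristic function at 1. The
    expansion is integrated where \<bar>z\<bar> < r; the complement costs at most
    \<open>K * p t\<close>, and p t / t tends to 0.\<close>
  have E1_bound: "\<bar>E1 t - tail y - s y * S t + s' * C t\<bar> \<le> \<eta> * C t + K * p t" if t: "0 < t" for t
  proof -
    interpret real_distribution "R t" by (rule R) fact
    have i: "integrable (R t) (one_jump y \<delta>)"
      using integrable_const_bound[of "one_jump y \<delta>" ?l] by (auto simp: abs_one_jump_le[OF \<delta>(1)])
    have isin: "integrable (R t) sin" and icos: "integrable (R t) cos"
      using integrable_const_bound[of "sin" 1] integrable_const_bound[of "cos" 1] by auto
    have ii: "integrable (R t) (indicator {z. r \<le> \<bar>z\<bar>} :: real \<Rightarrow> real)"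
      by (intro integrable_real_indicator) (auto simp: emeasure_eq_measure)
    have S: "(LINT z|R t. sin z) = S t" and C: "(LINT z|R t. 1 - cos z) = C t"
      using Re_char[of 1] Im_char[of 1] icos prob_space by (simp_all add: charR[OF t] S_def C_def)
    let ?q = "\<lambda>z. one_jump y \<delta> z - tail y - s y * sin z + s' * (1 - cos z)"
    have iq: "integrable (R t) ?q" using i isin icos by auto
    have E1_eq: "E1 t - tail y - s y * S t + s' * C t = (LINT z|R t. ?q z)"
      unfolding E1_def S[symmetric] C[symmetric] using i isin icos prob_space by simp
    have "\<bar>E1 t - tail y - s y * S t + s' * C t\<bar> = \<bar>LINT z|R t. ?q z\<bar>"
      unfolding E1_eq ..
    also have "\<dots> \<le> (LINT z|R t. \<bar>?q z\<bar>)" by (rule integral_abs_bound)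
    also have "\<dots> \<le> (LINT z|R t. \<eta> * (1 - cos z) + K * indicator {z. r \<le> \<bar>z\<bar>} z)"
    proof (rule integral_mono)
      show "\<bar>?q z\<bar> \<le> \<eta> * (1 - cos z) + K * indicator {z. r \<le> \<bar>z\<bar>} z" for z
      proof (cases "r \<le> \<bar>z\<bar>")
        case True
        have tri: "\<bar>a - b - c + d\<bar> \<le> \<bar>a\<bar> + \<bar>b\<bar> + \<bar>c\<bar> + \<bar>d\<bar>" for a b c d :: real
          by linarith
        have "\<bar>1 - cos z\<bar> \<le> 2"
          using cos_ge_minus_one[of z] cos_le_one[of z] unfolding abs_le_iff by linarith
        from mult_left_mono[OF this, of "\<bar>s'\<bar>"] have s'_le: "\<bar>s' * (1 - cos z)\<bar> \<le> 2 * \<bar>s'\<bar>"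
          by (simp add: abs_mult)
        have "\<bar>s y * sin z\<bar> \<le> \<bar>s y\<bar>" by (simp add: abs_mult mult_left_le)
        then have "\<bar>?q z\<bar> \<le> K"
          unfolding K_def
          by (intro order_trans[OF tri] add_mono abs_one_jump_le[OF \<delta>(1)] s'_le order_refl)
        moreover have "0 \<le> \<eta> * (1 - cos z)" using \<eta> by simp
        ultimately show ?thesis using True by simp
      next
        case False
        then have "one_jump y \<delta> z = tail (y - z)"
          using r \<delta> by (intro one_jump_eq_tail) auto
        then show ?thesis using False loc[of z] by simp
      qed
    qed (use iq icos ii in auto)
    also have "\<dots> = \<eta> * (LINT z|R t. 1 - cos z) + K * p t"
      unfolding p_def using icos ii by simp
    finally show ?thesis unfolding C .
  qed
  have S_lim: "((\<lambda>t. S t / t) \<longlongrightarrow> Im \<zeta>) (at_right 0)"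
    using tendsto_Im[OF exp_of_real_mult_quotient_tendsto[of \<zeta>]] by (simp add: S_def)
  have C_lim: "((\<lambda>t. C t / t) \<longlongrightarrow> - Re \<zeta>) (at_right 0)"
    using tendsto_minus[OF tendsto_Re[OF exp_of_real_mult_quotient_tendsto[of \<zeta>]]]
    by (simp add: C_def diff_divide_distrib)
  \<comment> \<open>The rescaled probability without its error terms. One jump contributes exp(-l t)
    \<open>tail y\<close> / t; subtracting \<open>tail y\<close> / t leaves the difference quotient
    of the exponential, the origin of the term \<open>- big_mass \<delta> * tail y\<close>.\<close>
  define \<Psi> where "\<Psi> t = exp (- (?l * t)) * (PZ t / t\<^sup>2) + exp (- (?l * t)) * (s y * (S t / t) - s' * (C t / t))
    + tail y * ((exp (- (?l * t)) - 1) / t) + exp (- (?l * t)) * (E2 t / 2)" for t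
  define Err where "Err t = exp (- (?l * t)) * (\<eta> * (C t / t) + K * (p t / t)) + ?l ^ 3 * t" for t
  have e_lim: "((\<lambda>t. exp (- (?l * t))) \<longlongrightarrow> exp (- (?l * 0))) (at_right 0)"
    by (intro tendsto_intros)
  have e_lim': "((\<lambda>t. (exp (- (?l * t)) - 1) / t) \<longlongrightarrow> - ?l) (at_right 0)"
    using tendsto_Re[OF exp_of_real_mult_quotient_tendsto[of "- of_real ?l"]]
    by (simp add: mult.commute Re_exp)
  let ?D = "s y * Im \<zeta> + s' * Re \<zeta> + two_jumps y \<delta> 0 / 2 - ?l * tail y"
  have "(\<Psi> \<longlongrightarrow> exp (- (?l * 0)) * 0 + exp (- (?l * 0)) * (s y * Im \<zeta> - s' * (- Re \<zeta>))
      + tail y * (- ?l) + exp (- (?l * 0)) * (two_jumps y \<delta> 0 / 2)) (at_right 0)"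
    unfolding \<Psi>_def by (intro tendsto_intros e_lim PZ_lim S_lim C_lim e_lim' E2_lim) simp
  then have \<Psi>_lim: "(\<Psi> \<longlongrightarrow> ?D) (at_right 0)" by (simp add: algebra_simps)
  have "(Err \<longlongrightarrow> exp (- (?l * 0)) * (\<eta> * (- Re \<zeta>) + K * 0) + ?l ^ 3 * 0) (at_right 0)"
    unfolding Err_def by (intro tendsto_intros e_lim C_lim p_lim1)
  then have Err_lim: "(Err \<longlongrightarrow> \<eta> * (- Re \<zeta>)) (at_right 0)" by simp
  have close: "\<bar>1 / t * (1 / t * measure (L t) {y..} - tail y) - \<Psi> t\<bar> \<le> Err t" if t: "0 < t" for t
  proof -
    define E where "E = exp (- (?l * t))"
    define e1 where "e1 = E1 t - tail y - s y * S t + s' * C t"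
    define e3 where "e3 = measure (L t) {y..} - E * (PZ t + t * E1 t + t\<^sup>2 / 2 * E2 t)"
    have e3: "\<bar>e3\<bar> \<le> (?l * t) ^ 3"
      unfolding e3_def E_def PZ_def E1_def E2_def
      using tail_expansion[OF \<delta>(1) less_imp_le[OF t] L[OF t] R[OF t] char[OF t], of y] .
    have PL: "measure (L t) {y..} = E * (PZ t + t * (e1 + tail y + s y * S t - s' * C t) + t\<^sup>2 / 2 * E2 t) + e3"
      unfolding e3_def e1_def by simp
    have "1 / t * (1 / t * measure (L t) {y..} - tail y) - \<Psi> t = E * (e1 / t) + e3 / t\<^sup>2"
      unfolding PL \<Psi>_def E_def[symmetric] using t by (simp add: field_simps power2_eq_square)
    also have "\<bar>\<dots>\<bar> \<le> E * (\<bar>e1\<bar> / t) + \<bar>e3\<bar> / t\<^sup>2"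
      using t abs_triangle_ineq[of "E * (e1 / t)" "e3 / t\<^sup>2"] by (simp add: abs_mult E_def)
    also have "\<dots> \<le> E * ((\<eta> * C t + K * p t) / t) + (?l * t) ^ 3 / t\<^sup>2"
      using t e3 E1_bound[OF t] unfolding e1_def[symmetric]
      by (intro add_mono mult_left_mono divide_right_mono) (auto simp: E_def)
    also have "\<dots> = Err t"
      unfolding Err_def E_def using t by (simp add: field_simps power2_eq_square power3_eq_cube)
    finally show ?thesis .
  qed
  have "\<forall>\<^sub>F t in at_right 0. dist (\<Psi> t) ?D < e / 2"
    by (rule tendstoD[OF \<Psi>_lim]) (use \<open>0 < e\<close> in simp)
  moreover have "\<forall>\<^sub>F t in at_right 0. Err t < \<eta> * (- Re \<zeta>) + e / 2"
    by (rule order_tendstoD(2)[OF Err_lim]) (use \<open>0 < e\<close> in simp)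
  moreover have "\<forall>\<^sub>F t in at_right 0. 0 < (t::real)"
    by (simp add: eventually_at_right_less)
  ultimately show ?thesis
  proof eventually_elim
    case (elim t)
    have lin: "\<bar>a - d\<bar> < x + e" if "\<bar>a - p\<bar> \<le> w" "w < x + e / 2" "\<bar>p - d\<bar> < e / 2" for a d p w x :: real
      using that by linarith
    show ?case
      by (rule lin[OF close[OF elim(3)] elim(2) elim(1)[unfolded dist_real_def]])
  qed
qed

end

section \<open>Independence of the truncation\<close>

context levy_density
begin

text \<open>A closed form of the inner integral over s(y - u) - s(y) when \<open>x < y\<close>. In
  terms of \<open>tail\<close> it is visibly measurable and can be compared with
  \<open>one_jump\<close>.\<close>

definition increment :: "real \<Rightarrow> real \<Rightarrow> real" where
  "increment y x = tail (y - x) - tail y - x * s y"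

lemma tail_measurable[measurable]: "tail \<in> borel_measurable borel"
proof -
  have "tail v = (LINT x|lborel. s x * indicator {0..} (x - v))" for v
    unfolding tail_def by (intro Bochner_Integration.integral_cong refl) (auto simp: indicator_def)
  then have "tail = (\<lambda>v. LINT x|lborel. s x * indicator {0..} (x - v))" by auto
  then show ?thesis by simp
qed

lemma increment_measurable[measurable]: "increment y \<in> borel_measurable borel"
  unfolding increment_def by measurable

lemma tail_nonneg: "0 \<le> tail v"
  unfolding tail_def by (intro integral_nonneg_AE) (simp add: s_nonneg)

lemma tail_antimono: "0 < v \<Longrightarrow> v \<le> w \<Longrightarrow> tail w \<le> tail v"
  unfolding tail_def
  by (intro integral_mono integrable_tail) (auto simp: indicator_def s_nonneg)

lemma interval_integral_increment:
  assumes "a \<le> b" "b < y"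
  shows "(LBINT u=a..b. s (y - u) - s y) = tail (y - b) - tail (y - a) - (b - a) * s y"
proof -
  \<comment> \<open>The difference of two integrable tails is \<open>s\<close> restricted to the
    half-open interval from y - b to y - a; this supplies integrability, and the reflection of
    \<open>u\<close> into y - u gives the value.\<close>
  let ?f = "\<lambda>v. s v * indicator {y - b..} v - s v * indicator {y - a..} v"
  have i: "integrable lborel ?f"
    using assms by (intro Bochner_Integration.integrable_diff integrable_tail) auto
  have i': "integrable lborel (\<lambda>u. ?f (y + - 1 * u))"
    by (rule lborel_integrable_real_affine[OF i]) simp
  have ic: "integrable lborel (\<lambda>u. indicator {a..b} u * s y)"
    using assms by (intro integrable_mult_left integrable_real_indicator) (auto simp: emeasure_lborel_Icc_eq)
  have "(LBINT u=a..b. s (y - u) - s y) = (LINT u|lborel. indicator {a..b} u *\<^sub>R (s (y - u) - s y))"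
    using assms by (simp add: interval_integral_Icc set_lebesgue_integral_def)
  also have "\<dots> = (LINT u|lborel. ?f (y + - 1 * u) - indicator {a..b} u * s y)"
  proof (rule integral_cong_AE)
    show "AE u in lborel. indicator {a..b} u *\<^sub>R (s (y - u) - s y) = ?f (y + - 1 * u) - indicator {a..b} u * s y"
      using AE_lborel_singleton[of a] by eventually_elim (use assms in \<open>auto simp: indicator_def\<close>)
  qed auto
  also have "\<dots> = (LINT u|lborel. ?f (y + - 1 * u)) - (LINT u|lborel. indicator {a..b} u * s y)"
    by (rule Bochner_Integration.integral_diff[OF i' ic])
  also have "(LINT u|lborel. ?f (y + - 1 * u)) = (LINT v|lborel. ?f v)"
    using lborel_integral_real_affine[of "- 1" ?f y] by simp
  also have "\<dots> = tail (y - b) - tail (y - a)"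
    unfolding tail_def using assms by (intro Bochner_Integration.integral_diff integrable_tail) auto
  also have "(LINT u|lborel. indicator {a..b} u * s y) = (b - a) * s y"
    using assms by simp
  finally show ?thesis .
qed

lemma interval_integral_eq_increment:
  assumes "0 < y" "x < y"
  shows "(LBINT u=0..x. s (y - u) - s y) = increment y x"
proof (cases "0 \<le> x")
  case True
  then show ?thesis
    using interval_integral_increment[of 0 x y] assms by (simp add: increment_def zero_ereal_def)
next
  case False
  have "(LBINT u=0..x. s (y - u) - s y) = - (LBINT u=x..0. s (y - u) - s y)"
    by (rule interval_integral_endpoints_reverse)
  also have "\<dots> = increment y x"
    using interval_integral_increment[of x 0 y] False assms by (simp add: increment_def zero_ereal_def)
  finally show ?thesis .
qed

text \<open>Near 0 this is \<open>tail_first_order\<close>. On the rest of the interval the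
  increment is bounded, since y - x stays at least y - \<epsilon> > 0, and x^2 is bounded
  below.\<close>

lemma increment_quadratic:
  assumes \<rho>: "0 < \<rho>" "\<rho> < y" and cont: "continuous_on {y - \<rho>..y + \<rho>} s"
    and s': "(s has_real_derivative s') (at y)" and \<epsilon>: "0 < \<epsilon>" "\<epsilon> < y"
  obtains C where "0 \<le> C" "\<And>x. \<bar>x\<bar> \<le> \<epsilon> \<Longrightarrow> \<bar>increment y x\<bar> \<le> C * x\<^sup>2"
proof -
  obtain r where r: "0 < r" "\<And>z. \<bar>z\<bar> \<le> r \<Longrightarrow> \<bar>tail (y - z) - tail y - z * s y\<bar> \<le> (\<bar>s'\<bar> + 1) * z\<^sup>2"
    using tail_first_order[OF \<rho> cont s'] by blast
  define B where "B = tail (y - \<epsilon>) + tail y + \<epsilon> * s y"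
  have B: "0 \<le> B" using tail_nonneg s_nonneg \<epsilon> by (simp add: B_def)
  define C where "C = max (\<bar>s'\<bar> + 1) (B / r\<^sup>2)"
  have "\<bar>increment y x\<bar> \<le> C * x\<^sup>2" if x: "\<bar>x\<bar> \<le> \<epsilon>" for x
  proof (cases "\<bar>x\<bar> \<le> r")
    case True
    then have "\<bar>increment y x\<bar> \<le> (\<bar>s'\<bar> + 1) * x\<^sup>2" using r(2) by (simp add: increment_def)
    also have "\<dots> \<le> C * x\<^sup>2" by (intro mult_right_mono) (auto simp: C_def)
    finally show ?thesis .
  next
    case False
    have t: "tail (y - x) \<le> tail (y - \<epsilon>)" using x \<epsilon> by (intro tail_antimono) auto
    have "\<bar>x * s y\<bar> \<le> \<epsilon> * s y"
      using x s_nonneg[of y] by (simp add: abs_mult mult_right_mono)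
    then have "\<bar>increment y x\<bar> \<le> B"
      unfolding increment_def B_def using t tail_nonneg[of "y - x"] tail_nonneg[of y] by linarith
    also have "B = B / r\<^sup>2 * r\<^sup>2" using r by simp
    also have "\<dots> \<le> B / r\<^sup>2 * x\<^sup>2"
      using False r(1) B by (intro mult_left_mono) (auto simp flip: abs_le_square_iff)
    also have "\<dots> \<le> C * x\<^sup>2" by (intro mult_right_mono) (auto simp: C_def)
    finally show ?thesis .
  qed
  moreover have "0 \<le> C" by (simp add: C_def le_max_iff_disj)
  ultimately show ?thesis using that by blast
qed

text \<open>The claimed coefficient with \<open>c\<close> replaced by the indicator of \<bar>x\<bar>
  \<le> \<delta>.\<close>

definition sharp_coefficient :: "real \<Rightarrow> real \<Rightarrow> real \<Rightarrow> real \<Rightarrow> real \<Rightarrow> real" where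
  "sharp_coefficient \<sigma> b y s' \<delta> = - (\<sigma>\<^sup>2 / 2) * s' + (b - mid_drift \<delta>) * s y
    + (LINT x|lborel. s x * (indicator {x. \<bar>x\<bar> \<le> \<delta>} x * increment y x))
    + two_jumps y \<delta> 0 / 2 - big_mass \<delta> * tail y"

text \<open>With \<open>I f\<close> the integral of \<open>f\<close> against s h, passing from the
  indicator to \<open>c\<close> adds s(y) I(x) through the drift, I(increment) through the small
  jumps, - I(tail (y - x)) through half the double integral and tail(y) I(1) through the intensity.
  These add up to 0 by the definition of \<open>increment\<close>.\<close>

lemma truncation_invariance:
  assumes \<rho>: "0 < \<rho>" "\<rho> < y" and cont: "continuous_on {y - \<rho>..y + \<rho>} s"
    and s': "(s has_real_derivative s') (at y)"
    and \<delta>: "0 < \<delta>" "\<delta> \<le> \<epsilon> / 2" and \<epsilon>: "\<epsilon> < 1" "2 * \<epsilon> < y"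
    and c[measurable]: "c \<in> borel_measurable borel"
    and c_bounds: "\<And>x. indicator {- \<epsilon> / 2..\<epsilon> / 2} x \<le> c x" "\<And>x. c x \<le> indicator {- \<epsilon>..\<epsilon>} x"
  shows "- (\<sigma>\<^sup>2 / 2) * s' + (b - (LINT x|lborel. s x * (indicator {x. \<bar>x\<bar> \<le> 1} x * (x * (1 - c x))))) * s y
      + (LINT x|lborel. (LBINT u=0..x. s (y - u) - s y) * small_part c s x)
      + 1 / 2 * (LINT x|lborel. LINT u|lborel.
            indicator {(x, u). x + u \<ge> y} (x, u) * large_part c s u * large_part c s x)
      - (LINT x|lborel. s x * (1 - c x)) * tail y
    = sharp_coefficient \<sigma> b y s' \<delta>"
proof -
  have \<epsilon>0: "0 < \<epsilon>" and \<epsilon>y: "\<epsilon> < y" using \<delta> \<epsilon> by auto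
  define h where "h x = c x - indicator {x. \<bar>x\<bar> \<le> \<delta>} x" for x
  have [measurable]: "h \<in> borel_measurable borel" unfolding h_def by measurable
  have c_small: "c x = 1" if "\<bar>x\<bar> \<le> \<delta>" for x
  proof -
    have "x \<in> {- \<epsilon> / 2..\<epsilon> / 2}" "x \<in> {- \<epsilon>..\<epsilon>}" using that \<delta> by auto
    then show ?thesis using c_bounds[of x] by simp
  qed
  have c_large: "c x = 0" if "\<epsilon> < \<bar>x\<bar>" for x
  proof -
    have "x \<notin> {- \<epsilon> / 2..\<epsilon> / 2}" "x \<notin> {- \<epsilon>..\<epsilon>}" using that \<epsilon>0 by auto
    then show ?thesis using c_bounds[of x] by simp
  qed
  have c01: "0 \<le> c x" "c x \<le> 1" for x
    using order_trans[OF indicator_pos_le c_bounds(1)] order_trans[OF c_bounds(2) indicator_le_1] by auto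
  have h0: "h x = 0" if "\<bar>x\<bar> \<le> \<delta> \<or> \<epsilon> < \<bar>x\<bar>" for x
    using that c_small[of x] c_large[of x] \<delta> by (auto simp: h_def indicator_def)
  have h1: "\<bar>h x\<bar> \<le> 1" for x
    using c01[of x] c_small[of x] by (auto simp: h_def indicator_def)
  \<comment> \<open>\<open>h\<close> is supported where \<delta> < \<bar>x\<bar> \<le> \<epsilon>:
    the lower bound gives finite mass, and the upper one means that \<open>f\<close> need only be
    bounded on the interval of radius \<epsilon>.\<close>
  have ih: "integrable lborel (\<lambda>x. s x * (h x * f x))"
    if [measurable]: "f \<in> borel_measurable borel" and B: "\<And>x. \<bar>x\<bar> \<le> \<epsilon> \<Longrightarrow> \<bar>f x\<bar> \<le> B" for f :: "real \<Rightarrow> real" and B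
  proof -
    have "0 \<le> B" using B[of 0] \<epsilon>0 by simp
    have "norm (h x * f x) \<le> B" for x
    proof (cases "\<bar>x\<bar> \<le> \<epsilon>")
      case True
      then show ?thesis
        using mult_mono[OF h1[of x] B[OF True]] by (simp add: abs_mult)
    qed (use h0 \<open>0 \<le> B\<close> in simp)
    then show ?thesis
      unfolding real_scaleR_def[symmetric, of "s _"]
      by (intro integrable_levy_tail[OF _ _ \<delta>(1)]) (auto simp: h0)
  qed
  define I where "I f = (LINT x|lborel. s x * (h x * f x))" for f :: "real \<Rightarrow> real"
  obtain C where C: "0 \<le> C" "\<And>x. \<bar>x\<bar> \<le> \<epsilon> \<Longrightarrow> \<bar>increment y x\<bar> \<le> C * x\<^sup>2"
    using increment_quadratic[OF \<rho> cont s' \<epsilon>0 \<epsilon>y] by blast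
  have tail_le: "\<bar>tail (y - x)\<bar> \<le> tail (y - \<epsilon>)" if "\<bar>x\<bar> \<le> \<epsilon>" for x
    using tail_antimono[of "y - \<epsilon>" "y - x"] tail_nonneg[of "y - x"] that \<epsilon>y by auto
  have sq: "C * x\<^sup>2 \<le> C" if "\<bar>x\<bar> \<le> \<epsilon>" for x
    using that \<epsilon> C(1) by (simp add: mult_left_le abs_square_le_1)
  have ih_inc: "integrable lborel (\<lambda>x. s x * (h x * increment y x))"
    by (rule ih[where B = C]) (auto intro: order_trans[OF C(2) sq])
  have ih_x: "integrable lborel (\<lambda>x. s x * (h x * x))"
    by (rule ih[where B = \<epsilon>]) auto
  have ih_tail: "integrable lborel (\<lambda>x. s x * (h x * tail (y - x)))"
    by (rule ih[OF _ tail_le]) auto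
  have ih_1: "integrable lborel (\<lambda>x. s x * (h x * 1))"
    by (rule ih[where B = 1]) auto
  have T1: "(LINT x|lborel. s x * (indicator {x. \<bar>x\<bar> \<le> 1} x * (x * (1 - c x)))) = mid_drift \<delta> - I (\<lambda>x. x)"
  proof -
    have i: "integrable lborel (\<lambda>x. s x * (indicator {x. \<delta> < \<bar>x\<bar> \<and> \<bar>x\<bar> \<le> 1} x * x))"
      unfolding real_scaleR_def[symmetric, of "s _"]
      by (rule integrable_levy_tail[where C = 1 and a = \<delta>]) (use \<delta> in \<open>auto simp: indicator_def\<close>)
    have "(LINT x|lborel. s x * (indicator {x. \<bar>x\<bar> \<le> 1} x * (x * (1 - c x))))
      = (LINT x|lborel. s x * (indicator {x. \<delta> < \<bar>x\<bar> \<and> \<bar>x\<bar> \<le> 1} x * x) - s x * (h x * x))"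
    proof (intro Bochner_Integration.integral_cong refl)
      fix x
      show "s x * (indicator {x. \<bar>x\<bar> \<le> 1} x * (x * (1 - c x)))
        = s x * (indicator {x. \<delta> < \<bar>x\<bar> \<and> \<bar>x\<bar> \<le> 1} x * x) - s x * (h x * x)"
        using c_large[of x] c_small[of x] \<epsilon> \<delta>
        by (cases "\<bar>x\<bar> \<le> \<delta>"; cases "\<bar>x\<bar> \<le> 1") (auto simp: h_def indicator_def algebra_simps)
    qed
    then show ?thesis using i ih_x by (simp add: mid_drift_def I_def)
  qed
  have T2: "(LINT x|lborel. (LBINT u=0..x. s (y - u) - s y) * small_part c s x)
    = (LINT x|lborel. s x * (indicator {x. \<bar>x\<bar> \<le> \<delta>} x * increment y x)) + I (increment y)"
  proof -
    have i: "integrable lborel (\<lambda>x. s x * (indicator {x. \<bar>x\<bar> \<le> \<delta>} x * increment y x))"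
      unfolding real_scaleR_def[symmetric, of "s _"]
    proof (rule integrable_levy)
      fix x :: real
      show "norm (indicator {x. \<bar>x\<bar> \<le> \<delta>} x * increment y x) \<le> C * min 1 (x\<^sup>2)"
      proof (cases "\<bar>x\<bar> \<le> \<delta>")
        case True
        then have "x\<^sup>2 \<le> 1" using \<delta> \<epsilon> by (simp add: abs_square_le_1)
        then show ?thesis using True C(2)[of x] \<delta> \<epsilon>0 by simp
      qed (use C(1) in simp)
    qed measurable
    have "(LINT x|lborel. (LBINT u=0..x. s (y - u) - s y) * small_part c s x)
      = (LINT x|lborel. s x * (indicator {x. \<bar>x\<bar> \<le> \<delta>} x * increment y x) + s x * (h x * increment y x))"
    proof (intro Bochner_Integration.integral_cong refl)
      fix x
      show "(LBINT u=0..x. s (y - u) - s y) * small_part c s x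
        = s x * (indicator {x. \<bar>x\<bar> \<le> \<delta>} x * increment y x) + s x * (h x * increment y x)"
      proof (cases "\<bar>x\<bar> \<le> \<epsilon>")
        case True
        then have "(LBINT u=0..x. s (y - u) - s y) = increment y x"
          using \<epsilon>y \<epsilon>0 by (intro interval_integral_eq_increment) auto
        then show ?thesis by (simp add: small_part_def h_def algebra_simps)
      next
        case False
        then show ?thesis using c_large[of x] h0[of x] \<delta> by (simp add: small_part_def)
      qed
    qed
    then show ?thesis using i ih_inc by (simp add: I_def)
  qed
  have T4: "(LINT x|lborel. s x * (1 - c x)) = big_mass \<delta> - I (\<lambda>_. 1)"
  proof -
    have "(LINT x|lborel. s x * (1 - c x)) = (LINT x|lborel. big_part \<delta> x - s x * (h x * 1))"
      by (intro Bochner_Integration.integral_cong refl) (auto simp: big_part_def h_def indicator_def algebra_simps)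
    then show ?thesis using integrable_big_part[OF \<delta>(1)] ih_1 by (simp add: big_mass_def I_def)
  qed
  define hs where "hs x = s x * h x" for x
  have [measurable]: "hs \<in> borel_measurable borel" unfolding hs_def by measurable
  have ihs: "integrable lborel hs" using ih_1 by (simp add: hs_def[abs_def])
  have ihs_mult: "integrable lborel (\<lambda>x. hs x * f x)"
    if [measurable]: "f \<in> borel_measurable borel" and "\<And>x. \<bar>f x\<bar> \<le> B" for f :: "real \<Rightarrow> real" and B
    using ih[of f B] that by (simp add: hs_def mult.assoc)
  define gh where "gh x = (LINT u|lborel. hs u * indicator {y..} (x + u))" for x
  have [measurable]: "gh \<in> borel_measurable borel" unfolding gh_def by measurable
  have gh_bound: "\<bar>gh x\<bar> \<le> (LINT u|lborel. \<bar>hs u\<bar>)" for x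
  proof -
    have "\<bar>gh x\<bar> \<le> (LINT u|lborel. \<bar>hs u * indicator {y..} (x + u)\<bar>)"
      unfolding gh_def by (rule integral_abs_bound)
    also have "\<dots> \<le> (LINT u|lborel. \<bar>hs u\<bar>)"
      by (intro integral_mono integrable_abs ihs ihs_mult[where B = 1]) (auto simp: indicator_def abs_mult)
    finally show ?thesis .
  qed
  have large: "large_part c s x = big_part \<delta> x - hs x" for x
    by (auto simp: large_part_def big_part_def hs_def h_def indicator_def algebra_simps)
  have inner: "(LINT u|lborel. indicator {(x, u). x + u \<ge> y} (x, u) * large_part c s u * large_part c s x)
    = (big_part \<delta> x - hs x) * (one_jump y \<delta> x - gh x)" for x
  proof -
    have "(LINT u|lborel. indicator {(x, u). x + u \<ge> y} (x, u) * large_part c s u * large_part c s x)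
      = (LINT u|lborel. (big_part \<delta> x - hs x) * (big_part \<delta> u * indicator {y..} (x + u) - hs u * indicator {y..} (x + u)))"
      unfolding large by (intro Bochner_Integration.integral_cong refl) (auto simp: indicator_def)
    also have "\<dots> = (big_part \<delta> x - hs x) * (LINT u|lborel. big_part \<delta> u * indicator {y..} (x + u) - hs u * indicator {y..} (x + u))"
      by (rule integral_mult_right_zero)
    also have "(LINT u|lborel. big_part \<delta> u * indicator {y..} (x + u) - hs u * indicator {y..} (x + u)) = one_jump y \<delta> x - gh x"
      unfolding one_jump_def gh_def
      by (intro Bochner_Integration.integral_diff ihs_mult[where B = 1] integrable_big_part_mult(1)[OF \<delta>(1), where B = 1])
        (auto simp: indicator_def)
    finally show ?thesis .
  qed
  have hs_gh: "hs x * gh x = 0" for x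
  proof (cases "\<bar>x\<bar> \<le> \<epsilon>")
    case True
    have z: "hs u * indicator {y..} (x + u) = 0" for u
    proof (cases "\<bar>u\<bar> \<le> \<epsilon>")
      case le: True
      then have "\<not> y \<le> x + u" using True \<epsilon> by linarith
      then show ?thesis by simp
    next
      case False
      then show ?thesis using h0[of u] by (simp add: hs_def)
    qed
    show ?thesis unfolding gh_def z by simp
  qed (use h0 in \<open>simp add: hs_def\<close>)
  \<comment> \<open>Starting from \<bar>x\<bar> \<le> \<epsilon>, reaching \<open>y\<close> takes a
    further jump of at least y - \<epsilon> > \<delta>, so the cut at \<delta> is invisible and
    \<open>one_jump\<close> is the full tail.\<close>
  have hs_oj: "hs x * one_jump y \<delta> x = s x * (h x * tail (y - x))" for x
  proof (cases "\<bar>x\<bar> \<le> \<epsilon>")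
    case True
    then have "one_jump y \<delta> x = tail (y - x)"
      using \<delta> \<epsilon> by (intro one_jump_eq_tail) auto
    then show ?thesis by (simp add: hs_def)
  qed (use h0 in \<open>simp add: hs_def\<close>)
  \<comment> \<open>The condition y \<le> x + u is symmetric, so Fubini identifies the two mixed
    terms of the double integral; this gives the factor 2 in \<open>T3\<close>.\<close>
  have swap: "(LINT x|lborel. big_part \<delta> x * gh x) = I (\<lambda>x. tail (y - x))"
  proof -
    let ?f = "\<lambda>x u. big_part \<delta> x * (hs u * indicator {y..} (x + u)) :: real"
    have i: "integrable (lborel \<Otimes>\<^sub>M lborel) (case_prod ?f)"
    proof (rule lborel_pair.Fubini_integrable)
      show "AE x in lborel. integrable lborel (\<lambda>u. case_prod ?f (x, u))"
        by (auto intro!: ihs_mult[where B = 1] simp: indicator_def)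
      have "integrable lborel (\<lambda>x. big_part \<delta> x * (LINT u|lborel. \<bar>hs u * indicator {y..} (x + u)\<bar>))"
      proof (rule integrable_big_part_mult(1)[OF \<delta>(1)])
        fix x
        have "(LINT u|lborel. \<bar>hs u * indicator {y..} (x + u)\<bar>) \<le> (LINT u|lborel. \<bar>hs u\<bar>)"
          by (intro integral_mono integrable_abs ihs ihs_mult[where B = 1]) (auto simp: indicator_def abs_mult)
        then show "\<bar>LINT u|lborel. \<bar>hs u * indicator {y..} (x + u)\<bar>\<bar> \<le> (LINT u|lborel. \<bar>hs u\<bar>)"
          by simp
      qed measurable
      then show "integrable lborel (\<lambda>x. LINT u|lborel. norm (case_prod ?f (x, u)))"
        by (simp add: abs_mult big_part_nonneg)
    qed measurable
    have "(LINT x|lborel. big_part \<delta> x * gh x) = (LINT x|lborel. LINT u|lborel. ?f x u)"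
      by (simp add: gh_def)
    also have "\<dots> = (LINT u|lborel. LINT x|lborel. ?f x u)"
      by (rule lborel_pair.Fubini_integral[OF i, symmetric])
    also have "\<dots> = (LINT u|lborel. hs u * one_jump y \<delta> u)"
    proof (intro Bochner_Integration.integral_cong refl)
      fix u
      have "(LINT x|lborel. ?f x u) = (LINT x|lborel. hs u * (big_part \<delta> x * indicator {y..} (u + x)))"
        by (intro Bochner_Integration.integral_cong refl) (simp add: mult_ac add.commute)
      then show "(LINT x|lborel. ?f x u) = hs u * one_jump y \<delta> u"
        by (simp add: one_jump_def)
    qed
    finally show ?thesis by (simp add: hs_oj I_def)
  qed
  have T3: "(LINT x|lborel. LINT u|lborel. indicator {(x, u). x + u \<ge> y} (x, u) * large_part c s u * large_part c s x)
    = two_jumps y \<delta> 0 - 2 * I (\<lambda>x. tail (y - x))"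
  proof -
    have i1: "integrable lborel (\<lambda>x. big_part \<delta> x * one_jump y \<delta> x)"
      by (rule integrable_big_part_mult(1)[OF \<delta>(1) _ abs_one_jump_le[OF \<delta>(1)]]) measurable
    have i2: "integrable lborel (\<lambda>x. big_part \<delta> x * gh x)"
      by (rule integrable_big_part_mult(1)[OF \<delta>(1) _ gh_bound]) measurable
    have "(big_part \<delta> x - hs x) * (one_jump y \<delta> x - gh x)
      = big_part \<delta> x * one_jump y \<delta> x - big_part \<delta> x * gh x - s x * (h x * tail (y - x))" for x
      using hs_gh[of x] hs_oj[of x] by (simp add: algebra_simps)
    then show ?thesis
      unfolding inner using i1 i2 ih_tail swap by (simp add: two_jumps_def I_def)
  qed
  have "I (increment y) = I (\<lambda>x. tail (y - x)) - tail y * I (\<lambda>_. 1) - s y * I (\<lambda>x. x)"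
  proof -
    have "I (increment y) = (LINT x|lborel. s x * (h x * tail (y - x)) - tail y * (s x * (h x * 1)) - s y * (s x * (h x * x)))"
      unfolding I_def by (intro Bochner_Integration.integral_cong refl) (simp add: increment_def algebra_simps)
    then show ?thesis
      using ih_tail ih_1 ih_x by (simp add: I_def)
  qed
  then show ?thesis
    unfolding T1 T2 T3 T4 sharp_coefficient_def by (simp add: algebra_simps)
qed

section \<open>Variance of the small jumps\<close>

definition small_variance :: "real \<Rightarrow> real" where
  "small_variance \<delta> = (LINT x|lborel. s x * (indicator {x. \<bar>x\<bar> \<le> \<delta>} x * x\<^sup>2))"

lemma integrable_small_variance:
  assumes "\<delta> \<le> 1"
  shows "integrable lborel (\<lambda>x. s x * (indicator {x. \<bar>x\<bar> \<le> \<delta>} x * x\<^sup>2))"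
  unfolding real_scaleR_def[symmetric, of "s _"]
proof (rule integrable_levy[where C = 1])
  fix x :: real
  show "norm (indicator {x. \<bar>x\<bar> \<le> \<delta>} x * x\<^sup>2) \<le> 1 * min 1 (x\<^sup>2)"
    using assms abs_square_le_1[of x] by (auto simp: indicator_def)
qed measurable

text \<open>Stated for Banach-valued integrands because it serves the complex
  \<open>small_exponent\<close> at 1, with C = 1, as well as the real integral of
  \<open>increment\<close>.\<close>

lemma norm_integral_small_le:
  fixes g :: "real \<Rightarrow> 'b::{banach, second_countable_topology}"
  assumes \<delta>: "\<delta> \<le> 1" and g[measurable]: "g \<in> borel_measurable borel"
    and gb: "\<And>x. \<bar>x\<bar> \<le> \<delta> \<Longrightarrow> norm (g x) \<le> C * x\<^sup>2"
  shows "norm (LINT x|lborel. s x *\<^sub>R (indicator {x. \<bar>x\<bar> \<le> \<delta>} x *\<^sub>R g x)) \<le> C * small_variance \<delta>"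
proof -
  let ?v = "\<lambda>x. s x * (indicator {x. \<bar>x\<bar> \<le> \<delta>} x * x\<^sup>2)"
  have i: "integrable lborel (\<lambda>x. C * ?v x)"
    using integrable_small_variance[OF \<delta>] by (rule integrable_mult_right)
  have b: "norm (s x *\<^sub>R (indicator {x. \<bar>x\<bar> \<le> \<delta>} x *\<^sub>R g x)) \<le> C * ?v x" for x
    using mult_left_mono[OF gb[of x] s_nonneg[of x]] s_nonneg[of x] by (auto simp: indicator_def mult_ac)
  have 1: "integrable lborel (\<lambda>x. s x *\<^sub>R (indicator {x. \<bar>x\<bar> \<le> \<delta>} x *\<^sub>R g x))"
    by (rule Bochner_Integration.integrable_bound[OF i]) (use b in \<open>auto intro: order_trans[OF _ abs_ge_self]\<close>)
  have "norm (LINT x|lborel. s x *\<^sub>R (indicator {x. \<bar>x\<bar> \<le> \<delta>} x *\<^sub>R g x)) \<le> (LINT x|lborel. C * ?v x)"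
    by (rule Bochner_Integration.integral_norm_bound_integral[OF 1 i]) (use b in auto)
  then show ?thesis by (simp add: small_variance_def)
qed

lemma small_variance_nonneg: "0 \<le> small_variance \<delta>"
  unfolding small_variance_def by (intro integral_nonneg_AE) (simp add: s_nonneg)

lemma small_variance_le: "\<delta> \<le> 1 \<Longrightarrow> small_variance \<delta> \<le> V"
  unfolding small_variance_def V_def
  by (intro integral_mono integrable_small_variance integrable_min)
    (auto simp: indicator_def s_nonneg abs_square_le_1 intro!: mult_left_mono)

lemma small_variance_mono: "\<delta> \<le> \<delta>' \<Longrightarrow> \<delta>' \<le> 1 \<Longrightarrow> small_variance \<delta> \<le> small_variance \<delta>'"
  unfolding small_variance_def
  by (intro integral_mono integrable_small_variance) (auto simp: indicator_def s_nonneg)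

lemma small_variance_small:
  assumes "0 < e"
  obtains a where "0 < a" "a \<le> 1" "small_variance a < e"
proof -
  have "(\<lambda>n. small_variance (1 / real (Suc n))) \<longlonglongrightarrow> (LINT x::real|lborel. 0)"
    unfolding small_variance_def
  proof (rule integral_dominated_convergence[where w = "\<lambda>x. s x * min 1 (x\<^sup>2)"])
    show "AE x in lborel. (\<lambda>n. s x * (indicator {x. \<bar>x\<bar> \<le> 1 / real (Suc n)} x * x\<^sup>2)) \<longlonglongrightarrow> 0"
    proof (rule AE_I2)
      fix x :: real
      show "(\<lambda>n. s x * (indicator {x. \<bar>x\<bar> \<le> 1 / real (Suc n)} x * x\<^sup>2)) \<longlonglongrightarrow> 0"
      proof (cases "x = 0")
        case False
        have "(\<lambda>n. 1 / real (Suc n)) \<longlonglongrightarrow> 0" by (rule LIMSEQ_Suc[OF lim_1_over_n])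
        from order_tendstoD(2)[OF this, of "\<bar>x\<bar>"] False
        have "\<forall>\<^sub>F n in sequentially. 1 / real (Suc n) < \<bar>x\<bar>" by simp
        then have "\<forall>\<^sub>F n in sequentially. s x * (indicator {x. \<bar>x\<bar> \<le> 1 / real (Suc n)} x * x\<^sup>2) = 0"
          by eventually_elim (simp add: indicator_def)
        then show ?thesis by (rule tendsto_eventually)
      qed simp
    qed
    show "AE x in lborel. norm (s x * (indicator {x. \<bar>x\<bar> \<le> 1 / real (Suc n)} x * x\<^sup>2)) \<le> s x * min 1 (x\<^sup>2)" for n
    proof (rule AE_I2)
      fix x :: real
      have "1 / real (Suc n) \<le> 1" by simp
      then have "x\<^sup>2 \<le> 1" if "\<bar>x\<bar> \<le> 1 / real (Suc n)"
        unfolding abs_square_le_1 using that by linarith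
      then have "\<bar>indicator {x. \<bar>x\<bar> \<le> 1 / real (Suc n)} x * x\<^sup>2\<bar> \<le> min 1 (x\<^sup>2)"
        by (auto simp: indicator_def simp del: of_nat_Suc)
      then show "norm (s x * (indicator {x. \<bar>x\<bar> \<le> 1 / real (Suc n)} x * x\<^sup>2)) \<le> s x * min 1 (x\<^sup>2)"
        using s_nonneg[of x] by (simp only: real_norm_def abs_mult[of "s x"] abs_of_nonneg mult_left_mono)
    qed
  qed (use integrable_min in auto)
  from order_tendstoD(2)[OF this, of e] assms obtain n where "small_variance (1 / real (Suc n)) < e"
    by (auto simp: eventually_sequentially)
  then show ?thesis by (intro that[of "1 / real (Suc n)"]) auto
qed

text \<open>The order of the choices matters: \<open>\<eta>\<close> depends on \<open>e\<close>
  through a constant valid for all cuts, \<open>\<eta>\<close> fixes the radius \<open>r\<close>,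
  \<open>r\<close> limits \<open>\<delta>\<close>, and only then does t tend to 0. Three errors of
  size e / 4 result.\<close>

proposition tail_second_order_limit:
  fixes L :: "real \<Rightarrow> real measure"
  assumes \<rho>: "0 < \<rho>" "\<rho> < y" and cont: "continuous_on {y - \<rho>..y + \<rho>} s"
    and s': "(s has_real_derivative s') (at y)"
    and "0 < \<delta>\<^sub>0" and D: "\<And>\<delta>. 0 < \<delta> \<Longrightarrow> \<delta> \<le> \<delta>\<^sub>0 \<Longrightarrow> sharp_coefficient \<sigma> b y s' \<delta> = D"
    and L: "\<And>t. 0 < t \<Longrightarrow> real_distribution (L t)"
    and decomposition: "\<And>\<delta> t. 0 < \<delta> \<Longrightarrow> \<delta> < 1 \<Longrightarrow> 0 < t \<Longrightarrow> \<exists>R. real_distribution R \<and>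
      (\<forall>u. char (L t) u = char R u * exp (of_real t * big_exponent \<delta> u)) \<and>
      (\<forall>u. char R u = exp (of_real t * (\<i> * of_real (u * (b - mid_drift \<delta>)) - of_real (\<sigma>\<^sup>2 * u\<^sup>2 / 2) + small_exponent \<delta> u))) \<and>
      (\<forall>u. (\<integral>\<^sup>+z. ennreal (exp (u * z)) \<partial>R)
        \<le> ennreal (exp (t * (u * (b - mid_drift \<delta>) + \<sigma>\<^sup>2 * u\<^sup>2 / 2 + u\<^sup>2 * exp (\<bar>u\<bar> * \<delta>) * V))))"
  shows "((\<lambda>t. 1 / t * (1 / t * measure (L t) {y..} - tail y)) \<longlongrightarrow> D) (at_right 0)"
proof (rule tendstoI)
  fix e :: real assume e: "0 < e"
  \<comment> \<open>Bounds \<open>- Re \<zeta>\<close> for every \<delta> \<le> 1: half the Gaussian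
    variance plus the second moment of the small jumps, with 1 added for positivity.\<close>
  define K where "K = \<sigma>\<^sup>2 / 2 + V + 1"
  have K: "0 < K" using V_nonneg by (simp add: K_def add_nonneg_pos)
  define \<eta> where "\<eta> = e / (4 * K)"
  have \<eta>: "0 < \<eta>" "\<eta> * K = e / 4" using e K by (auto simp: \<eta>_def)
  obtain r0 where r0: "0 < r0" "\<And>z. \<bar>z\<bar> \<le> r0 \<Longrightarrow> \<bar>tail (y - z) - tail y - s y * sin z + s' * (1 - cos z)\<bar> \<le> \<eta> * (1 - cos z)"
    using tail_second_order[OF \<rho> cont s' \<eta>(1)] by blast
  have y: "0 < y" using \<rho> by simp
  define r where "r = min r0 (y / 2)"
  have r: "0 < r" "r \<le> r0" "r \<le> y / 2" using r0 y by (auto simp: r_def)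
  obtain C where C: "0 \<le> C" "\<And>x. \<bar>x\<bar> \<le> y / 2 \<Longrightarrow> \<bar>increment y x\<bar> \<le> C * x\<^sup>2"
    using increment_quadratic[OF \<rho> cont s', of "y / 2"] y by auto
  \<comment> \<open>Collects the factors with which \<open>small_variance \<delta>\<close> enters
    the distance between the fixed-cut limit and \<open>D\<close>.\<close>
  define N where "N = \<bar>s y\<bar> + \<bar>s'\<bar> + C + 1"
  have N: "0 < N" using C(1) by (simp add: N_def)
  obtain a where a: "0 < a" "a \<le> 1" "small_variance a < e / (4 * N)"
    using small_variance_small[of "e / (4 * N)"] e N by auto
  \<comment> \<open>In turn: small variance below its target, validity of \<open>D\<close>, the
    Chernoff condition 4 \<delta> \<le> r, and \<delta> < 1.\<close>
  define \<delta> where "\<delta> = min (min a \<delta>\<^sub>0) (min (r / 4) (1 / 2))"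
  have \<delta>: "0 < \<delta>" "\<delta> \<le> a" "\<delta> \<le> \<delta>\<^sub>0" "4 * \<delta> \<le> r" "\<delta> < 1"
    using a r \<open>0 < \<delta>\<^sub>0\<close> by (auto simp: \<delta>_def min_def)
  have v: "N * small_variance \<delta> < e / 4"
  proof -
    have "small_variance \<delta> < e / (4 * N)"
      using small_variance_mono[OF \<delta>(2) a(2)] a(3) by linarith
    then show ?thesis using N by (simp add: field_simps)
  qed
  define se where "se = small_exponent \<delta> 1"
  define \<zeta> where "\<zeta> = \<i> * of_real (b - mid_drift \<delta>) - of_real (\<sigma>\<^sup>2 / 2) + se"
  have se: "norm se \<le> 1 * small_variance \<delta>"
    unfolding se_def small_exponent_def
    by (rule norm_integral_small_le) (use \<delta> norm_iexp_minus_le in auto)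
  have Re_\<zeta>: "Re \<zeta> = - (\<sigma>\<^sup>2 / 2) + Re se" and Im_\<zeta>: "Im \<zeta> = b - mid_drift \<delta> + Im se"
    by (simp_all add: \<zeta>_def)
  have "- Re \<zeta> \<le> K"
    using abs_Re_le_cmod[of se] se small_variance_le[of \<delta>] \<delta> unfolding Re_\<zeta> K_def by linarith
  then have \<eta>\<zeta>: "\<eta> * (- Re \<zeta>) \<le> e / 4"
    using mult_left_mono[of "- Re \<zeta>" K \<eta>] \<eta> by linarith
  define A where "A = (LINT x|lborel. s x * (indicator {x. \<bar>x\<bar> \<le> \<delta>} x * increment y x))"
  have A: "\<bar>A\<bar> \<le> C * small_variance \<delta>"
    using norm_integral_small_le[of \<delta> "increment y" C] C(2) \<delta> r by (simp add: A_def)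
  let ?L = "s y * Im \<zeta> + s' * Re \<zeta> + two_jumps y \<delta> 0 / 2 - big_mass \<delta> * tail y"
  \<comment> \<open>The two expressions differ in the small jumps only: the limit sees them through
    their characteristic exponent at 1, the coefficient through \<open>increment\<close>. Both
    contributions are of the order of \<open>small_variance \<delta>\<close>, so no cancellation
    between them is required.\<close>
  have "?L - D = s y * Im se + s' * Re se - A"
    unfolding D[OF \<delta>(1,3), symmetric] sharp_coefficient_def A_def[symmetric] Re_\<zeta> Im_\<zeta>
    by (simp add: algebra_simps)
  also have "\<bar>s y * Im se + s' * Re se - A\<bar> \<le> \<bar>s y\<bar> * \<bar>Im se\<bar> + \<bar>s'\<bar> * \<bar>Re se\<bar> + \<bar>A\<bar>"
    unfolding abs_mult[symmetric] by linarith
  also have "\<dots> \<le> \<bar>s y\<bar> * small_variance \<delta> + \<bar>s'\<bar> * small_variance \<delta> + C * small_variance \<delta>"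
    using abs_Re_le_cmod[of se] abs_Im_le_cmod[of se] se A by (intro add_mono mult_left_mono) auto
  also have "\<dots> \<le> N * small_variance \<delta>"
    using small_variance_nonneg[of \<delta>] by (simp add: N_def algebra_simps)
  finally have LD: "\<bar>?L - D\<bar> < e / 4" using v by linarith
  obtain R where R: "\<And>t. 0 < t \<Longrightarrow> real_distribution (R t)"
    "\<And>t u. 0 < t \<Longrightarrow> char (L t) u = char (R t) u * exp (of_real t * big_exponent \<delta> u)"
    "\<And>t u. 0 < t \<Longrightarrow> char (R t) u = exp (of_real t * (\<i> * of_real (u * (b - mid_drift \<delta>)) - of_real (\<sigma>\<^sup>2 * u\<^sup>2 / 2) + small_exponent \<delta> u))"
    "\<And>t u. 0 < t \<Longrightarrow> (\<integral>\<^sup>+z. ennreal (exp (u * z)) \<partial>R t)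
        \<le> ennreal (exp (t * (u * (b - mid_drift \<delta>) + \<sigma>\<^sup>2 * u\<^sup>2 / 2 + u\<^sup>2 * exp (\<bar>u\<bar> * \<delta>) * V)))"
    using decomposition[OF \<delta>(1,5)] by metis
  have R1: "char (R t) 1 = exp (of_real t * \<zeta>)" if "0 < t" for t
    using R(3)[OF that, of 1] by (simp add: \<zeta>_def se_def)
  have "\<forall>\<^sub>F t in at_right 0. \<bar>1 / t * (1 / t * measure (L t) {y..} - tail y) - ?L\<bar> < \<eta> * (- Re \<zeta>) + e / 4"
    by (rule tail_asymptotics_fixed_cutoff[OF \<delta>(1,4) _ less_imp_le[OF \<eta>(1)] _ L R(1,2) R1 R(4)])
      (use r r0 \<delta> y e in auto)
  then show "\<forall>\<^sub>F t in at_right 0. dist (1 / t * (1 / t * measure (L t) {y..} - tail y)) D < e"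
  proof eventually_elim
    case (elim t)
    have lin: "\<bar>p - d\<bar> < e" if "\<bar>p - l\<bar> < w + e / 4" "w \<le> e / 4" "\<bar>l - d\<bar> < e / 4" for p d l w :: real
      using that e by linarith
    show ?case unfolding dist_real_def by (rule lin[OF elim \<eta>\<zeta> LD])
  qed
qed

end

section \<open>Second-order expansion of the tail\<close>

lemma truncation_function_measurable:
  assumes "truncation_function \<epsilon> c"
  shows "c \<in> borel_measurable borel"
proof -
  have "\<forall>n x. (deriv ^^ n) c field_differentiable (at x)"
    using assms by (simp add: truncation_function_def smooth_def)
  from this[rule_format, of 0] have "continuous_on UNIV c"
    by (intro continuous_at_imp_continuous_on) (auto intro: field_differentiable_imp_continuous_at)
  then show ?thesis by (rule borel_measurable_continuous_onI)
qed

theorem proposition3p4: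
  fixes M :: "'a measure" and X :: "real \<Rightarrow> 'a \<Rightarrow> real"
    and \<sigma> b y \<epsilon> :: real and \<nu> :: "real measure" and s c :: "real \<Rightarrow> real"
  assumes "0 < y" and "0 < \<epsilon>" and "\<epsilon> < min (y / 2) 1"
    and "truncation_function \<epsilon> c"
    and "levy_process_with_triplet M X (\<sigma>\<^sup>2) b \<nu>"
    and "has_density \<nu> s"
    and "bounded (s ` (- {-\<epsilon>..\<epsilon>}))"
    and "\<exists>U. open U \<and> y \<in> U \<and> s C1_differentiable_on U"
  shows "\<exists>d\<^sub>2.
    ((\<lambda>t. 1 / t * (1 / t * measure M {\<omega> \<in> space M. X t \<omega> \<ge> y} - measure \<nu> {y..}))
        \<longlongrightarrow> d\<^sub>2 / 2) (at_right 0) \<and>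
    d\<^sub>2 / 2 =
      - (\<sigma>\<^sup>2 / 2) * deriv s y
      + truncated_drift c b \<nu> * s y
      + (LINT x|lborel. (LBINT u=0..x. s (y - u) - s y) * small_part c s x)
      + 1 / 2 * (LINT x|lborel. LINT u|lborel.
            indicator {(x, u). x + u \<ge> y} (x, u) * large_part c s u * large_part c s x)
      - large_jump_intensity c \<nu> * measure \<nu> {y..}"
proof -
  \<comment> \<open>The triplet determines the Gaussian coefficient up to sign, so the witness
    \<open>\<tau>\<close> may differ from \<open>\<sigma>\<close>; only its square enters the
    result.\<close>
  obtain \<tau> W \<mu> J where \<tau>: "\<sigma>\<^sup>2 = \<tau>\<^sup>2"
    and W: "standard_brownian_motion M W"
    and \<mu>: "poisson_random_measure M \<mu> (jump_mean_measure \<nu>)"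
    and indep: "independent_of_random_measure M W \<mu> (jump_mean_measure \<nu>)"
    and J: "\<And>t. 0 \<le> t \<Longrightarrow> compensated_jumps M \<mu> (jump_mean_measure \<nu>) t (J t)"
    and X_eq: "\<And>t. 0 \<le> t \<Longrightarrow> AE \<omega> in M. X t \<omega> = b * t + \<tau> * W t \<omega> + J t \<omega>
                            + (LINT p:{0..t} \<times> {x. 1 < \<bar>x\<bar>}|\<mu> \<omega>. snd p)"
    and levy: "levy_process M X" "levy_measure \<nu>"
    using assms(5) unfolding levy_process_with_triplet_def by blast
  have \<nu>: "\<nu> = density lborel (\<lambda>x. ennreal (s x))"
    using assms(6) by (simp add: has_density_def)
  interpret levy_density s
    by (rule levy_density_of_measure) fact+
  interpret prob_space M
    using levy(1) by (simp add: levy_process_def)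
  have X[measurable]: "X t \<in> borel_measurable M" if "0 \<le> t" for t
    using levy(1) that by (simp add: levy_process_def real_process_def)
  have c: "c \<in> borel_measurable borel"
    by (rule truncation_function_measurable[OF assms(4)])
  have c_bounds: "indicator {- \<epsilon> / 2..\<epsilon> / 2} x \<le> c x" "c x \<le> indicator {- \<epsilon>..\<epsilon>} x" for x
    using assms(4) by (simp_all add: truncation_function_def)
  obtain U where U: "open U" "y \<in> U" "s C1_differentiable_on U" using assms(8) by blast
  then obtain e where e: "0 < e" "cball y e \<subseteq> U" using open_contains_cball by blast
  \<comment> \<open>Bounding the radius by y / 2 keeps the interval inside the positive half-line,
    where the tail is finite.\<close>
  define \<rho> where "\<rho> = min e (y / 2)"
  have \<rho>: "0 < \<rho>" "\<rho> < y" using e assms(1) by (auto simp: \<rho>_def)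
  have "{y - \<rho>..y + \<rho>} \<subseteq> cball y e"
    by (auto simp: \<rho>_def dist_real_def abs_le_iff)
  then have "{y - \<rho>..y + \<rho>} \<subseteq> U"
    using e(2) by blast
  then have cont: "continuous_on {y - \<rho>..y + \<rho>} s"
    using C1_differentiable_imp_continuous_on[OF U(3)] continuous_on_subset by blast
  have "s differentiable at y"
    using U by (simp add: C1_differentiable_on_eq)
  then have s': "(s has_real_derivative deriv s y) (at y)"
    using DERIV_deriv_iff_real_differentiable by blast
  define D where "D = - (\<sigma>\<^sup>2 / 2) * deriv s y
      + truncated_drift c b \<nu> * s y
      + (LINT x|lborel. (LBINT u=0..x. s (y - u) - s y) * small_part c s x)
      + 1 / 2 * (LINT x|lborel. LINT u|lborel.
            indicator {(x, u). x + u \<ge> y} (x, u) * large_part c s u * large_part c s x)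
      - large_jump_intensity c \<nu> * measure \<nu> {y..}"
  have drift: "truncated_drift c b \<nu> = b - (LINT x|lborel. s x * (indicator {x. \<bar>x\<bar> \<le> 1} x * (x * (1 - c x))))"
    unfolding truncated_drift_def set_lebesgue_integral_def \<nu> using c by (subst integral_levy(1)) auto
  have intensity: "large_jump_intensity c \<nu> = (LINT x|lborel. s x * (1 - c x))"
    unfolding large_jump_intensity_def \<nu> using c by (subst integral_levy(1)) auto
  have tail_y: "measure \<nu> {y..} = tail y"
    unfolding \<nu> by (rule measure_tail[OF assms(1)])
  \<comment> \<open>The assumption \<epsilon> < y / 2 enters here, as 2 \<epsilon> < y.\<close>
  have sharp: "sharp_coefficient \<tau> b y (deriv s y) \<delta> = D" if "0 < \<delta>" "\<delta> \<le> \<epsilon> / 2" for \<delta>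
    unfolding D_def drift intensity tail_y \<tau>
    by (rule truncation_invariance[OF \<rho> cont s' that _ _ c c_bounds, symmetric]) (use assms(3) in auto)
  define L where "L t = distr M borel (X t)" for t
  have L: "real_distribution (L t)" if "0 < t" for t
    unfolding L_def using that by (intro real_distribution_distr X) auto
  have "((\<lambda>t. 1 / t * (1 / t * measure (L t) {y..} - tail y)) \<longlongrightarrow> D) (at_right 0)"
  proof (rule tail_second_order_limit[OF \<rho> cont s' _ sharp L])
    show "0 < \<epsilon> / 2" using assms(2) by simp
    fix \<delta> t :: real assume \<delta>: "0 < \<delta>" "\<delta> < 1" and t: "0 < t"
    interpret levy_ito s M \<mu> W t
      using W \<mu> indep t unfolding \<nu> by unfold_locales auto
    have [measurable]: "X t \<in> borel_measurable M" using t by (intro X) auto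
    have "0 \<le> t" using t by simp
    note J' = J[OF this, unfolded \<nu>] and X_eq' = X_eq[OF this]
    obtain Z where Z[measurable]: "Z \<in> borel_measurable M"
      and char: "\<And>u. (CLINT \<omega>|M. iexp (u * X t \<omega>)) = (CLINT \<omega>|M. iexp (u * Z \<omega>)) * exp (of_real t * big_exponent \<delta> u)"
        "\<And>u. (CLINT \<omega>|M. iexp (u * Z \<omega>)) =
          exp (of_real t * (\<i> * of_real (u * (b - mid_drift \<delta>)) - of_real (\<tau>\<^sup>2 * u\<^sup>2 / 2) + small_exponent \<delta> u))"
      and mgf: "\<And>u. (\<integral>\<^sup>+\<omega>. ennreal (exp (u * Z \<omega>)) \<partial>M)
          \<le> ennreal (exp (t * (u * (b - mid_drift \<delta>) + \<tau>\<^sup>2 * u\<^sup>2 / 2 + u\<^sup>2 * exp (\<bar>u\<bar> * \<delta>) * V)))"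
      using law_decomposition[OF \<delta> _ J' X_eq'] by auto
    have char_distr: "char (distr M borel Y) u = (CLINT \<omega>|M. iexp (u * Y \<omega>))" if "Y \<in> borel_measurable M" for Y u
      unfolding char_def using that by (subst integral_distr) auto
    show "\<exists>R. real_distribution R \<and>
      (\<forall>u. char (L t) u = char R u * exp (of_real t * big_exponent \<delta> u)) \<and>
      (\<forall>u. char R u = exp (of_real t * (\<i> * of_real (u * (b - mid_drift \<delta>)) - of_real (\<tau>\<^sup>2 * u\<^sup>2 / 2) + small_exponent \<delta> u))) \<and>
      (\<forall>u. (\<integral>\<^sup>+z. ennreal (exp (u * z)) \<partial>R)
        \<le> ennreal (exp (t * (u * (b - mid_drift \<delta>) + \<tau>\<^sup>2 * u\<^sup>2 / 2 + u\<^sup>2 * exp (\<bar>u\<bar> * \<delta>) * V))))"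
    proof (intro exI[of _ "distr M borel Z"] conjI allI)
      show "real_distribution (distr M borel Z)" by (rule real_distribution_distr) (rule Z)
      fix u
      show "char (L t) u = char (distr M borel Z) u * exp (of_real t * big_exponent \<delta> u)"
        unfolding L_def by (simp only: char_distr[OF Z] char_distr[OF \<open>X t \<in> borel_measurable M\<close>] char(1))
      show "char (distr M borel Z) u = exp (of_real t * (\<i> * of_real (u * (b - mid_drift \<delta>)) - of_real (\<tau>\<^sup>2 * u\<^sup>2 / 2) + small_exponent \<delta> u))"
        by (simp only: char_distr[OF Z] char(2))
      show "(\<integral>\<^sup>+z. ennreal (exp (u * z)) \<partial>distr M borel Z)
        \<le> ennreal (exp (t * (u * (b - mid_drift \<delta>) + \<tau>\<^sup>2 * u\<^sup>2 / 2 + u\<^sup>2 * exp (\<bar>u\<bar> * \<delta>) * V)))"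
        by (subst nn_integral_distr) (auto intro: mgf)
    qed
  qed
  moreover have "\<forall>\<^sub>F t in at_right 0. 1 / t * (1 / t * measure (L t) {y..} - tail y)
      = 1 / t * (1 / t * measure M {\<omega> \<in> space M. X t \<omega> \<ge> y} - measure \<nu> {y..})"
  proof -
    have "measure (L t) {y..} = measure M {\<omega> \<in> space M. X t \<omega> \<ge> y}" if "0 < t" for t
      unfolding L_def using X[of t] that
      by (subst measure_distr) (auto intro!: arg_cong[where f = "measure M"])
    then show ?thesis
      unfolding tail_y by (auto simp: eventually_at_right_field intro!: exI[of _ 1])
  qed
  ultimately have "((\<lambda>t. 1 / t * (1 / t * measure M {\<omega> \<in> space M. X t \<omega> \<ge> y} - measure \<nu> {y..})) \<longlongrightarrow> D) (at_right 0)"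
    by (rule Lim_transform_eventually)
  then show ?thesis
    unfolding D_def[symmetric] by (intro exI[of _ "2 * D"]) simp
qed

end
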